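(* In the setting below, the global scattering operator $\mathrm{S}:G_h\to G_h$ satisfies $\|\mathrm{S}(g)\|<\|g\|$ for all $g\in G_h\setminus\{0\}$.
   Context: $\Omega\subset\mathbb{R}^d$ ($d=2,3$) is a Lipschitz polytopal domain with a conforming simplicial mesh $\mathcal{T}_h$; $\mathcal{F}_K$ is the set of faces of $K\in\mathcal{T}_h$. Fix $\mathrm{p}\ge0$; $\kappa$ and $\eta$ are strictly positive real coefficients constant on each element, with values $\kappa_K,\eta_K$ on $K$. $\mathcal{P}_\mathrm{p}(\cdot)$, $\boldsymbol{\mathcal{P}}_\mathrm{p}(\cdot)$ are spaces of complex scalar/$\mathbb{C}^d$-valued polynomials of degree $\le\mathrm{p}$; $(u,v)_K:=\int_K u\overline{v}$, $\langle u,v\rangle_F:=\int_F u\overline{v}$; $\mathbf{n}_{K,F}$ is the unit normal on $F$ outward from $K$. For each face $F$ of the mesh, $\mathcal{A}_F:\mathcal{P}_\mathrm{p}(F)\to\mathcal{P}_\mathrm{p}(F)$ is a linear operator (depending only on $F$, not on the adjacent element), self-adjoint for $\langle\cdot,\cdot\rangle_F$ and positive ($\langle\mathcal{A}_F\phi,\phi\rangle_F>0$ for $\phi\neq0$); $\|u\|_F:=\sqrt{\langle\mathcal{A}_F u,u\rangle_F}$. Let $G_h:=\prod_{K\in\mathcal{T}_h}\prod_{F\in\mathcal{F}_K}\mathcal{P}_\mathrm{p}(F)$ (one component $g_{K,F}$ per face of each element) with norm $\|g\|:=\big(\sum_{K}\sum_{F\in\mathcal{F}_K}\|g_{K,F}\|_F^2\big)^{1/2}$.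 For $g\in G_h$ and each $K$, let $(p_K,\mathbf{u}_K)\in\mathcal{P}_\mathrm{p}(K)\times\boldsymbol{\mathcal{P}}_\mathrm{p}(K)$ be the unique solution of: for all $(q_K,\mathbf{v}_K)$ in the same space, $$-\imath(\kappa_K\eta_K^{-1}p_K,q_K)_K-(\mathbf{u}_K,\nabla q_K)_K+\sum_{F\in\mathcal{F}_K}\tfrac12\langle\mathcal{A}_F^{-1}p_K+\mathbf{n}_{K,F}\cdot\mathbf{u}_K,q_K\rangle_F=\sum_{F\in\mathcal{F}_K}\tfrac12\langle g_{K,F},q_K\rangle_F,$$ $$-\imath(\kappa_K\eta_K\mathbf{u}_K,\mathbf{v}_K)_K-(p_K,\nabla\cdot\mathbf{v}_K)_K+\sum_{F\in\mathcal{F}_K}\tfrac12\langle p_K+\mathcal{A}_F(\mathbf{n}_{K,F}\cdot\mathbf{u}_K),\mathbf{n}_{K,F}\cdot\mathbf{v}_K\rangle_F=-\sum_{F\in\mathcal{F}_K}\tfrac12\langle\mathcal{A}_F g_{K,F},\mathbf{n}_{K,F}\cdot\mathbf{v}_K\rangle_F.$$ The scattering operator is $\mathrm{S}(g)|_{K,F}:=\mathcal{A}_F^{-1}p_K|_F+\mathbf{n}_{K,F}\cdot\mathbf{u}_K|_F$. *)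

theory Defs
  imports "HOL-Analysis.Analysis"
begin

definition mono_exps :: "nat \<Rightarrow> ('d::finite \<Rightarrow> nat) set" where
  "mono_exps p = {\<alpha>. sum \<alpha> UNIV \<le> p}"

definition poly_fun :: "nat \<Rightarrow> (real^'d::finite \<Rightarrow> complex) \<Rightarrow> bool" where
  "poly_fun p f \<longleftrightarrow> (\<exists>c :: ('d \<Rightarrow> nat) \<Rightarrow> complex.
      f = (\<lambda>x. \<Sum>\<alpha>\<in>mono_exps p. c \<alpha> * (\<Prod>i\<in>UNIV. complex_of_real ((x $ i) ^ \<alpha> i))))"

definition vpoly_fun :: "nat \<Rightarrow> (real^'d::finite \<Rightarrow> complex^'d) \<Rightarrow> bool" where
  "vpoly_fun p u \<longleftrightarrow> (\<forall>i. poly_fun p (\<lambda>x. u x $ i))"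

text \<open>Extension by zero outside a set (used to represent traces on faces).\<close>
definition restr :: "'a set \<Rightarrow> ('a \<Rightarrow> complex) \<Rightarrow> 'a \<Rightarrow> complex" where
  "restr S f = (\<lambda>x. if x \<in> S then f x else 0)"

text \<open>P_p(F) for the face with vertex set W: traces on conv W of polynomials, zero outside.\<close>
definition PF :: "nat \<Rightarrow> (real^'d::finite) set \<Rightarrow> (real^'d \<Rightarrow> complex) set" where
  "PF p W = {f. \<exists>q. poly_fun p q \<and> f = restr (convex hull W) q}"

definition pdiff :: "'d::finite \<Rightarrow> (real^'d \<Rightarrow> complex) \<Rightarrow> real^'d \<Rightarrow> complex" where
  "pdiff i f x = vector_derivative (\<lambda>t. f (x + t *\<^sub>R axis i 1)) (at 0)"

definition cgrad :: "(real^'d::finite \<Rightarrow> complex) \<Rightarrow> real^'d \<Rightarrow> complex^'d" where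
  "cgrad f x = (\<chi> i. pdiff i f x)"

definition cdiv :: "(real^'d::finite \<Rightarrow> complex^'d) \<Rightarrow> real^'d \<Rightarrow> complex" where
  "cdiv u x = (\<Sum>i\<in>UNIV. pdiff i (\<lambda>y. u y $ i) x)"

definition simplex_verts :: "(real^'d::finite) set \<Rightarrow> bool" where
  "simplex_verts V \<longleftrightarrow> finite V \<and> card V = CARD('d) + 1 \<and> \<not> affine_dependent V"

definition faces :: "'a set \<Rightarrow> 'a set set" where
  "faces V = (\<lambda>v. V - {v}) ` V"

text \<open>Conforming simplicial mesh of the polytopal domain Omega; elements are given by
  their vertex sets.\<close>
definition conforming_mesh :: "(real^'d::finite) set \<Rightarrow> (real^'d) set set \<Rightarrow> bool" where
  "conforming_mesh \<Omega> T \<longleftrightarrow> finite T \<and> T \<noteq> {} \<and> (\<forall>V\<in>T. simplex_verts V)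
     \<and> (\<forall>V1\<in>T. \<forall>V2\<in>T. convex hull V1 \<inter> convex hull V2 = convex hull (V1 \<inter> V2))
     \<and> closure \<Omega> = (\<Union>V\<in>T. convex hull V)"

definition polytopal_domain :: "(real^'d::finite) set \<Rightarrow> bool" where
  "polytopal_domain \<Omega> \<longleftrightarrow> open \<Omega> \<and> connected \<Omega> \<and> bounded \<Omega> \<and> \<Omega> \<noteq> {}
     \<and> interior (closure \<Omega>) = \<Omega>"

definition onormal :: "(real^'d::finite) set \<Rightarrow> (real^'d) set \<Rightarrow> real^'d" where
  "onormal V W = (THE n. norm n = 1 \<and> (\<forall>w\<in>W. \<forall>w'\<in>W. n \<bullet> (w - w') = 0)
                       \<and> (\<forall>w\<in>W. \<forall>v\<in>V - W. n \<bullet> (v - w) < 0))"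

definition ndot :: "real^'d::finite \<Rightarrow> ('a \<Rightarrow> complex^'d) \<Rightarrow> 'a \<Rightarrow> complex" where
  "ndot n u = (\<lambda>x. \<Sum>i\<in>UNIV. complex_of_real (n $ i) * u x $ i)"

definition vol_ip :: "(real^'d::finite) set \<Rightarrow> (real^'d \<Rightarrow> complex) \<Rightarrow> (real^'d \<Rightarrow> complex) \<Rightarrow> complex" where
  "vol_ip K a b = integral K (\<lambda>x. a x * cnj (b x))"

definition vvol_ip :: "(real^'d::finite) set \<Rightarrow> (real^'d \<Rightarrow> complex^'d) \<Rightarrow> (real^'d \<Rightarrow> complex^'d) \<Rightarrow> complex" where
  "vvol_ip K a b = integral K (\<lambda>x. \<Sum>i\<in>UNIV. a x $ i * cnj (b x $ i))"

text \<open>Surface integral over the (d-1)-simplex F = conv W, via an affine parametrisation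
  over the standard (m)-simplex, m = card W - 1, with Gram-determinant Jacobian.\<close>
definition face_list :: "'a set \<Rightarrow> 'a list" where
  "face_list W = (SOME ws. distinct ws \<and> set ws = W)"

definition face_edge :: "(real^'d::finite) set \<Rightarrow> nat \<Rightarrow> real^'d" where
  "face_edge W i = face_list W ! Suc i - face_list W ! 0"

definition face_param :: "(real^'d::finite) set \<Rightarrow> (nat \<Rightarrow> real) \<Rightarrow> real^'d" where
  "face_param W s = face_list W ! 0 + (\<Sum>i<card W - 1. s i *\<^sub>R face_edge W i)"

definition gram_det :: "(real^'d::finite) set \<Rightarrow> real" where
  "gram_det W = (\<Sum>\<pi> | \<pi> permutes {..<card W - 1}. real_of_int (sign \<pi>) *
                    (\<Prod>i<card W - 1. face_edge W i \<bullet> face_edge W (\<pi> i)))"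

definition std_simplex :: "nat \<Rightarrow> (nat \<Rightarrow> real) set" where
  "std_simplex m = {s \<in> {..<m} \<rightarrow>\<^sub>E UNIV. (\<forall>i<m. 0 \<le> s i) \<and> sum s {..<m} \<le> 1}"

definition face_int :: "(real^'d::finite) set \<Rightarrow> (real^'d \<Rightarrow> complex) \<Rightarrow> complex" where
  "face_int W f = complex_of_real (sqrt (gram_det W)) *
     set_lebesgue_integral (Pi\<^sub>M {..<card W - 1} (\<lambda>_. lborel)) (std_simplex (card W - 1))
        (\<lambda>s. f (face_param W s))"

definition fip :: "(real^'d::finite) set \<Rightarrow> (real^'d \<Rightarrow> complex) \<Rightarrow> (real^'d \<Rightarrow> complex) \<Rightarrow> complex" where
  "fip W a b = face_int W (\<lambda>x. a x * cnj (b x))"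

definition admissible_face_op ::
  "nat \<Rightarrow> (real^'d::finite) set \<Rightarrow> ((real^'d \<Rightarrow> complex) \<Rightarrow> (real^'d \<Rightarrow> complex)) \<Rightarrow> bool" where
  "admissible_face_op p W Af \<longleftrightarrow>
     (\<forall>\<phi>\<in>PF p W. Af \<phi> \<in> PF p W)
   \<and> (\<forall>\<phi>\<in>PF p W. \<forall>\<psi>\<in>PF p W. \<forall>a b::complex.
        Af (\<lambda>x. a * \<phi> x + b * \<psi> x) = (\<lambda>x. a * Af \<phi> x + b * Af \<psi> x))
   \<and> (\<forall>\<phi>\<in>PF p W. \<forall>\<psi>\<in>PF p W. fip W (Af \<phi>) \<psi> = fip W \<phi> (Af \<psi>))
   \<and> (\<forall>\<phi>\<in>PF p W. \<phi> \<noteq> (\<lambda>_. 0) \<longrightarrow> Re (fip W (Af \<phi>) \<phi>) > 0)"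

definition face_op_inv ::
  "nat \<Rightarrow> (real^'d::finite) set \<Rightarrow> ((real^'d \<Rightarrow> complex) \<Rightarrow> (real^'d \<Rightarrow> complex))
     \<Rightarrow> (real^'d \<Rightarrow> complex) \<Rightarrow> (real^'d \<Rightarrow> complex)" where
  "face_op_inv p W Af \<psi> = (THE \<phi>. \<phi> \<in> PF p W \<and> Af \<phi> = \<psi>)"

definition face_norm ::
  "(real^'d::finite) set \<Rightarrow> ((real^'d \<Rightarrow> complex) \<Rightarrow> (real^'d \<Rightarrow> complex)) \<Rightarrow> (real^'d \<Rightarrow> complex) \<Rightarrow> real" where
  "face_norm W Af u = sqrt (Re (fip W (Af u) u))"

text \<open>An element g of G_h assigns to each element (vertex set V) and each of its faces
  (vertex set W) a component g V W in P_p(F).\<close>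
definition in_Gh :: "nat \<Rightarrow> (real^'d::finite) set set
    \<Rightarrow> ((real^'d) set \<Rightarrow> (real^'d) set \<Rightarrow> real^'d \<Rightarrow> complex) \<Rightarrow> bool" where
  "in_Gh p T g \<longleftrightarrow> (\<forall>V\<in>T. \<forall>W\<in>faces V. g V W \<in> PF p W)"

definition Gh_norm :: "(real^'d::finite) set set
    \<Rightarrow> ((real^'d) set \<Rightarrow> (real^'d \<Rightarrow> complex) \<Rightarrow> (real^'d \<Rightarrow> complex))
    \<Rightarrow> ((real^'d) set \<Rightarrow> (real^'d) set \<Rightarrow> real^'d \<Rightarrow> complex) \<Rightarrow> real" where
  "Gh_norm T A g = sqrt (\<Sum>V\<in>T. \<Sum>W\<in>faces V. (face_norm W (A W) (g V W))\<^sup>2)"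

definition local_eqs :: "nat \<Rightarrow> ((real^'d::finite) set \<Rightarrow> (real^'d \<Rightarrow> complex) \<Rightarrow> (real^'d \<Rightarrow> complex))
    \<Rightarrow> real \<Rightarrow> real \<Rightarrow> (real^'d) set
    \<Rightarrow> ((real^'d) set \<Rightarrow> real^'d \<Rightarrow> complex)
    \<Rightarrow> (real^'d \<Rightarrow> complex) \<Rightarrow> (real^'d \<Rightarrow> complex^'d) \<Rightarrow> bool" where
  "local_eqs p A \<kappa> \<eta> V gV P U \<longleftrightarrow>
    (\<forall>q. poly_fun p q \<longrightarrow>
       - \<i> * complex_of_real (\<kappa> / \<eta>) * vol_ip (convex hull V) P q
       - vvol_ip (convex hull V) U (cgrad q)
       + (\<Sum>W\<in>faces V. 1/2 * fip W (\<lambda>x. face_op_inv p W (A W) (restr (convex hull W) P) x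
                                        + ndot (onormal V W) U x) q)
     = (\<Sum>W\<in>faces V. 1/2 * fip W (gV W) q))
  \<and> (\<forall>v. vpoly_fun p v \<longrightarrow>
       - \<i> * complex_of_real (\<kappa> * \<eta>) * vvol_ip (convex hull V) U v
       - vol_ip (convex hull V) P (cdiv v)
       + (\<Sum>W\<in>faces V. 1/2 * fip W (\<lambda>x. P x + A W (restr (convex hull W) (ndot (onormal V W) U)) x)
                                    (ndot (onormal V W) v))
     = - (\<Sum>W\<in>faces V. 1/2 * fip W (A W (gV W)) (ndot (onormal V W) v)))"

definition local_sol :: "nat \<Rightarrow> ((real^'d::finite) set \<Rightarrow> (real^'d \<Rightarrow> complex) \<Rightarrow> (real^'d \<Rightarrow> complex))
    \<Rightarrow> real \<Rightarrow> real \<Rightarrow> (real^'d) set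
    \<Rightarrow> ((real^'d) set \<Rightarrow> real^'d \<Rightarrow> complex)
    \<Rightarrow> (real^'d \<Rightarrow> complex) \<times> (real^'d \<Rightarrow> complex^'d)" where
  "local_sol p A \<kappa> \<eta> V gV = (THE (P, U). poly_fun p P \<and> vpoly_fun p U \<and> local_eqs p A \<kappa> \<eta> V gV P U)"

definition scatter :: "nat \<Rightarrow> ((real^'d::finite) set \<Rightarrow> (real^'d \<Rightarrow> complex) \<Rightarrow> (real^'d \<Rightarrow> complex))
    \<Rightarrow> ((real^'d) set \<Rightarrow> real) \<Rightarrow> ((real^'d) set \<Rightarrow> real)
    \<Rightarrow> ((real^'d) set \<Rightarrow> (real^'d) set \<Rightarrow> real^'d \<Rightarrow> complex)
    \<Rightarrow> (real^'d) set \<Rightarrow> (real^'d) set \<Rightarrow> real^'d \<Rightarrow> complex" where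
  "scatter p A \<kappa> \<eta> g V W =
     (let (P, U) = local_sol p A (\<kappa> V) (\<eta> V) V (g V) in
      (\<lambda>x. face_op_inv p W (A W) (restr (convex hull W) P) x
           + restr (convex hull W) (ndot (onormal V W) U) x))"

end

theory Submission
  imports Defs "HOL-Library.Function_Algebras"
begin

text \<open>
  On one element put \<open>a = A\<inverse> p\<close> and \<open>b = n \<cdot> u\<close> on each face. Testing the first equation with
  \<open>p\<close>, the second with \<open>u\<close>, and integrating by parts gives, after taking real parts and summing
  over the faces, \<open>\<Sum> \<parallel>a\<parallel>\<^sup>2 + \<parallel>b\<parallel>\<^sup>2 = \<Sum> Re \<langle>g, a - b\<rangle>\<^sub>A\<close>. Since \<open>S g = a + b\<close>, the parallelogram
  identity turns this into \<open>\<parallel>S g\<parallel>\<^sup>2 = \<parallel>g\<parallel>\<^sup>2 - \<parallel>g - (a - b)\<parallel>\<^sup>2\<close>. If the last term vanishes, the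
  variational equations collapse to the strong ones \<open>div u = \<i> (\<kappa> / \<eta>) p\<close> and
  \<open>grad p = \<i> \<kappa> \<eta> u\<close>, whose only polynomial solution is zero, so \<open>g = 0\<close> on that element. The case
  \<open>g = 0\<close> also shows that the local problem is injective, hence uniquely solvable.

  Integration by parts reduces to the divergence theorem for polynomials on a simplex. It is linear,
  so it suffices to check monomials in the barycentric coordinates \<open>\<lambda>\<^sub>v\<close>: their integrals over the
  simplex and over its faces are Dirichlet integrals, the volume is base times height, and
  \<open>\<Sum>\<^sub>v grad \<lambda>\<^sub>v = 0\<close> gives the identity.
\<close>

section \<open>Linear algebra\<close>

text \<open>\<open>scatter\<close> rests on two definite descriptions, \<open>face_op_inv\<close>
  and \<open>local_sol\<close>, so nothing can be said about it before each face operator is known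
  to be bijective and each local problem to be uniquely solvable. Both follow from one
  finite-dimensional principle: a nondegenerate sesquilinear form represents every antilinear
  functional. There each unknown is a multiple of derivatives of the other, so its degree can be
  lowered again and again. The other obstacle is that volume integrals are taken over subsets of
  \<open>real^'d\<close> but face integrals over simplices of index functions, weighted by a Gram
  determinant. The volume integral is therefore pulled back to a standard simplex as well, so that
  one Dirichlet formula evaluates both, in dimensions d and d - 1; differentiation lowers the degree
  by one and makes up for the difference.\<close>

lemma (in vector_space) injective_endomorphism_onto:
  assumes S: "subspace S" and F: "finite F" "S \<subseteq> span F"
    and T: "\<And>x. x \<in> S \<Longrightarrow> T x \<in> S"
    and T_add: "\<And>x y. x \<in> S \<Longrightarrow> y \<in> S \<Longrightarrow> T (x + y) = T x + T y"
    and T_scale: "\<And>c x. x \<in> S \<Longrightarrow> T (scale c x) = scale c (T x)"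
    and T_ker: "\<And>x. x \<in> S \<Longrightarrow> T x = 0 \<Longrightarrow> x = 0"
    and y: "y \<in> S"
  shows "\<exists>x\<in>S. T x = y"
proof -
  obtain B where B: "B \<subseteq> S" "independent B" "S \<subseteq> span B"
    using maximal_independent_subset by blast
  have finB: "finite B"
    using independent_span_bound[OF F(1) B(2)] B(1) F(2) by blast
  have T0: "T 0 = 0"
    using T_scale[of 0 0] subspace_0[OF S] by simp
  have sum_in: "(\<Sum>b\<in>X. scale (c b) b) \<in> S" if "X \<subseteq> B" for c X
    using that B(1) by (intro subspace_sum[OF S] subspace_scale[OF S]) auto
  have T_sum: "T (\<Sum>b\<in>X. scale (c b) b) = (\<Sum>b\<in>X. scale (c b) (T b))" if "finite X" "X \<subseteq> B" for c X
    using that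
  proof (induction X rule: finite_induct)
    case (insert b X)
    then show ?case
      using B(1) sum_in[of X c] by (simp add: T_add T_scale subspace_scale[OF S] subset_iff)
  qed (simp add: T0)
  have zero: "\<forall>b\<in>B. c b = 0" if "(\<Sum>b\<in>B. scale (c b) (T b)) = 0" for c
  proof -
    have "(\<Sum>b\<in>B. scale (c b) b) = 0"
      using that T_sum[OF finB order_refl, of c] T_ker[OF sum_in[OF order_refl]] by simp
    then show ?thesis
      using B(2) finB independent_explicit_finite_subsets by blast
  qed
  have inj: "inj_on T B"
  proof (rule inj_onI)
    fix b b' assume b: "b \<in> B" "b' \<in> B" "T b = T b'"
    have "T (b + scale (-1) b') = T b + scale (-1) (T b')"
      using b B(1) T_add T_scale subspace_scale[OF S] by (metis subset_iff)
    then have "T (b + scale (-1) b') = 0" using b by simp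
    moreover have "b + scale (-1) b' \<in> S"
      using b B(1) subspace_add[OF S] subspace_scale[OF S] by blast
    ultimately have "b + scale (-1) b' = 0" using T_ker by blast
    then show "b = b'" by simp
  qed
  have ind: "independent (T ` B)"
  proof (rule independent_if_scalars_zero)
    show "finite (T ` B)" using finB by simp
    fix f x assume "(\<Sum>x\<in>T ` B. scale (f x) x) = 0" "x \<in> T ` B"
    then show "f x = 0" using zero[of "f \<circ> T"] by (auto simp: sum.reindex[OF inj])
  qed
  \<comment> \<open>Otherwise \<open>y\<close> and the image of \<open>B\<close> would be
    \<open>card B + 1\<close> independent vectors inside \<open>span B\<close>.\<close>
  have "y \<in> span (T ` B)"
  proof (rule ccontr)
    assume n: "y \<notin> span (T ` B)"
    then have "y \<notin> T ` B" using span_superset[of "T ` B"] by auto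
    then have "card (insert y (T ` B)) = Suc (card B)"
      using finB by (simp add: card_image[OF inj])
    moreover have "independent (insert y (T ` B))"
      using n ind by (rule independent_insertI)
    moreover have "insert y (T ` B) \<subseteq> span B"
      using y B T by blast
    ultimately show False
      using independent_span_bound[OF finB] by (metis Suc_n_not_le_n)
  qed
  then obtain u where "y = (\<Sum>v\<in>T ` B. scale (u v) v)"
    using span_finite[of "T ` B"] finB by auto
  then have "y = T (\<Sum>b\<in>B. scale (u (T b)) b)"
    using T_sum[OF finB order_refl, of "u \<circ> T"] by (simp add: sum.reindex[OF inj])
  then show ?thesis using sum_in[OF order_refl, of "u \<circ> T"] by auto
qed

text \<open>Over a basis, matching \<open>a x\<close> with \<open>l\<close> is a square linear
  system; nondegeneracy says that its kernel is trivial, which makes it solvable. This replaces the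
  Riesz theorem for a form that need not be positive.\<close>

lemma nondegenerate_form_represents:
  fixes S :: "('i \<Rightarrow> complex) set" and F :: "'k \<Rightarrow> 'i \<Rightarrow> complex"
    and a :: "('i \<Rightarrow> complex) \<Rightarrow> ('i \<Rightarrow> complex) \<Rightarrow> complex"
  assumes I: "finite I" and F: "\<And>x. x \<in> S \<Longrightarrow> \<exists>c. x = (\<lambda>i. \<Sum>k\<in>I. c k * F k i)"
    and zero: "(\<lambda>_. 0) \<in> S"
    and comb: "\<And>x y c d. x \<in> S \<Longrightarrow> y \<in> S \<Longrightarrow> (\<lambda>i. c * x i + d * y i) \<in> S"
    and a_left: "\<And>x y z c d. x \<in> S \<Longrightarrow> y \<in> S \<Longrightarrow> z \<in> S \<Longrightarrow>
        a (\<lambda>i. c * x i + d * y i) z = c * a x z + d * a y z"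
    and a_right: "\<And>x y z c d. x \<in> S \<Longrightarrow> y \<in> S \<Longrightarrow> z \<in> S \<Longrightarrow>
        a z (\<lambda>i. c * x i + d * y i) = cnj c * a z x + cnj d * a z y"
    and l: "\<And>x y c d. x \<in> S \<Longrightarrow> y \<in> S \<Longrightarrow>
        l (\<lambda>i. c * x i + d * y i) = cnj c * l x + cnj d * l y"
    and nondeg: "\<And>x. x \<in> S \<Longrightarrow> (\<And>y. y \<in> S \<Longrightarrow> a x y = 0) \<Longrightarrow> x = (\<lambda>_. 0)"
  shows "\<exists>x\<in>S. \<forall>y\<in>S. a x y = l y"
proof -
  define sc where "sc = (\<lambda>(c::complex) (x::'i \<Rightarrow> complex) i. c * x i)"
  interpret V: vector_space sc
    by standard (auto simp: sc_def fun_eq_iff algebra_simps)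
  have sum_apply: "(\<Sum>k\<in>A. h k) i = (\<Sum>k\<in>A. h k i)"
    for A and h :: "'k \<Rightarrow> 'i \<Rightarrow> complex" and i
    by (induction A rule: infinite_finite_induct) auto
  have add_eq: "x + y = (\<lambda>i. 1 * x i + 1 * y i)" for x y :: "'i \<Rightarrow> complex"
    by (auto simp: fun_eq_iff)
  have sc_eq: "sc c x = (\<lambda>i. c * x i + 0 * x i)" for c x
    by (auto simp: fun_eq_iff sc_def)
  have z: "(0 :: 'i \<Rightarrow> complex) = (\<lambda>_. 0)" by (auto simp: fun_eq_iff)
  have S: "V.subspace S"
    unfolding V.subspace_def z using zero comb unfolding add_eq sc_eq by blast
  have spanF: "S \<subseteq> V.span (F ` I)"
  proof
    fix x assume "x \<in> S"
    then obtain c where "x = (\<lambda>i. \<Sum>k\<in>I. c k * F k i)" using F by blast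
    then have "x = (\<Sum>k\<in>I. sc (c k) (F k))"
      by (simp add: sc_def fun_eq_iff sum_apply)
    then show "x \<in> V.span (F ` I)"
      by (simp add: V.span_sum V.span_scale V.span_base)
  qed
  obtain B where B: "B \<subseteq> S" "V.independent B" "S \<subseteq> V.span B"
    using V.maximal_independent_subset by blast
  have finB: "finite B"
    using V.independent_span_bound[OF finite_imageI[OF I] B(2)] B(1) spanF by blast
  have coef: "\<forall>b\<in>B. c b = 0" if "(\<Sum>b\<in>B. sc (c b) b) = 0" for c
    using that B(2) finB V.independent_explicit_finite_subsets by blast
  have antilinear_zero: "h y = 0"
    if hB: "\<And>b. b \<in> B \<Longrightarrow> h b = 0" and y: "y \<in> S"
      and h: "\<And>x y c d. x \<in> S \<Longrightarrow> y \<in> S \<Longrightarrow> h (\<lambda>i. c * x i + d * y i) = cnj c * h x + cnj d * h y"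
    for h :: "('i \<Rightarrow> complex) \<Rightarrow> complex" and y
  proof -
    have "h y = 0 \<and> y \<in> S" if "y \<in> V.span B"
      using that
    proof (induction rule: V.span_induct_alt)
      case base
      then show ?case using h[OF zero zero, of 0 0] zero by (simp add: z)
    next
      case (step c x y)
      then have "x \<in> S" using B by auto
      moreover have "sc c x + y = (\<lambda>i. c * x i + 1 * y i)" by (auto simp: sc_def fun_eq_iff)
      ultimately show ?case using step h[of x y c 1] hB comb[of x y c 1] by simp
    qed
    then show ?thesis using y B(3) by blast
  qed
  \<comment> \<open>The numbers \<open>a x b\<close> on the basis \<open>B\<close> are reused as
    coordinates of a vector of \<open>S\<close>, so \<open>T\<close> is an endomorphism and no dual
    space is needed. It is linear although \<open>a\<close> is conjugate linear in its second slot,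
    since \<open>x\<close> stands in the first.\<close>
  define T where "T x = (\<Sum>b\<in>B. sc (a x b) b)" for x
  have TS: "(\<Sum>b\<in>B. sc (c b) b) \<in> S" for c
    using B(1) by (intro V.subspace_sum[OF S] V.subspace_scale[OF S]) auto
  have "\<exists>x\<in>S. T x = (\<Sum>b\<in>B. sc (l b) b)"
  proof (rule V.injective_endomorphism_onto[OF S finite_imageI[OF I] spanF])
    show "T x \<in> S" for x unfolding T_def by (rule TS)
    show "T (x + y) = T x + T y" if "x \<in> S" "y \<in> S" for x y
    proof -
      have "a (x + y) b = a x b + a y b" if "b \<in> B" for b
        using a_left[OF \<open>x \<in> S\<close> \<open>y \<in> S\<close>, of b 1 1] B(1) that unfolding add_eq by auto
      then show ?thesis
        by (simp add: T_def V.scale_left_distrib flip: sum.distrib)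
    qed
    show "T (sc c x) = sc c (T x)" if "x \<in> S" for c x
    proof -
      have "a (sc c x) b = c * a x b" if "b \<in> B" for b
        using a_left[OF \<open>x \<in> S\<close> \<open>x \<in> S\<close>, of b c 0] B(1) that unfolding sc_eq by auto
      then show ?thesis by (simp add: T_def V.scale_sum_right)
    qed
    show "x = 0" if "x \<in> S" "T x = 0" for x
    proof -
      have "\<forall>b\<in>B. a x b = 0" using that coef by (auto simp: T_def)
      then have "a x y = 0" if "y \<in> S" for y
        using antilinear_zero[of "a x" y] a_right[OF _ _ \<open>x \<in> S\<close>] that by blast
      then show ?thesis unfolding z using nondeg that by blast
    qed
    show "(\<Sum>b\<in>B. sc (l b) b) \<in> S" by (rule TS)
  qed
  then obtain x where x: "x \<in> S" "T x = (\<Sum>b\<in>B. sc (l b) b)" by blast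
  have "(\<Sum>b\<in>B. sc (a x b - l b) b) = 0"
    using x(2) by (simp add: T_def V.scale_left_diff_distrib sum_subtractf)
  then have eqB: "a x b - l b = 0" if "b \<in> B" for b
    using coef[of "\<lambda>b. a x b - l b"] that by simp
  have "a x y - l y = 0" if "y \<in> S" for y
    by (rule antilinear_zero[where h = "\<lambda>y. a x y - l y"])
      (use eqB that in \<open>simp_all add: a_right[OF _ _ x(1)] l algebra_simps\<close>)
  then show ?thesis using x(1) by auto
qed

section \<open>Polynomials\<close>

text \<open>The class of \<open>poly_fun\<close> recast for induction. The index is only an upper
  bound on the total degree: constants live at every index, and only \<open>coord\<close> raises
  it.\<close>

inductive pdeg :: "nat \<Rightarrow> (real^'d::finite \<Rightarrow> complex) \<Rightarrow> bool" where
  const: "pdeg p (\<lambda>_. c)"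
| add: "pdeg p f \<Longrightarrow> pdeg p g \<Longrightarrow> pdeg p (\<lambda>x. f x + g x)"
| coord: "pdeg p f \<Longrightarrow> pdeg (Suc p) (\<lambda>x. complex_of_real (x $ i) * f x)"

lemma finite_mono_exps [simp]: "finite (mono_exps p :: ('d::finite \<Rightarrow> nat) set)"
proof (rule finite_subset)
  show "mono_exps p \<subseteq> (UNIV :: 'd set) \<rightarrow>\<^sub>E {..p}"
  proof (clarsimp simp: mono_exps_def PiE_def Pi_def)
    fix \<alpha> :: "'d \<Rightarrow> nat" and i assume "sum \<alpha> UNIV \<le> p"
    moreover have "\<alpha> i \<le> sum \<alpha> UNIV" by (rule member_le_sum) auto
    ultimately show "\<alpha> i \<le> p" by simp
  qed
qed (auto intro: finite_PiE)

lemma pdeg_mono: "pdeg p f \<Longrightarrow> p \<le> q \<Longrightarrow> pdeg q f"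
proof (induction arbitrary: q rule: pdeg.induct)
  case (coord p f i)
  then obtain r where "q = Suc r" "p \<le> r" by (cases q) auto
  then show ?case using coord by (auto intro: pdeg.coord)
qed (auto intro: pdeg.intros)

lemma pdeg_sum: "(\<And>a. a \<in> A \<Longrightarrow> pdeg p (f a)) \<Longrightarrow> pdeg p (\<lambda>x. \<Sum>a\<in>A. f a x)"
  by (induction A rule: infinite_finite_induct) (auto intro: pdeg.intros)

lemma pdeg_scale: "pdeg p f \<Longrightarrow> pdeg p (\<lambda>x. c * f x)"
proof (induction rule: pdeg.induct)
  case (coord p f i)
  from pdeg.coord[OF coord.IH, of i] show ?case by (simp add: mult.left_commute)
qed (auto simp: distrib_left intro: pdeg.intros)

lemma pdeg_comb: "pdeg p f \<Longrightarrow> pdeg p g \<Longrightarrow> pdeg p (\<lambda>x. c * f x + d * g x)"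
  by (intro pdeg.add pdeg_scale)

lemma pdeg_mult: "pdeg p f \<Longrightarrow> pdeg q g \<Longrightarrow> pdeg (p + q) (\<lambda>x. f x * g x)"
proof (induction rule: pdeg.induct)
  case (const p c)
  then show ?case by (intro pdeg_scale) (auto intro: pdeg_mono)
next
  case (add p f1 f2)
  then show ?case by (auto simp: distrib_right intro: pdeg.add)
next
  case (coord p f i)
  from pdeg.coord[OF coord.IH[OF coord.prems], of i] show ?case by (simp add: mult.assoc)
qed

lemma pdeg_cnj: "pdeg p f \<Longrightarrow> pdeg p (\<lambda>x. cnj (f x))"
  by (induction rule: pdeg.induct) (auto intro: pdeg.intros)

lemma poly_fun_iff_pdeg: "poly_fun p f \<longleftrightarrow> pdeg p f"
proof
  have mono: "pdeg (sum \<alpha> A) (\<lambda>x. \<Prod>i\<in>A. complex_of_real ((x $ i) ^ \<alpha> i))"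
    if "finite A" for A and \<alpha> :: "'a \<Rightarrow> nat"
    using that
  proof (induction A rule: finite_induct)
    case empty
    then show ?case by (auto intro: pdeg.const)
  next
    case (insert i A)
    have "pdeg n (\<lambda>x. complex_of_real ((x $ i) ^ n))" for n
      by (induction n) (auto intro: pdeg.intros)
    with insert show ?case by (auto intro: pdeg_mult)
  qed
  assume "poly_fun p f"
  then obtain c where "f = (\<lambda>x. \<Sum>\<alpha>\<in>mono_exps p. c \<alpha> * (\<Prod>i\<in>UNIV. complex_of_real ((x $ i) ^ \<alpha> i)))"
    by (auto simp: poly_fun_def)
  then show "pdeg p f"
    by (auto intro!: pdeg_sum pdeg_scale intro: pdeg_mono[OF mono] simp: mono_exps_def
        simp del: of_real_power)
next
  define m where "m \<alpha> x = (\<Prod>i\<in>UNIV. complex_of_real ((x $ i) ^ \<alpha> i))" for \<alpha> :: "'a \<Rightarrow> nat" and x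
  have pf: "poly_fun p f \<longleftrightarrow> (\<exists>c. f = (\<lambda>x. \<Sum>\<alpha>\<in>mono_exps p. c \<alpha> * m \<alpha> x))" for p f
    by (simp add: poly_fun_def m_def)
  assume "pdeg p f"
  then show "poly_fun p f"
  proof (induction rule: pdeg.induct)
    case (const p c)
    have eq: "(\<Sum>\<alpha>\<in>mono_exps p. (if \<alpha> = (\<lambda>_. 0) then c else 0) * m \<alpha> x) = c" for x
    proof -
      have "(\<Sum>\<alpha>\<in>mono_exps p. (if \<alpha> = (\<lambda>_. 0) then c else 0) * m \<alpha> x)
          = (\<Sum>\<alpha>\<in>(mono_exps p :: ('a \<Rightarrow> nat) set). if \<alpha> = (\<lambda>_. 0) then c else 0)"
        by (intro sum.cong) (auto simp: m_def)
      then show ?thesis by (simp add: mono_exps_def finite_mono_exps[unfolded mono_exps_def])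
    qed
    have "(\<lambda>_. c) = (\<lambda>x. \<Sum>\<alpha>\<in>mono_exps p. (if \<alpha> = (\<lambda>_. 0) then c else 0) * m \<alpha> x)"
      by (rule ext) (rule eq[symmetric])
    then show ?case unfolding pf by (rule exI[of _ "\<lambda>\<alpha>. if \<alpha> = (\<lambda>_. 0) then c else 0"])
  next
    case (add p f g)
    then obtain c d where "f = (\<lambda>x. \<Sum>\<alpha>\<in>mono_exps p. c \<alpha> * m \<alpha> x)"
      "g = (\<lambda>x. \<Sum>\<alpha>\<in>mono_exps p. d \<alpha> * m \<alpha> x)" unfolding pf by blast
    then show ?case unfolding pf
      by (intro exI[of _ "\<lambda>\<alpha>. c \<alpha> + d \<alpha>"]) (auto simp: sum.distrib distrib_right)
  next
    case (coord p f i)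
    then obtain c where c: "f = (\<lambda>x. \<Sum>\<alpha>\<in>mono_exps p. c \<alpha> * m \<alpha> x)" unfolding pf by blast
    \<comment> \<open>Multiplication by coordinate \<open>i\<close> moves every exponent along
      \<open>h\<close>. As \<open>h\<close> is injective, the new coefficient at a shifted exponent
      is the old one, and all others are zero.\<close>
    define h where "h \<alpha> = \<alpha>(i := Suc (\<alpha> i))" for \<alpha> :: "'a \<Rightarrow> nat"
    have inj: "inj_on h A" for A
    proof (rule inj_onI, rule ext)
      fix \<alpha> \<beta> j assume "h \<alpha> = h \<beta>"
      then have "h \<alpha> j = h \<beta> j" by simp
      then show "\<alpha> j = \<beta> j" by (auto simp: h_def split: if_splits)
    qed
    have hm: "m (h \<alpha>) x = complex_of_real (x $ i) * m \<alpha> x" for \<alpha> x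
    proof -
      have "m (h \<alpha>) x = complex_of_real (x $ i ^ Suc (\<alpha> i)) * (\<Prod>j\<in>UNIV - {i}. complex_of_real ((x $ j) ^ \<alpha> j))"
        unfolding m_def by (subst prod.remove[of _ i]) (auto simp: h_def)
      also have "\<dots> = complex_of_real (x $ i) * m \<alpha> x"
        unfolding m_def by (subst (2) prod.remove[of _ i]) auto
      finally show ?thesis .
    qed
    have hS: "h ` mono_exps p \<subseteq> mono_exps (Suc p)"
    proof clarify
      fix \<alpha> :: "'a \<Rightarrow> nat" assume "\<alpha> \<in> mono_exps p"
      moreover have "sum (h \<alpha>) UNIV = Suc (sum \<alpha> UNIV)"
      proof -
        have "sum (h \<alpha>) UNIV = Suc (\<alpha> i) + sum \<alpha> (UNIV - {i})"
          by (subst sum.remove[of _ i]) (auto simp: h_def)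
        also have "\<dots> = Suc (sum \<alpha> UNIV)"
          by (subst (2) sum.remove[of _ i]) auto
        finally show ?thesis .
      qed
      ultimately show "h \<alpha> \<in> mono_exps (Suc p)" by (simp add: mono_exps_def)
    qed
    have eq: "complex_of_real (x $ i) * f x
        = (\<Sum>\<alpha>\<in>mono_exps (Suc p). (if \<alpha> \<in> h ` mono_exps p then c (inv_into (mono_exps p) h \<alpha>) else 0) * m \<alpha> x)" for x
    proof -
      have "complex_of_real (x $ i) * f x = (\<Sum>\<alpha>\<in>mono_exps p. c \<alpha> * m (h \<alpha>) x)"
        by (simp add: c sum_distrib_left hm mult.left_commute)
      also have "\<dots> = (\<Sum>\<alpha>\<in>h ` mono_exps p. c (inv_into (mono_exps p) h \<alpha>) * m \<alpha> x)"
        by (simp add: sum.reindex[OF inj] inv_into_f_f[OF inj])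
      also have "\<dots> = (\<Sum>\<alpha>\<in>h ` mono_exps p. (if \<alpha> \<in> h ` mono_exps p then c (inv_into (mono_exps p) h \<alpha>) else 0) * m \<alpha> x)"
        by (rule sum.cong) auto
      also have "\<dots> = (\<Sum>\<alpha>\<in>mono_exps (Suc p). (if \<alpha> \<in> h ` mono_exps p then c (inv_into (mono_exps p) h \<alpha>) else 0) * m \<alpha> x)"
        using hS by (intro sum.mono_neutral_left) auto
      finally show ?thesis .
    qed
    have "(\<lambda>x. complex_of_real (x $ i) * f x) = (\<lambda>x. \<Sum>\<alpha>\<in>mono_exps (Suc p).
        (if \<alpha> \<in> h ` mono_exps p then c (inv_into (mono_exps p) h \<alpha>) else 0) * m \<alpha> x)"
      by (rule ext) (rule eq)
    then show ?case unfolding pf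
      by (rule exI[of _ "\<lambda>\<alpha>. if \<alpha> \<in> h ` mono_exps p then c (inv_into (mono_exps p) h \<alpha>) else 0"])
  qed
qed

section \<open>Continuity and partial derivatives of polynomials\<close>

lemma continuous_on_pdeg: "pdeg p f \<Longrightarrow> continuous_on S f"
  by (induction rule: pdeg.induct) (auto intro!: continuous_intros)

lemma borel_measurable_pdeg: "pdeg p f \<Longrightarrow> f \<in> borel_measurable borel"
  by (intro borel_measurable_continuous_onI continuous_on_pdeg)

text \<open>The last conjunct does not follow from the second, because \<open>p - 1\<close> is
  \<open>0\<close> for \<open>p = 0\<close>. Without it the product rule would only give degree 1
  for the derivative of a coordinate times a constant, and the degree descent in the local problem
  would have no base.\<close>

lemma pdeg_has_pdiff:
  assumes "pdeg p f"
  shows "((\<lambda>t. f (x + t *\<^sub>R axis i 1)) has_vector_derivative pdiff i f x) (at 0)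
      \<and> pdeg (p - 1) (pdiff i f) \<and> (p = 0 \<longrightarrow> pdiff i f = (\<lambda>_. 0))"
proof -
  define D :: "(real^'a \<Rightarrow> complex) \<Rightarrow> (real^'a \<Rightarrow> complex) \<Rightarrow> bool"
    where "D f f' \<longleftrightarrow> (\<forall>x. ((\<lambda>t. f (x + t *\<^sub>R axis i 1)) has_vector_derivative f' x) (at 0))" for f f'
  have "\<exists>f'. D f f' \<and> pdeg (p - 1) f' \<and> (p = 0 \<longrightarrow> f' = (\<lambda>_. 0))"
    using assms
  proof (induction rule: pdeg.induct)
    case (const p c)
    then show ?case by (intro exI[of _ "\<lambda>_. 0"]) (auto simp: D_def intro: pdeg.const)
  next
    case (add p f g)
    then obtain f' g' where "D f f'" "pdeg (p - 1) f'" "p = 0 \<longrightarrow> f' = (\<lambda>_. 0)"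
      "D g g'" "pdeg (p - 1) g'" "p = 0 \<longrightarrow> g' = (\<lambda>_. 0)"
      by blast
    then show ?case
      by (intro exI[of _ "\<lambda>x. f' x + g' x"])
        (auto simp: D_def intro!: pdeg.add has_vector_derivative_add)
  next
    case (coord p f j)
    then obtain f' where f': "D f f'" "pdeg (p - 1) f'" "p = 0 \<longrightarrow> f' = (\<lambda>_. 0)"
      by blast
    let ?g = "\<lambda>x. complex_of_real (x $ j) * f' x + complex_of_real (axis i 1 $ j) * f x"
    have e: "((\<lambda>t. complex_of_real ((x + t *\<^sub>R axis i 1) $ j)) has_vector_derivative
         complex_of_real (axis i 1 $ j)) (at 0)" for x
      by (rule has_vector_derivative_of_real)
        (auto intro!: derivative_eq_intros simp: has_real_derivative_iff_has_vector_derivative[symmetric])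
    have "((\<lambda>t. complex_of_real ((x + t *\<^sub>R axis i 1) $ j) * f (x + t *\<^sub>R axis i 1))
        has_vector_derivative ?g x) (at 0)" for x
      using has_vector_derivative_mult[OF e[of x] f'(1)[unfolded D_def, rule_format, of x]] by simp
    moreover have "pdeg p (\<lambda>x. complex_of_real (x $ j) * f' x)"
    proof (cases p)
      case 0
      then show ?thesis using f' by (auto intro: pdeg.const)
    next
      case (Suc q)
      then show ?thesis using f' by (auto intro: pdeg.coord)
    qed
    then have "pdeg p ?g"
      using coord by (intro pdeg.add pdeg_scale)
    ultimately show ?case
      by (intro exI[of _ ?g]) (auto simp: D_def)
  qed
  then obtain f' where f': "D f f'" "pdeg (p - 1) f'" "p = 0 \<longrightarrow> f' = (\<lambda>_. 0)"
    by blast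
  then have "pdiff i f = f'"
    by (auto simp: pdiff_def fun_eq_iff D_def intro: vector_derivative_at)
  with f' show ?thesis by (simp add: D_def)
qed

lemmas pdeg_has_vector_derivative = pdeg_has_pdiff[THEN conjunct1]

lemma pdeg_pdiff: "pdeg p f \<Longrightarrow> pdeg (p - 1) (pdiff i f)"
  using pdeg_has_pdiff by blast

lemma pdiff_comb:
  assumes "pdeg p f" "pdeg q g"
  shows "pdiff i (\<lambda>x. c * f x + d * g x) x = c * pdiff i f x + d * pdiff i g x"
  unfolding pdiff_def[of i "\<lambda>x. c * f x + d * g x"]
  by (rule vector_derivative_at)
    (intro has_vector_derivative_add has_vector_derivative_mult_right
      pdeg_has_vector_derivative[OF assms(1)] pdeg_has_vector_derivative[OF assms(2)])

lemma pdiff_mult: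
  assumes "pdeg p f" "pdeg q g"
  shows "pdiff i (\<lambda>x. f x * g x) x = f x * pdiff i g x + pdiff i f x * g x"
  unfolding pdiff_def[of i "\<lambda>x. f x * g x"]
  using has_vector_derivative_mult[OF pdeg_has_vector_derivative[OF assms(1), of x i]
      pdeg_has_vector_derivative[OF assms(2), of x i]]
  by (intro vector_derivative_at) simp

lemma pdiff_cnj:
  assumes "pdeg p f"
  shows "pdiff i (\<lambda>x. cnj (f x)) x = cnj (pdiff i f x)"
  unfolding pdiff_def[of i "\<lambda>x. cnj (f x)"]
  by (intro vector_derivative_at has_vector_derivative_cnj pdeg_has_vector_derivative[OF assms])

section \<open>Dirichlet integrals over the standard simplex\<close>

text \<open>Euler's Beta integral. Integration by parts trades one power of \<open>r - t\<close> for
  one of \<open>t\<close>, so the induction on \<open>b\<close> needs \<open>a\<close>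
  arbitrary.\<close>

lemma has_integral_power_convolution:
  fixes r :: real
  assumes "0 \<le> r"
  shows "((\<lambda>t. t ^ a * (r - t) ^ b) has_integral
      (fact a * fact b / fact (a + b + 1) * r ^ (a + b + 1))) {0..r}"
proof (induction b arbitrary: a)
  case 0
  have "((\<lambda>t. t ^ a) has_integral (r ^ (a + 1) / real (a + 1) - 0 ^ (a + 1) / real (a + 1))) {0..r}"
    using assms
  proof (intro fundamental_theorem_of_calculus)
    fix t
    have "((\<lambda>t. t ^ (a + 1) / real (a + 1)) has_real_derivative (real (a + 1) * t ^ a) / real (a + 1))
        (at t within {0..r})"
      by (auto intro!: derivative_eq_intros simp del: of_nat_Suc of_nat_add power_Suc)
    then show "((\<lambda>t. t ^ (a + 1) / real (a + 1)) has_vector_derivative t ^ a) (at t within {0..r})"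
      by (simp add: has_real_derivative_iff_has_vector_derivative del: of_nat_Suc of_nat_add)
  qed
  then show ?case by (simp add: divide_simps del: of_nat_Suc)
next
  case (Suc b)
  \<comment> \<open>\<open>?F\<close> vanishes at both ends, and its derivative is the wanted
    integrand minus a multiple of the one covered by the induction hypothesis at
    \<open>a + 1\<close>.\<close>
  let ?F = "\<lambda>t. t ^ (a + 1) * (r - t) ^ (b + 1) / real (a + 1)"
  have "((\<lambda>t. t ^ a * (r - t) ^ (b + 1) - real (b + 1) / real (a + 1) * (t ^ (a + 1) * (r - t) ^ b))
      has_integral (?F r - ?F 0)) {0..r}"
    using assms
  proof (intro fundamental_theorem_of_calculus)
    fix t
    have "(?F has_real_derivative (real (a + 1) * t ^ a * (r - t) ^ (b + 1)
        - t ^ (a + 1) * (real (b + 1) * (r - t) ^ b)) / real (a + 1)) (at t within {0..r})"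
      by (auto intro!: derivative_eq_intros simp del: of_nat_Suc power_Suc)
    also have "(real (a + 1) * t ^ a * (r - t) ^ (b + 1) - t ^ (a + 1) * (real (b + 1) * (r - t) ^ b)) / real (a + 1)
        = t ^ a * (r - t) ^ (b + 1) - real (b + 1) / real (a + 1) * (t ^ (a + 1) * (r - t) ^ b)"
      by (simp add: diff_divide_distrib del: of_nat_Suc of_nat_add power_Suc)
    finally show "(?F has_vector_derivative (t ^ a * (r - t) ^ (b + 1)
        - real (b + 1) / real (a + 1) * (t ^ (a + 1) * (r - t) ^ b))) (at t within {0..r})"
      by (simp add: has_real_derivative_iff_has_vector_derivative)
  qed simp
  from has_integral_add[OF this has_integral_mult_right[OF Suc.IH[of "a + 1"], of "real (b + 1) / real (a + 1)"]]
  have "((\<lambda>t. t ^ a * (r - t) ^ (b + 1)) has_integral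
      (?F r - ?F 0 + real (b + 1) / real (a + 1) * (fact (a + 1) * fact b / fact (a + 1 + b + 1) * r ^ (a + 1 + b + 1)))) {0..r}"
    by simp
  moreover have "?F r - ?F 0 + real (b + 1) / real (a + 1) * (fact (a + 1) * fact b / fact (a + 1 + b + 1) * r ^ (a + 1 + b + 1))
      = fact a * fact (Suc b) / fact (a + Suc b + 1) * r ^ (a + Suc b + 1)"
    by (simp add: divide_simps del: of_nat_add of_nat_Suc)
  ultimately show ?case by (simp only: Suc_eq_plus1)
qed

abbreviation nat_lborel :: "nat \<Rightarrow> (nat \<Rightarrow> real) measure" where
  "nat_lborel m \<equiv> Pi\<^sub>M {..<m} (\<lambda>_. lborel)"

lemma std_simplex_sets [measurable]: "std_simplex m \<in> sets (nat_lborel m)"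
proof -
  have "std_simplex m = {s \<in> space (nat_lborel m). (\<forall>i\<in>{..<m}. 0 \<le> s i) \<and> sum s {..<m} \<le> 1}"
    by (auto simp: std_simplex_def space_PiM)
  also have "\<dots> \<in> sets (nat_lborel m)" by measurable
  finally show ?thesis .
qed

lemma std_simplex_le_1: "s \<in> std_simplex m \<Longrightarrow> i < m \<Longrightarrow> s i \<in> {0..1}"
  using member_le_sum[of i "{..<m}" s] by (auto simp: std_simplex_def)

lemma emeasure_std_simplex_finite: "emeasure (nat_lborel m) (std_simplex m) < \<infinity>"
proof -
  interpret product_sigma_finite "\<lambda>_::nat. lborel :: real measure" by standard
  have sub: "std_simplex m \<subseteq> Pi\<^sub>E {..<m} (\<lambda>_. {0..1})"
    using std_simplex_le_1 by (auto simp: std_simplex_def)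
  have "emeasure (nat_lborel m) (std_simplex m) \<le> emeasure (nat_lborel m) (Pi\<^sub>E {..<m} (\<lambda>_. {0..1}))"
    by (intro emeasure_mono sub) auto
  also have "\<dots> = 1" by (subst emeasure_PiM) auto
  finally show ?thesis by (simp add: le_less_trans)
qed

lemma set_integrable_std_simplex:
  fixes f :: "(nat \<Rightarrow> real) \<Rightarrow> 'a::{banach, second_countable_topology}"
  assumes "f \<in> borel_measurable (nat_lborel m)" "\<And>s. s \<in> std_simplex m \<Longrightarrow> norm (f s) \<le> B"
  shows "set_integrable (nat_lborel m) (std_simplex m) f"
  unfolding set_integrable_def
  using assms emeasure_std_simplex_finite by (intro integrableI_bounded_set_indicator) auto

text \<open>Fubini in the last coordinate: with the others fixed it runs over \<open>{0..r}\<close>,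
  where \<open>r\<close> is the remaining slack, and the Beta integral yields a power of
  \<open>r\<close>. That is the same integral in one dimension less with a larger exponent
  \<open>c\<close>, hence \<open>arbitrary: c\<close>.\<close>

lemma dirichlet_integral_last:
  "(LINT s:std_simplex m|nat_lborel m. (\<Prod>i<m. s i ^ b i) * (1 - sum s {..<m}) ^ c)
    = (\<Prod>i<m. fact (b i)) * fact c / (fact (m + sum b {..<m} + c) :: real)"
proof (induction m arbitrary: c)
  case 0
  \<comment> \<open>The product of no factors is a point mass, and both sides equal 1.\<close>
  have "std_simplex 0 = {\<lambda>_. undefined}" by (auto simp: std_simplex_def)
  then show ?case
    by (simp add: set_lebesgue_integral_def PiM_empty lebesgue_integral_count_space_finite)
next
  case (Suc m)
  interpret product_sigma_finite "\<lambda>_::nat. lborel :: real measure" by standard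
  define F where "F s = indicator (std_simplex (Suc m)) s *\<^sub>R
      ((\<Prod>i<Suc m. s i ^ b i) * (1 - sum s {..<Suc m}) ^ c)" for s :: "nat \<Rightarrow> real"
  have int: "integrable (nat_lborel (Suc m)) F"
  proof -
    have "set_integrable (nat_lborel (Suc m)) (std_simplex (Suc m))
        (\<lambda>s. (\<Prod>i<Suc m. s i ^ b i) * (1 - sum s {..<Suc m}) ^ c)"
    proof (rule set_integrable_std_simplex[where B = 1])
      fix s assume s: "s \<in> std_simplex (Suc m)"
      have "\<bar>\<Prod>i<Suc m. s i ^ b i\<bar> \<le> 1"
        unfolding abs_prod using std_simplex_le_1[OF s] by (intro prod_le_1) (auto simp: power_le_one simp flip: power_abs)
      moreover have "0 \<le> 1 - sum s {..<Suc m}" "1 - sum s {..<Suc m} \<le> 1"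
        using s sum_nonneg[of "{..<Suc m}" s] unfolding std_simplex_def by auto
      then have "\<bar>(1 - sum s {..<Suc m}) ^ c\<bar> \<le> 1"
        by (metis abs_of_nonneg power_le_one zero_le_power)
      ultimately show "norm ((\<Prod>i<Suc m. s i ^ b i) * (1 - sum s {..<Suc m}) ^ c) \<le> 1"
        unfolding real_norm_def abs_mult by (intro mult_le_one) auto
    qed measurable
    then show ?thesis by (simp add: set_integrable_def F_def[abs_def])
  qed
  have inner: "(LINT y|lborel. F (x(m := y)))
      = indicator (std_simplex m) x *\<^sub>R ((\<Prod>i<m. x i ^ b i) * (1 - sum x {..<m}) ^ (b m + c + 1))
        * (fact (b m) * fact c / fact (b m + c + 1))"
    if x: "x \<in> space (nat_lborel m)" for x
  proof (cases "x \<in> std_simplex m")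
    case False
    then have "x(m := y) \<notin> std_simplex (Suc m)" for y
      using x by (auto simp: std_simplex_def space_PiM)
    with False show ?thesis by (simp add: F_def)
  next
    case True
    define r where "r = 1 - sum x {..<m}"
    have r: "0 \<le> r" using True by (simp add: r_def std_simplex_def)
    have "x(m := y) \<in> std_simplex (Suc m) \<longleftrightarrow> y \<in> {0..r}" for y
    proof -
      have "x(m := y) \<in> {..<Suc m} \<rightarrow>\<^sub>E UNIV"
        using x by (auto simp: space_PiM PiE_def extensional_def)
      moreover have "sum (x(m := y)) {..<Suc m} = sum x {..<m} + y" by simp
      moreover have "(\<forall>i<Suc m. 0 \<le> (x(m := y)) i) \<longleftrightarrow> 0 \<le> y"
        using True by (auto simp: std_simplex_def less_Suc_eq)
      ultimately show ?thesis unfolding std_simplex_def r_def by auto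
    qed
    then have "F (x(m := y)) = (\<Prod>i<m. x i ^ b i) * (indicator {0..r} y *\<^sub>R (y ^ b m * (r - y) ^ c))" for y
      by (auto simp: F_def indicator_def r_def algebra_simps)
    then have "(LINT y|lborel. F (x(m := y)))
        = (\<Prod>i<m. x i ^ b i) * (LINT y:{0..r}|lborel. y ^ b m * (r - y) ^ c)"
      by (simp add: set_lebesgue_integral_def)
    also have "(LINT y:{0..r}|lborel. y ^ b m * (r - y) ^ c) = integral {0..r} (\<lambda>y. y ^ b m * (r - y) ^ c)"
      by (intro set_borel_integral_eq_integral(2) borel_integrable_atLeastAtMost') (auto intro!: continuous_intros)
    also have "\<dots> = fact (b m) * fact c / fact (b m + c + 1) * r ^ (b m + c + 1)"
      using has_integral_power_convolution[OF r] by blast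
    finally show ?thesis using True by (simp only: r_def) (simp add: mult_ac del: fact_Suc)
  qed
  have "(LINT s:std_simplex (Suc m)|nat_lborel (Suc m). (\<Prod>i<Suc m. s i ^ b i) * (1 - sum s {..<Suc m}) ^ c)
      = integral\<^sup>L (Pi\<^sub>M (insert m {..<m}) (\<lambda>_. lborel)) F"
    by (simp add: set_lebesgue_integral_def F_def[abs_def] lessThan_Suc)
  also have "\<dots> = (LINT x|nat_lborel m. LINT y|lborel. F (x(m := y)))"
    using int by (intro product_integral_insert) (auto simp: lessThan_Suc)
  also have "\<dots> = (LINT x|nat_lborel m.
      indicator (std_simplex m) x *\<^sub>R ((\<Prod>i<m. x i ^ b i) * (1 - sum x {..<m}) ^ (b m + c + 1))
        * (fact (b m) * fact c / fact (b m + c + 1)))"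
    by (rule Bochner_Integration.integral_cong) (auto simp: inner)
  also have "\<dots> = (\<Prod>i<m. fact (b i)) * fact (b m + c + 1) / fact (m + sum b {..<m} + (b m + c + 1))
      * (fact (b m) * fact c / fact (b m + c + 1))"
    by (simp only: integral_mult_left_zero Suc.IH[unfolded set_lebesgue_integral_def])
  also have "\<dots> = (\<Prod>i<Suc m. fact (b i)) * fact c / fact (Suc m + sum b {..<Suc m} + c)"
    by (simp add: algebra_simps del: fact_Suc)
  finally show ?case .
qed

text \<open>Index 0 is the slack coordinate because \<open>face_param\<close> measures its edges
  from the first listed vertex; index \<open>Suc i\<close> belongs to the far end of edge
  \<open>i\<close>.\<close>

definition bary :: "nat \<Rightarrow> (nat \<Rightarrow> real) \<Rightarrow> nat \<Rightarrow> real" where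
  "bary m s j = (case j of 0 \<Rightarrow> 1 - sum s {..<m} | Suc i \<Rightarrow> s i)"

lemma dirichlet_integral:
  "(LINT s:std_simplex m|nat_lborel m. \<Prod>j<Suc m. bary m s j ^ \<beta> j)
    = (\<Prod>j<Suc m. fact (\<beta> j)) / (fact (m + sum \<beta> {..<Suc m}) :: real)"
proof -
  have "(\<Prod>j<Suc m. bary m s j ^ \<beta> j) = (\<Prod>i<m. s i ^ \<beta> (Suc i)) * (1 - sum s {..<m}) ^ \<beta> 0" for s
    by (simp add: prod.lessThan_Suc_shift bary_def del: prod.lessThan_Suc)
  then have "(LINT s:std_simplex m|nat_lborel m. \<Prod>j<Suc m. bary m s j ^ \<beta> j)
      = (LINT s:std_simplex m|nat_lborel m. (\<Prod>i<m. s i ^ \<beta> (Suc i)) * (1 - sum s {..<m}) ^ \<beta> 0)"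
    by (simp only:)
  also have "\<dots> = (\<Prod>j<Suc m. fact (\<beta> j)) / fact (m + sum \<beta> {..<Suc m})"
    unfolding dirichlet_integral_last
    by (simp add: prod.lessThan_Suc_shift sum.lessThan_Suc_shift algebra_simps
        del: prod.lessThan_Suc sum.lessThan_Suc)
  finally show ?thesis .
qed

section \<open>Affine change of variables\<close>

lemma nat_lborel_vec_measurable:
  assumes e: "bij_betw e {..<m} (UNIV :: 'n::finite set)"
  shows "(\<lambda>s. \<chi> j. s (inv_into {..<m} e j)) \<in> nat_lborel m \<rightarrow>\<^sub>M (borel :: (real^'n) measure)"
proof (subst borel_measurable_euclidean_space, intro ballI)
  fix b :: "real^'n" assume "b \<in> Basis"
  then obtain j where "b = axis j 1" by (auto simp: Basis_vec_def)
  moreover have "inv_into {..<m} e j \<in> {..<m}"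
    using e by (intro inv_into_into) (auto simp: bij_betw_def)
  then have "(\<lambda>s. s (inv_into {..<m} e j)) \<in> borel_measurable (nat_lborel m)"
    using measurable_component_singleton[of "inv_into {..<m} e j" "{..<m}" "\<lambda>_. lborel"] by simp
  ultimately show "(\<lambda>s. (\<chi> j. s (inv_into {..<m} e j)) \<bullet> b) \<in> borel_measurable (nat_lborel m)"
    by (simp add: inner_axis)
qed

text \<open>Lebesgue measure is fixed by its values on boxes, and a box pulls back along the
  renaming \<open>e\<close> to a product of intervals with the same sides. This links the index
  functions used for faces with the vectors used for elements.\<close>

lemma lborel_eq_distr_nat_lborel:
  assumes e: "bij_betw e {..<m} (UNIV :: 'n::finite set)"
  shows "distr (nat_lborel m) borel (\<lambda>s. \<chi> j. s (inv_into {..<m} e j)) = (lborel :: (real^'n) measure)"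
proof (rule lborel_eqI[symmetric])
  interpret product_sigma_finite "\<lambda>_::nat. lborel :: real measure" by standard
  let ?P = "\<lambda>s. \<chi> j. s (inv_into {..<m} e j) :: real^'n"
  have inv: "inv_into {..<m} e j \<in> {..<m}" for j
    using e by (intro inv_into_into) (auto simp: bij_betw_def)
  have ei: "e (inv_into {..<m} e j) = j" for j
    using e by (auto simp: bij_betw_def intro: f_inv_into_f)
  have ie: "inv_into {..<m} e (e i) = i" if "i < m" for i
    using e that by (auto simp: bij_betw_def intro: inv_into_f_f)
  have [measurable]: "?P \<in> nat_lborel m \<rightarrow>\<^sub>M borel"
    by (rule nat_lborel_vec_measurable[OF e])
  fix l u :: "real^'n"
  assume le: "\<And>b. b \<in> Basis \<Longrightarrow> l \<bullet> b \<le> u \<bullet> b"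
  then have le': "l $ j \<le> u $ j" for j
    by (metis axis_in_Basis_iff cart_eq_inner_axis inner_real_def axis_in_Basis_iff insertI1 Basis_real_def)
  have "?P -` box l u \<inter> space (nat_lborel m) = Pi\<^sub>E {..<m} (\<lambda>i. {l $ e i <..< u $ e i})"
    (is "?A = ?B")
  proof (intro set_eqI iffI)
    fix s assume s: "s \<in> ?A"
    have "l $ e i < s i \<and> s i < u $ e i" if "i < m" for i
      using s ie[OF that] by (auto simp: mem_box_cart dest!: spec[of _ "e i"])
    then show "s \<in> ?B" using s by (auto simp: space_PiM PiE_def)
  next
    fix s assume s: "s \<in> ?B"
    have "l $ j < s (inv_into {..<m} e j) \<and> s (inv_into {..<m} e j) < u $ j" for j
      using s inv[of j] ei[of j] by (auto simp: PiE_def Pi_def)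
    then show "s \<in> ?A" using s by (auto simp: mem_box_cart space_PiM PiE_def)
  qed
  then have "emeasure (distr (nat_lborel m) borel ?P) (box l u) = (\<Prod>i<m. ennreal (u $ e i - l $ e i))"
    by (simp add: emeasure_distr emeasure_PiM le')
  also have "\<dots> = (\<Prod>j\<in>UNIV. ennreal (u $ j - l $ j))"
    using prod.reindex_bij_betw[OF e, of "\<lambda>j. ennreal (u $ j - l $ j)"] by simp
  also have "\<dots> = ennreal (\<Prod>j\<in>UNIV. u $ j - l $ j)"
    by (intro prod_ennreal) (simp add: le')
  also have "(\<Prod>j\<in>UNIV. u $ j - l $ j) = (\<Prod>b\<in>Basis. (u - l) \<bullet> b)"
  proof -
    have B: "Basis = (\<lambda>i. axis i (1::real)) ` (UNIV :: 'n set)"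
      by (auto simp: Basis_vec_def)
    have inj: "inj (\<lambda>i::'n. axis i (1::real))" by (auto simp: inj_def axis_eq_axis)
    show ?thesis unfolding B prod.reindex[OF inj] by (simp add: inner_axis)
  qed
  finally show "emeasure (distr (nat_lborel m) borel ?P) (box l u) = ennreal (\<Prod>b\<in>Basis. (u - l) \<bullet> b)" .
qed simp

text \<open>Checked on boxes: the preimage of a box under \<open>M\<close> is its image under the
  inverse \<open>N\<close>, so its volume is scaled by |det N|, and
  \<open>det N * det M = 1\<close>. The sort \<open>wellorder\<close> is the one under which
  \<open>measure_linear_image\<close> computes volumes by determinants.\<close>

lemma lborel_linear_image:
  fixes M :: "real^'n::{finite,wellorder}^'n::{finite,wellorder}"
  assumes "det M \<noteq> 0"
  shows "lborel = density (distr lborel borel (\<lambda>x. M *v x)) (\<lambda>_. ennreal \<bar>det M\<bar>)"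
proof (rule lborel_eqI)
  obtain N where inv: "M ** N = mat 1" "N ** M = mat 1"
    using assms unfolding invertible_det_nz[symmetric] invertible_def by blast
  have det: "det N * det M = 1" using det_mul[of N M] inv by simp
  have [measurable]: "(\<lambda>x. M *v x) \<in> borel_measurable borel"
    by (intro borel_measurable_continuous_onI matrix_vector_mult_linear_continuous_on)
  fix l u :: "real^'n::_"
  assume le: "\<And>b. b \<in> Basis \<Longrightarrow> l \<bullet> b \<le> u \<bullet> b"
  have img: "(\<lambda>x. M *v x) -` box l u = (*v) N ` box l u"
  proof (intro set_eqI iffI)
    fix x assume "x \<in> (\<lambda>x. M *v x) -` box l u"
    moreover have "x = N *v (M *v x)" by (simp add: matrix_vector_mul_assoc inv)
    ultimately show "x \<in> (*v) N ` box l u" by blast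
  qed (auto simp: matrix_vector_mul_assoc inv)
  have lin: "linear ((*v) N)" by simp
  have box: "box l u \<in> lmeasurable" by simp
  note m = measurable_linear_image[OF lin box] measure_linear_image[OF lin box]
  have borel: "(\<lambda>x. M *v x) -` box l u \<in> sets borel"
    using measurable_sets[of "\<lambda>x. M *v x" borel borel "box l u"] by simp
  have "emeasure lborel ((\<lambda>x. M *v x) -` box l u) = emeasure lebesgue ((\<lambda>x. M *v x) -` box l u)"
    using borel by simp
  also have "\<dots> = ennreal (\<bar>det N\<bar> * measure lebesgue (box l u))"
    using m unfolding img by (simp add: emeasure_eq_measure2)
  also have "measure lebesgue (box l u) = (\<Prod>b\<in>Basis. (u - l) \<bullet> b)"
    using le by (simp add: measure_lborel_box_eq)
  finally have pre: "emeasure lborel ((\<lambda>x. M *v x) -` box l u) = ennreal (\<bar>det N\<bar> * (\<Prod>b\<in>Basis. (u - l) \<bullet> b))" .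
  have nn: "0 \<le> (\<Prod>b\<in>Basis. (u - l) \<bullet> b)"
    using le by (intro prod_nonneg) (simp add: inner_diff_left)
  have "emeasure (density (distr lborel borel (\<lambda>x. M *v x)) (\<lambda>_. ennreal \<bar>det M\<bar>)) (box l u)
      = ennreal \<bar>det M\<bar> * emeasure lborel ((\<lambda>x. M *v x) -` box l u)"
    by (simp add: emeasure_density nn_integral_cmult_indicator emeasure_distr)
  also have "\<dots> = ennreal ((\<bar>det N * det M\<bar>) * (\<Prod>b\<in>Basis. (u - l) \<bullet> b))"
    unfolding pre using nn by (subst ennreal_mult[symmetric]) (auto simp: abs_mult mult_ac)
  finally show "emeasure (density (distr lborel borel (\<lambda>x. M *v x)) (\<lambda>_. ennreal \<bar>det M\<bar>)) (box l u)
      = ennreal (\<Prod>b\<in>Basis. (u - l) \<bullet> b)"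
    by (simp add: det)
qed simp

text \<open>The matrix lives on an auxiliary well-ordered index type \<open>'n\<close>;
  \<open>b\<close> renames its rows to coordinates of \<open>real^'d\<close>, and \<open>e\<close>
  its columns to edge numbers. Renaming and translation preserve Lebesgue measure, so |det M| is the
  whole Jacobian.\<close>

lemma integral_affine_nat_lborel:
  fixes b :: "'n::{finite,wellorder} \<Rightarrow> 'd::finite" and E :: "nat \<Rightarrow> real^'d"
    and g :: "real^'d \<Rightarrow> complex"
  assumes b: "bij b" and e: "bij_betw e {..<m} (UNIV :: 'n set)"
    and M: "M = (\<chi> r c. E (inv_into {..<m} e c) $ b r)" and det: "det M \<noteq> 0"
    and g [measurable]: "g \<in> borel_measurable borel"
  shows "integral\<^sup>L lborel g
      = complex_of_real \<bar>det M\<bar> * (LINT s|nat_lborel m. g (w0 + (\<Sum>i<m. s i *\<^sub>R E i)))"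
proof -
  define P :: "(nat \<Rightarrow> real) \<Rightarrow> real^'n::_" where "P s = (\<chi> j. s (inv_into {..<m} e j))" for s
  define L where "L y = (\<chi> k. y $ inv b k)" for y :: "real^'n::_"
  have e': "bij_betw (b \<circ> e) {..<m} (UNIV :: 'd set)"
    using e b by (rule bij_betw_trans)
  have inv_eq: "inv_into {..<m} (b \<circ> e) k = inv_into {..<m} e (inv b k)" for k
  proof (rule inv_into_f_eq)
    show "inj_on (b \<circ> e) {..<m}" using e' by (simp add: bij_betw_def)
    show "inv_into {..<m} e (inv b k) \<in> {..<m}"
      using e by (intro inv_into_into) (auto simp: bij_betw_def)
    show "(b \<circ> e) (inv_into {..<m} e (inv b k)) = k"
      using e b by (simp add: f_inv_into_f bij_betw_def bij_is_surj surj_f_inv_f)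
  qed
  have LP: "L (P s) = (\<chi> k. s (inv_into {..<m} (b \<circ> e) k))" for s
    by (simp add: L_def P_def inv_eq)
  have dP: "distr (nat_lborel m) borel P = lborel"
    unfolding P_def[abs_def] by (rule lborel_eq_distr_nat_lborel[OF e])
  have dLP: "distr (nat_lborel m) borel (\<lambda>s. L (P s)) = lborel"
    unfolding LP by (rule lborel_eq_distr_nat_lborel[OF e'])
  have Pm [measurable]: "P \<in> nat_lborel m \<rightarrow>\<^sub>M borel"
    unfolding P_def[abs_def] by (rule nat_lborel_vec_measurable[OF e])
  have Lm [measurable]: "L \<in> borel_measurable borel"
    by (intro borel_measurable_continuous_onI linear_continuous_on linear_conv_bounded_linear[THEN iffD1] linearI)
      (auto simp: L_def vec_eq_iff)
  have Mm [measurable]: "(\<lambda>x. M *v x) \<in> borel_measurable borel"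
    by (intro borel_measurable_continuous_onI matrix_vector_mult_linear_continuous_on)
  have eq: "w0 + L (M *v P s) = w0 + (\<Sum>i<m. s i *\<^sub>R E i)" for s
  proof -
    have "L (M *v P s) $ k = (\<Sum>i<m. s i *\<^sub>R E i) $ k" for k
    proof -
      have "L (M *v P s) $ k = (\<Sum>c\<in>UNIV. E (inv_into {..<m} e c) $ k * s (inv_into {..<m} e c))"
        using b by (simp add: L_def M P_def matrix_vector_mult_def bij_is_surj surj_f_inv_f)
      also have "\<dots> = (\<Sum>i<m. E (inv_into {..<m} e (e i)) $ k * s (inv_into {..<m} e (e i)))"
        by (rule sum.reindex_bij_betw[OF e, symmetric])
      also have "\<dots> = (\<Sum>i<m. E i $ k * s i)"
        using e by (intro sum.cong) (auto simp: bij_betw_def inv_into_f_f)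
      finally show ?thesis by (simp add: mult.commute)
    qed
    then show ?thesis by (simp add: vec_eq_iff)
  qed
  have "integral\<^sup>L lborel g = integral\<^sup>L (distr lborel borel ((+) w0)) g"
    by (simp add: lborel_distr_plus)
  also have "\<dots> = (LINT x|lborel. g (w0 + x))"
    by (rule integral_distr) auto
  \<comment> \<open>Both \<open>real^'d\<close> and \<open>real^'n\<close> carry images of the same
    product measure, so the integral can move through it to \<open>real^'n\<close>, where the matrix
    acts, and back again.\<close>
  also have "\<dots> = (LINT x|distr (nat_lborel m) borel (\<lambda>s. L (P s)). g (w0 + x))"
    by (simp add: dLP)
  also have "\<dots> = (LINT s|nat_lborel m. g (w0 + L (P s)))"
    by (rule integral_distr) auto
  also have "\<dots> = (LINT y|distr (nat_lborel m) borel P. g (w0 + L y))"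
    by (rule integral_distr[symmetric]) auto
  also have "\<dots> = (LINT y|density (distr lborel borel (\<lambda>x. M *v x)) (\<lambda>_. ennreal \<bar>det M\<bar>). g (w0 + L y))"
    unfolding dP lborel_linear_image[OF det, symmetric] ..
  also have "\<dots> = (LINT y|distr lborel borel (\<lambda>x. M *v x). \<bar>det M\<bar> *\<^sub>R g (w0 + L y))"
    by (rule integral_density) auto
  also have "\<dots> = (LINT y|lborel. \<bar>det M\<bar> *\<^sub>R g (w0 + L (M *v y)))"
    by (rule integral_distr) auto
  also have "\<dots> = (LINT y|distr (nat_lborel m) borel P. \<bar>det M\<bar> *\<^sub>R g (w0 + L (M *v y)))"
    unfolding dP ..
  also have "\<dots> = (LINT s|nat_lborel m. \<bar>det M\<bar> *\<^sub>R g (w0 + L (M *v P s)))"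
    by (rule integral_distr) auto
  also have "\<dots> = complex_of_real \<bar>det M\<bar> * (LINT s|nat_lborel m. g (w0 + (\<Sum>i<m. s i *\<^sub>R E i)))"
    by (simp add: eq scaleR_conv_of_real)
  finally show ?thesis .
qed

section \<open>Gram determinants\<close>

text \<open>The Leibniz expansion of the determinant with entries \<open>X i \<bullet> Y j\<close>.
  Two frames are allowed so that mixed products of frame determinants are covered;
  \<open>gram_det W\<close> is the case where both are \<open>face_edge W\<close>.\<close>

definition gram_sum :: "nat \<Rightarrow> (nat \<Rightarrow> real^'d::finite) \<Rightarrow> (nat \<Rightarrow> real^'d) \<Rightarrow> real" where
  "gram_sum m X Y = (\<Sum>\<pi> | \<pi> permutes {..<m}. real_of_int (sign \<pi>) * (\<Prod>i<m. X i \<bullet> Y (\<pi> i)))"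

definition frame_matrix :: "('n::finite \<Rightarrow> 'd::finite) \<Rightarrow> (nat \<Rightarrow> 'n) \<Rightarrow> nat \<Rightarrow> (nat \<Rightarrow> real^'d) \<Rightarrow> real^'n^'n" where
  "frame_matrix b e m X = (\<chi> r c. X (inv_into {..<m} e c) $ b r)"

text \<open>det X det Y is the determinant of X^T Y, whose entries are inner products. It remains to
  carry the Leibniz sum from permutations of \<open>'n\<close> to permutations of numbers along
  \<open>e\<close>, which keeps signs.\<close>

lemma det_frame_matrix_mult:
  fixes b :: "'n::finite \<Rightarrow> 'd::finite"
  assumes b: "bij b" and e: "bij_betw e {..<m} (UNIV :: 'n set)"
  shows "det (frame_matrix b e m X) * det (frame_matrix b e m Y) = gram_sum m X Y"
proof -
  let ?i = "inv_into {..<m} e"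
  have inj: "inj_on e {..<m}" and img: "e ` {..<m} = UNIV" using e by (auto simp: bij_betw_def)
  have ie: "?i (e k) = k" if "k < m" for k using inj that by simp
  have entry: "(transpose (frame_matrix b e m X) ** frame_matrix b e m Y) $ r $ c = X (?i r) \<bullet> Y (?i c)" for r c
    using sum.reindex_bij_betw[OF b, of "\<lambda>k. X (?i r) $ k * Y (?i c) $ k"]
    by (simp add: matrix_matrix_mult_def transpose_def frame_matrix_def inner_vec_def)
  have "det (frame_matrix b e m X) * det (frame_matrix b e m Y)
      = det (transpose (frame_matrix b e m X) ** frame_matrix b e m Y)"
    by (simp add: det_mul)
  also have "\<dots> = (\<Sum>p | p permutes UNIV. of_int (sign p) * (\<Prod>r\<in>UNIV. X (?i r) \<bullet> Y (?i (p r))))"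
    by (simp add: det_def entry)
  also have "\<dots> = (\<Sum>\<pi> | \<pi> permutes {..<m}. of_int (sign (map_permutation {..<m} e \<pi>))
      * (\<Prod>r\<in>UNIV. X (?i r) \<bullet> Y (?i (map_permutation {..<m} e \<pi> r))))"
  proof (rule sum.reindex_bij_betw[symmetric])
    have "bij_betw (\<lambda>\<pi> x. if x \<in> UNIV then e (\<pi> (?i x)) else x)
        {\<pi>. \<pi> permutes {..<m}} {p. p permutes (UNIV :: 'n set)}"
      by (rule bij_betw_permutations[OF e])
    also have "(\<lambda>\<pi> x. if x \<in> UNIV then e (\<pi> (?i x)) else x) = map_permutation {..<m} e"
      by (auto simp: map_permutation_def restrict_id_def img fun_eq_iff)
    finally show "bij_betw (map_permutation {..<m} e) {\<pi>. \<pi> permutes {..<m}} {p. p permutes (UNIV :: 'n set)}" .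
  qed
  also have "\<dots> = gram_sum m X Y"
    unfolding gram_sum_def
  proof (intro sum.cong refl arg_cong2[where f = "(*)"])
    fix \<pi> assume "\<pi> \<in> {\<pi>. \<pi> permutes {..<m}}"
    then have p: "\<pi> permutes {..<m}" by simp
    show "real_of_int (sign (map_permutation {..<m} e \<pi>)) = real_of_int (sign \<pi>)"
      using sign_map_permutation[OF inj p] by simp
    have "(\<Prod>r\<in>UNIV. X (?i r) \<bullet> Y (?i (map_permutation {..<m} e \<pi> r)))
        = (\<Prod>k<m. X (?i (e k)) \<bullet> Y (?i (map_permutation {..<m} e \<pi> (e k))))"
      by (rule prod.reindex_bij_betw[OF e, symmetric])
    also have "\<dots> = (\<Prod>i<m. X i \<bullet> Y (\<pi> i))"
    proof (intro prod.cong refl)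
      fix k assume "k \<in> {..<m}"
      then have "k < m" "\<pi> k < m" using permutes_in_image[OF p, of k] by auto
      then show "X (?i (e k)) \<bullet> Y (?i (map_permutation {..<m} e \<pi> (e k))) = X k \<bullet> Y (\<pi> k)"
        by (simp add: ie map_permutation_apply[OF inj])
    qed
    finally show "(\<Prod>r\<in>UNIV. X (?i r) \<bullet> Y (?i (map_permutation {..<m} e \<pi> r))) = (\<Prod>i<m. X i \<bullet> Y (\<pi> i))" .
  qed
  finally show ?thesis .
qed

text \<open>Expansion along row \<open>n\<close>, whose only possibly nonzero entry is the diagonal
  one: a permutation that moves \<open>n\<close> contributes a zero factor.\<close>

lemma gram_sum_Suc:
  assumes "\<And>i. i < n \<Longrightarrow> X n \<bullet> Y i = 0"
  shows "gram_sum (Suc n) X Y = (X n \<bullet> Y n) * gram_sum n X Y"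
proof -
  have "gram_sum (Suc n) X Y
      = (\<Sum>\<pi> | \<pi> permutes {..<n}. real_of_int (sign \<pi>) * (\<Prod>i<Suc n. X i \<bullet> Y (\<pi> i)))"
    unfolding gram_sum_def
  proof (rule sum.mono_neutral_right)
    show "finite {\<pi>. \<pi> permutes {..<Suc n}}" by (simp add: finite_permutations)
    show "{\<pi>. \<pi> permutes {..<n}} \<subseteq> {\<pi>. \<pi> permutes {..<Suc n}}"
      by (auto intro: permutes_subset)
    show "\<forall>\<pi>\<in>{\<pi>. \<pi> permutes {..<Suc n}} - {\<pi>. \<pi> permutes {..<n}}.
        real_of_int (sign \<pi>) * (\<Prod>i<Suc n. X i \<bullet> Y (\<pi> i)) = 0"
    proof
      fix \<pi> assume p: "\<pi> \<in> {\<pi>. \<pi> permutes {..<Suc n}} - {\<pi>. \<pi> permutes {..<n}}"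
      then have "\<pi> n \<noteq> n"
        using permutes_superset[of \<pi> "{..<Suc n}" "{..<n}"] by (auto simp: less_Suc_eq)
      moreover have "\<pi> n < Suc n" using p permutes_in_image[of \<pi> "{..<Suc n}" n] by auto
      ultimately show "real_of_int (sign \<pi>) * (\<Prod>i<Suc n. X i \<bullet> Y (\<pi> i)) = 0"
        using assms by simp
    qed
  qed
  also have "\<dots> = (\<Sum>\<pi> | \<pi> permutes {..<n}. (X n \<bullet> Y n) * (real_of_int (sign \<pi>) * (\<Prod>i<n. X i \<bullet> Y (\<pi> i))))"
    by (intro sum.cong) (auto simp: permutes_not_in)
  finally show ?thesis by (simp add: gram_sum_def sum_distrib_left)
qed

lemma gram_sum_dual:
  assumes "\<And>i j. i < m \<Longrightarrow> j < m \<Longrightarrow> X i \<bullet> Y j = (if i = j then 1 else 0)"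
  shows "gram_sum m X Y = 1"
  using assms
proof (induction m)
  case 0
  then show ?case by (simp add: gram_sum_def)
next
  case (Suc n)
  then show ?case by (subst gram_sum_Suc) auto
qed

lemma gram_sum_cong:
  assumes "\<And>i. i < m \<Longrightarrow> X i = X' i" "\<And>i. i < m \<Longrightarrow> Y i = Y' i"
  shows "gram_sum m X Y = gram_sum m X' Y'"
  unfolding gram_sum_def
proof (intro sum.cong refl arg_cong2[where f = "(*)"] prod.cong)
  fix \<pi> i assume "\<pi> \<in> {\<pi>. \<pi> permutes {..<m}}" "i \<in> {..<m}"
  then show "X i \<bullet> Y (\<pi> i) = X' i \<bullet> Y' (\<pi> i)"
    using assms permutes_in_image[of \<pi> "{..<m}" i] by simp
qed

text \<open>Base times height: multiplying the frame \<open>E\<close> and the frame obtained by replacing its last vector by the normal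
  \<open>a = A n\<close> of the base gives block triangular Gram matrices.\<close>

lemma det_frame_matrix_base_height:
  fixes b :: "'n::finite \<Rightarrow> 'd::finite" and E A :: "nat \<Rightarrow> real^'d"
  assumes b: "bij b" and e: "bij_betw e {..<Suc n} (UNIV :: 'n set)"
    and dual: "\<And>i j. i < Suc n \<Longrightarrow> j < Suc n \<Longrightarrow> A i \<bullet> E j = (if i = j then 1 else 0)"
  shows "det (frame_matrix b e (Suc n) E) \<noteq> 0"
    and "\<bar>det (frame_matrix b e (Suc n) E)\<bar> * norm (A n) = sqrt (gram_sum n E E)"
proof -
  let ?d = "\<lambda>X. det (frame_matrix b e (Suc n) X)"
  note mult = det_frame_matrix_mult[OF b e]
  have "?d A * ?d E = 1" unfolding mult by (rule gram_sum_dual) (use dual in auto)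
  then show E0: "?d E \<noteq> 0" by auto
  \<comment> \<open>\<open>A n\<close> is orthogonal to the base edges and pairs to 1 with the last
    edge, so its length is the reciprocal of the height over the base.\<close>
  define a where "a = A n"
  define N where "N = E(n := a)"
  have aE: "a \<bullet> E i = 0" if "i < n" for i using dual[of n i] that by (simp add: a_def)
  have "a \<bullet> E n = 1" using dual[of n n] by (simp add: a_def)
  then have a0: "a \<noteq> 0" by auto
  \<comment> \<open>The dual frame of \<open>N\<close>, obtained by removing from each
    \<open>A i\<close> its part along \<open>a\<close>. It certifies that det N is nonzero and can
    be cancelled below.\<close>
  define A' where "A' i = (if i = n then a /\<^sub>R (a \<bullet> a) else A i - ((A i \<bullet> a) / (a \<bullet> a)) *\<^sub>R a)" for i
  have "?d A' * ?d N = 1"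
    unfolding mult
  proof (rule gram_sum_dual)
    fix i j assume "i < Suc n" "j < Suc n"
    then show "A' i \<bullet> N j = (if i = j then 1 else 0)"
      using dual[of i j] aE a0 by (auto simp: A'_def N_def inner_diff_left)
  qed
  then have N0: "?d N \<noteq> 0" by auto
  have NE: "?d N * ?d E = gram_sum n E E"
  proof -
    have "?d N * ?d E = (a \<bullet> E n) * gram_sum n N E"
      unfolding mult by (subst gram_sum_Suc) (auto simp: N_def aE)
    also have "gram_sum n N E = gram_sum n E E" by (rule gram_sum_cong) (auto simp: N_def)
    finally show ?thesis using \<open>a \<bullet> E n = 1\<close> by simp
  qed
  have NN: "?d N * ?d N = (a \<bullet> a) * gram_sum n E E"
  proof -
    have "?d N * ?d N = (a \<bullet> a) * gram_sum n N N"
      unfolding mult by (subst gram_sum_Suc) (auto simp: N_def aE)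
    also have "gram_sum n N N = gram_sum n E E" by (rule gram_sum_cong) (auto simp: N_def)
    finally show ?thesis .
  qed
  \<comment> \<open>\<open>NN\<close> is \<open>a \<bullet> a\<close> times \<open>NE\<close>;
    cancelling det N leaves this proportion, which turns the left side of \<open>NE\<close> into a
    square up to the factor \<open>a \<bullet> a\<close>.\<close>
  have "?d N = (a \<bullet> a) * ?d E" using NE NN N0 by (metis mult.left_commute mult_cancel_left)
  then have "gram_sum n E E = (\<bar>?d E\<bar> * norm a)\<^sup>2"
    using NE by (simp add: power_mult_distrib dot_square_norm power2_eq_square mult_ac)
  then show "\<bar>?d E\<bar> * norm (A n) = sqrt (gram_sum n E E)"
    by (simp add: a_def)
qed

section \<open>Face integrals\<close>

lemma face_list_props:
  assumes "finite W"
  shows "distinct (face_list W)" "set (face_list W) = W" "length (face_list W) = card W"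
proof -
  have "distinct (face_list W) \<and> set (face_list W) = W"
    unfolding face_list_def
    by (rule someI_ex) (use finite_distinct_list[OF assms] in blast)
  then show "distinct (face_list W)" "set (face_list W) = W" "length (face_list W) = card W"
    using distinct_card by fastforce+
qed

lemma sum_bary: "(\<Sum>j<Suc m. bary m s j) = 1"
  by (simp add: sum.lessThan_Suc_shift bary_def del: sum.lessThan_Suc)

lemma bary_nonneg_iff:
  assumes "s \<in> space (nat_lborel m)"
  shows "s \<in> std_simplex m \<longleftrightarrow> (\<forall>j<Suc m. 0 \<le> bary m s j)"
  using assms by (auto simp: std_simplex_def space_PiM bary_def All_less_Suc2)

lemma face_param_in_hull:
  assumes W: "finite W" "W \<noteq> {}" and s: "s \<in> std_simplex (card W - 1)"
  shows "face_param W s \<in> convex hull W"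
proof -
  let ?m = "card W - 1" and ?w = "\<lambda>j. face_list W ! j"
  have len: "length (face_list W) = Suc ?m"
    using face_list_props(3)[OF W(1)] W by (simp add: card_gt_0_iff)
  have nn: "0 \<le> bary ?m s j" if "j < Suc ?m" for j
    using s that bary_nonneg_iff[of s ?m] by (auto simp: std_simplex_def space_PiM)
  have "face_param W s = (\<Sum>j<Suc ?m. bary ?m s j *\<^sub>R ?w j)"
    by (simp add: face_param_def face_edge_def sum.lessThan_Suc_shift bary_def scaleR_diff_right
        sum_subtractf scaleR_sum_left scaleR_diff_left del: sum.lessThan_Suc)
  also have "\<dots> \<in> convex hull W"
  proof (rule convex_sum)
    fix j assume "j \<in> {..<Suc ?m}"
    then show "?w j \<in> convex hull W"
      using nth_mem[of j "face_list W"] len face_list_props(2)[OF W(1)]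
      by (intro hull_inc) auto
  qed (use nn sum_bary in auto)
  finally show ?thesis .
qed

lemma face_param_measurable [measurable]:
  "face_param W \<in> nat_lborel (card W - 1) \<rightarrow>\<^sub>M borel"
proof -
  have "(\<lambda>s. s i *\<^sub>R face_edge W i) \<in> nat_lborel (card W - 1) \<rightarrow>\<^sub>M borel" if "i < card W - 1" for i
  proof -
    have "(\<lambda>s. s i) \<in> borel_measurable (nat_lborel (card W - 1))"
      using measurable_component_singleton[of i "{..<card W - 1}" "\<lambda>_. lborel"] that by simp
    then show ?thesis by (intro borel_measurable_scaleR) auto
  qed
  then show ?thesis unfolding face_param_def[abs_def]
    by (intro borel_measurable_add borel_measurable_sum) auto
qed

lemma set_integrable_face:
  assumes W: "finite W" "W \<noteq> {}" and f: "pdeg p f"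
  shows "set_integrable (nat_lborel (card W - 1)) (std_simplex (card W - 1)) (\<lambda>s. f (face_param W s))"
proof -
  have "compact (f ` (convex hull W))"
    using W by (intro compact_continuous_image continuous_on_pdeg[OF f] finite_imp_compact_convex_hull)
  then obtain B where "\<forall>x\<in>convex hull W. norm (f x) \<le> B"
    using compact_imp_bounded bounded_iff by (metis image_eqI)
  moreover note [measurable] = borel_measurable_pdeg[OF f]
  ultimately show ?thesis
    using face_param_in_hull[OF W]
    by (intro set_integrable_std_simplex[where B = B] measurable_compose[OF face_param_measurable]) auto
qed

text \<open>The parametrisation stays inside the face, so trace functions may be exchanged for
  polynomials that agree with them there.\<close>

lemma face_int_cong:
  assumes "finite W" "W \<noteq> {}" "\<And>x. x \<in> convex hull W \<Longrightarrow> f x = g x"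
  shows "face_int W f = face_int W g"
  unfolding face_int_def using assms face_param_in_hull[OF assms(1,2)]
  by (intro arg_cong2[where f = "(*)"] refl set_lebesgue_integral_cong) auto

lemma face_int_comb:
  assumes W: "finite W" "W \<noteq> {}" and f: "pdeg p f" and g: "pdeg q g"
  shows "face_int W (\<lambda>x. c * f x + d * g x) = c * face_int W f + d * face_int W g"
proof -
  have "set_lebesgue_integral (nat_lborel (card W - 1)) (std_simplex (card W - 1))
        (\<lambda>s. c * f (face_param W s) + d * g (face_param W s))
      = c * set_lebesgue_integral (nat_lborel (card W - 1)) (std_simplex (card W - 1)) (\<lambda>s. f (face_param W s))
      + d * set_lebesgue_integral (nat_lborel (card W - 1)) (std_simplex (card W - 1)) (\<lambda>s. g (face_param W s))"
    using set_integrable_face[OF W f] set_integrable_face[OF W g]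
    by (subst set_integral_add(2)) (auto intro!: set_integrable_mult_right)
  then show ?thesis by (simp add: face_int_def algebra_simps)
qed

lemma face_int_cnj: "face_int W (\<lambda>x. cnj (f x)) = cnj (face_int W f)"
proof -
  let ?M = "nat_lborel (card W - 1)" and ?S = "std_simplex (card W - 1)"
  have "(\<lambda>s. indicator ?S s *\<^sub>R cnj (f (face_param W s))) = (\<lambda>s. cnj (indicator ?S s *\<^sub>R f (face_param W s)))"
    by (simp add: fun_eq_iff)
  then have "(LINT s|?M. indicator ?S s *\<^sub>R cnj (f (face_param W s)))
      = cnj (LINT s|?M. indicator ?S s *\<^sub>R f (face_param W s))"
    by (simp only: Bochner_Integration.integral_cnj)
  then show ?thesis
    unfolding face_int_def set_lebesgue_integral_def by simp
qed

lemma integrable_on_hull_pdeg: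
  assumes "finite V" "pdeg p f"
  shows "f integrable_on convex hull V"
proof -
  have "set_integrable lborel (convex hull V) f"
    unfolding set_integrable_def
    using assms by (intro borel_integrable_compact finite_imp_compact_convex_hull continuous_on_pdeg)
  then show ?thesis by (rule set_borel_integral_eq_integral)
qed

section \<open>Barycentric coordinates of a simplex\<close>

text \<open>The gradient of the barycentric coordinate of \<open>v\<close>, singled out by its
  values on vertex differences instead of a formula; \<open>bgrad_inner\<close> shows that the
  choice has a witness. The coordinate itself is \<open>blam\<close>.\<close>

definition bgrad :: "(real^'d::finite) set \<Rightarrow> real^'d \<Rightarrow> real^'d" where
  "bgrad V v = (SOME a. \<forall>w\<in>V. \<forall>w'\<in>V. a \<bullet> (w - w') = of_bool (w = v) - of_bool (w' = v))"

definition blam :: "(real^'d::finite) set \<Rightarrow> real^'d \<Rightarrow> real^'d \<Rightarrow> real" where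
  "blam V v x = 1 + bgrad V v \<bullet> (x - v)"

definition bmono :: "(real^'d::finite) set \<Rightarrow> (real^'d \<Rightarrow> nat) \<Rightarrow> real^'d \<Rightarrow> real" where
  "bmono V \<beta> x = (\<Prod>v\<in>V. blam V v x ^ \<beta> v)"

context
  fixes V :: "(real^'d::finite) set"
  assumes V: "simplex_verts V"
begin

lemma simplex_finite: "finite V" and simplex_card: "card V = CARD('d) + 1"
  using V unfolding simplex_verts_def by blast+

lemma simplex_not_singleton: "v \<in> V \<Longrightarrow> \<exists>w. w \<in> V - {v}"
proof (rule ccontr)
  assume "v \<in> V" "\<nexists>w. w \<in> V - {v}"
  then have "V = {v}" by blast
  then show False using simplex_card by simp
qed

lemma simplex_edges:
  assumes "w0 \<in> V"
  shows "independent ((\<lambda>w. w - w0) ` (V - {w0}))" "span ((\<lambda>w. w - w0) ` (V - {w0})) = UNIV"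
proof -
  show i: "independent ((\<lambda>w. w - w0) ` (V - {w0}))"
    using V affine_dependent_iff_dependent2[OF assms] by (simp add: simplex_verts_def)
  have "card ((\<lambda>w. w - w0) ` (V - {w0})) = CARD('d)"
    using assms simplex_card simplex_finite by (subst card_image) (auto simp: inj_on_def)
  then show "span ((\<lambda>w. w - w0) ` (V - {w0})) = UNIV"
    using card_ge_dim_independent[OF subset_UNIV i] by auto
qed

lemma simplex_linear_eqI:
  assumes "linear f" "linear g" "\<And>w w'. w \<in> V \<Longrightarrow> w' \<in> V \<Longrightarrow> f (w - w') = g (w - w')"
  shows "f = g"
proof -
  obtain w0 where w0: "w0 \<in> V" using simplex_card by fastforce
  show ?thesis
  proof
    fix x
    show "f x = g x"
      by (rule linear_eq_on_span[OF assms(1,2), of "(\<lambda>w. w - w0) ` (V - {w0})"])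
        (use assms(3) w0 simplex_edges(2)[OF w0] in auto)
  qed
qed

text \<open>Edges from a vertex \<open>w0\<close> other than \<open>v\<close> form a basis, so a
  linear functional may be prescribed as 1 on \<open>v - w0\<close> and 0 on the others; its adjoint
  at 1 is the vector representing it.\<close>

lemma bgrad_inner:
  assumes v: "v \<in> V" and "w \<in> V" "w' \<in> V"
  shows "bgrad V v \<bullet> (w - w') = of_bool (w = v) - of_bool (w' = v)"
proof -
  obtain w0 where w0: "w0 \<in> V" "w0 \<noteq> v" using simplex_not_singleton[OF v] by blast
  obtain g :: "real^'d \<Rightarrow> real" where g: "linear g"
    "\<forall>x\<in>(\<lambda>w. w - w0) ` (V - {w0}). g x = of_bool (x = v - w0)"
    using linear_independent_extend[OF simplex_edges(1)[OF w0(1)], where f = "\<lambda>x. of_bool (x = v - w0)"]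
    by blast
  define a where "a = adjoint g 1"
  have a: "a \<bullet> x = g x" for x
    using adjoint_works[OF g(1), of x 1] by (simp add: a_def inner_commute)
  have gw: "g (w - w0) = of_bool (w = v)" if "w \<in> V" for w
  proof (cases "w = w0")
    case True
    then show ?thesis using w0 linear_0[OF g(1)] by simp
  next
    case False
    then have "g (w - w0) = of_bool (w - w0 = v - w0)" using g(2) that by blast
    then show ?thesis by simp
  qed
  have "\<forall>w\<in>V. \<forall>w'\<in>V. a \<bullet> (w - w') = of_bool (w = v) - of_bool (w' = v)"
  proof (intro ballI)
    fix w w' assume "w \<in> V" "w' \<in> V"
    have "a \<bullet> (w - w') = g (w - w0) - g (w' - w0)"
      by (simp add: a linear_diff[OF g(1)])
    then show "a \<bullet> (w - w') = of_bool (w = v) - of_bool (w' = v)"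
      using gw \<open>w \<in> V\<close> \<open>w' \<in> V\<close> by simp
  qed
  then have "\<forall>w\<in>V. \<forall>w'\<in>V. bgrad V v \<bullet> (w - w') = of_bool (w = v) - of_bool (w' = v)"
    unfolding bgrad_def by (rule someI)
  then show ?thesis using assms by blast
qed

lemma bgrad_nonzero: "v \<in> V \<Longrightarrow> bgrad V v \<noteq> 0"
proof
  assume v: "v \<in> V" and "bgrad V v = 0"
  moreover obtain w where "w \<in> V" "w \<noteq> v" using simplex_not_singleton[OF v] by blast
  ultimately show False using bgrad_inner[of v v w] by simp
qed

text \<open>A difference of distinct vertices \<open>w - w'\<close> receives +1 from
  \<open>w\<close> and -1 from \<open>w'\<close>, so the sum is orthogonal to all vertex
  differences, and these span the space. Geometrically, the area-weighted face normals close
  up.\<close>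

lemma sum_bgrad: "(\<Sum>v\<in>V. bgrad V v) = 0"
proof -
  have "(\<lambda>x. (\<Sum>v\<in>V. bgrad V v) \<bullet> x) = (\<lambda>x. 0)"
  proof (rule simplex_linear_eqI)
    show "linear (\<lambda>x. (\<Sum>v\<in>V. bgrad V v) \<bullet> x)"
      by (simp add: bounded_linear.linear bounded_linear_inner_right)
    fix w w' assume "w \<in> V" "w' \<in> V"
    then show "(\<Sum>v\<in>V. bgrad V v) \<bullet> (w - w') = 0"
      using simplex_finite by (simp add: inner_sum_left bgrad_inner sum_subtractf of_bool_def)
  qed (simp add: linear_iff)
  then have "(\<Sum>v\<in>V. bgrad V v) \<bullet> (\<Sum>v\<in>V. bgrad V v) = 0" by metis
  then show ?thesis by simp
qed

lemma blam_shift: "blam V v x = blam V v y + bgrad V v \<bullet> (x - y)"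
  by (simp add: blam_def inner_diff_right)

lemma blam_vertex: "v \<in> V \<Longrightarrow> w \<in> V \<Longrightarrow> blam V v w = of_bool (w = v)"
  by (simp add: blam_def bgrad_inner)

lemma sum_blam_scaleR: "(\<Sum>v\<in>V. blam V v x *\<^sub>R v) = x"
proof -
  obtain w0 where w0: "w0 \<in> V" using simplex_card by fastforce
  have "(\<lambda>h. \<Sum>v\<in>V. (bgrad V v \<bullet> h) *\<^sub>R v) = (\<lambda>h. h)"
  proof (rule simplex_linear_eqI)
    show "linear (\<lambda>h. \<Sum>v\<in>V. (bgrad V v \<bullet> h) *\<^sub>R v)"
      by (auto simp: linear_iff inner_add_right scaleR_add_left sum.distrib scaleR_sum_right)
    fix w w' assume "w \<in> V" "w' \<in> V"
    then show "(\<Sum>v\<in>V. (bgrad V v \<bullet> (w - w')) *\<^sub>R v) = w - w'"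
      using simplex_finite
      by (simp add: bgrad_inner scaleR_diff_left sum_subtractf of_bool_def if_distrib[of "\<lambda>c. c *\<^sub>R _"] cong: if_cong)
  qed (simp add: linear_iff)
  then have h: "(\<Sum>v\<in>V. (bgrad V v \<bullet> (x - w0)) *\<^sub>R v) = x - w0" by metis
  have "(\<Sum>v\<in>V. blam V v x *\<^sub>R v) = (\<Sum>v\<in>V. (of_bool (w0 = v) + bgrad V v \<bullet> (x - w0)) *\<^sub>R v)"
    by (intro sum.cong refl) (simp add: blam_shift[of _ x w0] blam_vertex w0)
  also have "\<dots> = w0 + (x - w0)"
    using w0 simplex_finite
    by (simp add: scaleR_add_left sum.distrib h of_bool_def if_distrib[of "\<lambda>c. c *\<^sub>R _"] cong: if_cong)
  finally show ?thesis by simp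
qed

lemma sum_blam: "(\<Sum>v\<in>V. blam V v x) = 1"
proof -
  obtain w0 where w0: "w0 \<in> V" using simplex_card by fastforce
  have "(\<Sum>v\<in>V. blam V v x) = (\<Sum>v\<in>V. of_bool (w0 = v) + bgrad V v \<bullet> (x - w0))"
    by (intro sum.cong refl) (simp add: blam_shift[of _ x w0] blam_vertex w0)
  also have "\<dots> = 1"
    using w0 simplex_finite
    by (simp add: sum.distrib of_bool_def sum_bgrad inner_sum_left[symmetric])
  finally show ?thesis .
qed

text \<open>\<open>blam\<close> recovers the coefficients of any convex combination of the vertices;
  conversely \<open>sum_blam\<close> and \<open>sum_blam_scaleR\<close> write every point as an
  affine combination with these coefficients.\<close>

lemma mem_simplex_iff: "x \<in> convex hull V \<longleftrightarrow> (\<forall>v\<in>V. 0 \<le> blam V v x)"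
proof
  assume "x \<in> convex hull V"
  then obtain u where u: "\<forall>v\<in>V. 0 \<le> u v" "sum u V = 1" "(\<Sum>v\<in>V. u v *\<^sub>R v) = x"
    using simplex_finite by (auto simp: convex_hull_finite)
  show "\<forall>v\<in>V. 0 \<le> blam V v x"
  proof
    fix w assume w: "w \<in> V"
    have "blam V w x = 1 + (\<Sum>v\<in>V. u v * (bgrad V w \<bullet> v)) - bgrad V w \<bullet> w"
      by (simp add: blam_def inner_diff_right inner_sum_right flip: u(3))
    also have "\<dots> = (\<Sum>v\<in>V. u v * (1 + bgrad V w \<bullet> (v - w)))"
      using u(2)
      by (simp add: inner_diff_right distrib_left right_diff_distrib sum.distrib sum_subtractf
          flip: sum_distrib_right)
    also have "\<dots> = (\<Sum>v\<in>V. u v * of_bool (v = w))"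
      using w by (intro sum.cong refl) (simp flip: blam_def add: blam_vertex)
    also have "\<dots> = u w"
      using w simplex_finite by (simp add: of_bool_def if_distrib cong: if_cong)
    finally show "0 \<le> blam V w x" using u(1) w by simp
  qed
next
  assume "\<forall>v\<in>V. 0 \<le> blam V v x"
  then show "x \<in> convex hull V"
    using simplex_finite sum_blam[of x] sum_blam_scaleR[of x]
    by (auto simp: convex_hull_finite intro!: exI[of _ "\<lambda>v. blam V v x"])
qed

text \<open>The coordinate of \<open>v\<close> grows from the opposite face towards
  \<open>v\<close>, so outward is against its gradient. For uniqueness, constancy along the face
  forces a multiple \<open>\<mu>\<close> of the gradient, the sign condition gives
  \<open>\<mu> < 0\<close>, and unit length fixes its value.\<close>

lemma onormal_eq:
  assumes v: "v \<in> V"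
  shows "onormal V (V - {v}) = - (bgrad V v /\<^sub>R norm (bgrad V v))"
  unfolding onormal_def
proof (rule the_equality)
  let ?a = "bgrad V v"
  have a0: "norm ?a > 0" using bgrad_nonzero[OF v] by simp
  show "norm (- (?a /\<^sub>R norm ?a)) = 1
      \<and> (\<forall>w\<in>V - {v}. \<forall>w'\<in>V - {v}. - (?a /\<^sub>R norm ?a) \<bullet> (w - w') = 0)
      \<and> (\<forall>w\<in>V - {v}. \<forall>va\<in>V - (V - {v}). - (?a /\<^sub>R norm ?a) \<bullet> (va - w) < 0)"
    using a0 v by (auto simp: bgrad_inner)
  fix n
  assume n: "norm n = 1 \<and> (\<forall>w\<in>V - {v}. \<forall>w'\<in>V - {v}. n \<bullet> (w - w') = 0)
      \<and> (\<forall>w\<in>V - {v}. \<forall>va\<in>V - (V - {v}). n \<bullet> (va - w) < 0)"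
  obtain w0 where w0: "w0 \<in> V" "w0 \<noteq> v" using simplex_not_singleton[OF v] by blast
  define \<mu> where "\<mu> = n \<bullet> (v - w0)"
  have mu: "\<mu> < 0" using n w0 v by (auto simp: \<mu>_def)
  have nd: "n \<bullet> (w - w0) = \<mu> * of_bool (w = v)" if "w \<in> V" for w
    using n w0 that by (auto simp: \<mu>_def)
  have "(\<lambda>x. n \<bullet> x) = (\<lambda>x. (\<mu> *\<^sub>R ?a) \<bullet> x)"
  proof (rule simplex_linear_eqI)
    fix w w' assume w: "w \<in> V" "w' \<in> V"
    have "n \<bullet> (w - w') = n \<bullet> (w - w0) - n \<bullet> (w' - w0)" by (simp add: inner_diff_right)
    also have "\<dots> = \<mu> * (of_bool (w = v) - of_bool (w' = v))"
      using w by (simp add: nd right_diff_distrib)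
    finally show "n \<bullet> (w - w') = (\<mu> *\<^sub>R ?a) \<bullet> (w - w')"
      using w v by (simp add: bgrad_inner)
  qed (auto simp: linear_iff inner_add_right algebra_simps)
  then have "n = \<mu> *\<^sub>R ?a" by (metis vector_eq_rdot inner_commute)
  moreover from this have "\<bar>\<mu>\<bar> * norm ?a = 1" using n by simp
  then have "\<mu> = - inverse (norm ?a)"
    using mu a0 by (simp add: field_simps)
  ultimately show "n = - (?a /\<^sub>R norm ?a)" by simp
qed

section \<open>Barycentric monomials and their integrals\<close>

lemma blam_param:
  assumes u: "u \<in> V" and vs: "distinct vs" "set vs \<subseteq> V" "length vs = Suc m"
    and x: "x = vs ! 0 + (\<Sum>i<m. s i *\<^sub>R (vs ! Suc i - vs ! 0))"
  shows "u \<notin> set vs \<Longrightarrow> blam V u x = 0"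
    and "j < Suc m \<Longrightarrow> u = vs ! j \<Longrightarrow> blam V u x = bary m s j"
proof -
  have mem: "vs ! k \<in> V" if "k < Suc m" for k using vs that nth_mem[of k vs] by auto
  have eq: "blam V u x = of_bool (vs ! 0 = u) + (\<Sum>i<m. s i * (of_bool (vs ! Suc i = u) - of_bool (vs ! 0 = u)))"
  proof -
    have "blam V u x = blam V u (vs ! 0) + (\<Sum>i<m. s i * (bgrad V u \<bullet> (vs ! Suc i - vs ! 0)))"
      unfolding blam_shift[of u x "vs ! 0"] by (simp add: x inner_sum_right)
    then show ?thesis by (simp add: blam_vertex u mem bgrad_inner del: sum_mult_of_bool_eq)
  qed
  show "blam V u x = 0" if "u \<notin> set vs"
  proof -
    have "vs ! k \<noteq> u" if "k < Suc m" for k using \<open>u \<notin> set vs\<close> that vs nth_mem[of k vs] by auto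
    then show ?thesis by (simp add: eq)
  qed
  show "blam V u x = bary m s j" if j: "j < Suc m" "u = vs ! j"
  proof -
    have d: "vs ! k = u \<longleftrightarrow> k = j" if "k < Suc m" for k
      using vs j that by (simp add: nth_eq_iff_index_eq)
    show ?thesis
    proof (cases j)
      case 0
      then show ?thesis using d by (simp add: eq bary_def sum_negf)
    next
      case (Suc k)
      then have "blam V u x = (\<Sum>i<m. s i * of_bool (i = k))"
        using d by (simp add: eq)
      also have "\<dots> = s k" using Suc j by (simp add: of_bool_def if_distrib cong: if_cong)
      finally show ?thesis using Suc by (simp add: bary_def)
    qed
  qed
qed

text \<open>Serves elements and faces at once: \<open>X = {}\<close> gives the whole simplex,
  \<open>X = {v}\<close> the face opposite \<open>v\<close>, where the factor
  \<open>0 ^ \<beta> v\<close> is 1 or 0 according to whether the exponent of \<open>v\<close>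
  vanishes.\<close>

lemma bmono_param:
  assumes vs: "distinct vs" "set vs = V - X" "length vs = Suc m"
  shows "bmono V \<beta> (vs ! 0 + (\<Sum>i<m. s i *\<^sub>R (vs ! Suc i - vs ! 0)))
      = (\<Prod>v\<in>V \<inter> X. 0 ^ \<beta> v) * (\<Prod>j<Suc m. bary m s j ^ \<beta> (vs ! j))"
proof -
  let ?x = "vs ! 0 + (\<Sum>i<m. s i *\<^sub>R (vs ! Suc i - vs ! 0))"
  have sub: "set vs \<subseteq> V" using vs by auto
  have bij: "bij_betw ((!) vs) {..<Suc m} (V - X)"
    using bij_betw_nth[OF vs(1), of "{..<Suc m}" "V - X"] vs by auto
  have "bmono V \<beta> ?x = (\<Prod>v\<in>V \<inter> X. blam V v ?x ^ \<beta> v) * (\<Prod>v\<in>V - X. blam V v ?x ^ \<beta> v)"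
    unfolding bmono_def using simplex_finite
    by (subst prod.union_disjoint[symmetric]) (auto intro!: prod.cong)
  also have "(\<Prod>v\<in>V \<inter> X. blam V v ?x ^ \<beta> v) = (\<Prod>v\<in>V \<inter> X. 0 ^ \<beta> v)"
    using blam_param(1)[OF _ vs(1) sub vs(3) refl] vs(2) by (intro prod.cong refl) auto
  also have "(\<Prod>v\<in>V - X. blam V v ?x ^ \<beta> v) = (\<Prod>j<Suc m. blam V (vs ! j) ?x ^ \<beta> (vs ! j))"
    by (rule prod.reindex_bij_betw[OF bij, symmetric])
  also have "\<dots> = (\<Prod>j<Suc m. bary m s j ^ \<beta> (vs ! j))"
  proof (intro prod.cong refl)
    fix j assume "j \<in> {..<Suc m}"
    then have "blam V (vs ! j) ?x = bary m s j"
      using sub vs(3) nth_mem[of j vs] by (intro blam_param(2)[OF _ vs(1) sub vs(3) refl]) auto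
    then show "blam V (vs ! j) ?x ^ \<beta> (vs ! j) = bary m s j ^ \<beta> (vs ! j)" by simp
  qed
  finally show ?thesis .
qed

lemma dirichlet_vertices:
  assumes vs: "distinct vs" "set vs = X" "length vs = Suc m"
  shows "(LINT s:std_simplex m|nat_lborel m. \<Prod>j<Suc m. bary m s j ^ \<beta> (vs ! j))
    = (\<Prod>v\<in>X. fact (\<beta> v)) / (fact (m + sum \<beta> X) :: real)"
proof -
  have bij: "bij_betw ((!) vs) {..<Suc m} X"
    using bij_betw_nth[OF vs(1), of "{..<Suc m}" X] vs by auto
  show ?thesis
    unfolding dirichlet_integral[of m "\<lambda>j. \<beta> (vs ! j)"]
    using prod.reindex_bij_betw[OF bij, of "\<lambda>v. fact (\<beta> v)"] sum.reindex_bij_betw[OF bij, of \<beta>] by simp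
qed

lemma face_int_bmono:
  assumes v: "v \<in> V"
  shows "face_int (V - {v}) (\<lambda>x. complex_of_real (bmono V \<beta> x)) = complex_of_real
    (sqrt (gram_det (V - {v})) * (if \<beta> v = 0 then (\<Prod>v\<in>V. fact (\<beta> v)) / fact (CARD('d) - 1 + sum \<beta> V) else 0))"
proof -
  define W where "W = V - {v}"
  define n where "n = CARD('d) - 1"
  define ws where "ws = face_list W"
  have W: "finite W" using simplex_finite by (simp add: W_def)
  have card: "card W = Suc n" using simplex_card simplex_finite v by (simp add: W_def n_def)
  have ws: "distinct ws" "set ws = V - {v}" "length ws = Suc n"
    using face_list_props[OF W] card by (auto simp: ws_def W_def)
  have fp: "face_param W s = ws ! 0 + (\<Sum>i<n. s i *\<^sub>R (ws ! Suc i - ws ! 0))" for s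
    by (simp add: face_param_def face_edge_def ws_def card)
  have mono: "bmono V \<beta> (face_param W s) = 0 ^ \<beta> v * (\<Prod>j<Suc n. bary n s j ^ \<beta> (ws ! j))" for s
    unfolding fp bmono_param[OF ws] using v by simp
  have "face_int W (\<lambda>x. complex_of_real (bmono V \<beta> x))
      = complex_of_real (sqrt (gram_det W) * (LINT s:std_simplex n|nat_lborel n. bmono V \<beta> (face_param W s)))"
    by (simp add: face_int_def card set_integral_complex_of_real)
  also have "(LINT s:std_simplex n|nat_lborel n. bmono V \<beta> (face_param W s))
      = 0 ^ \<beta> v * ((\<Prod>v\<in>W. fact (\<beta> v)) / fact (n + sum \<beta> W))"
    unfolding mono by (subst set_integral_mult_right) (simp only: dirichlet_vertices[OF ws] W_def)
  also have "\<dots> = (if \<beta> v = 0 then (\<Prod>v\<in>V. fact (\<beta> v)) / fact (n + sum \<beta> V) else 0)"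
    using prod.remove[OF simplex_finite v, of "\<lambda>v. fact (\<beta> v) :: real"] sum.remove[OF simplex_finite v, of \<beta>]
    by (simp add: W_def power_0_left)
  finally show ?thesis by (simp add: W_def n_def)
qed

lemma pdeg_blam: "pdeg 1 (\<lambda>x. complex_of_real (blam V v x))"
proof -
  have "pdeg 1 (\<lambda>x. complex_of_real (1 - bgrad V v \<bullet> v) + (\<Sum>i\<in>UNIV. complex_of_real (bgrad V v $ i) * (complex_of_real (x $ i) * 1)))"
    unfolding One_nat_def by (intro pdeg.add pdeg.const pdeg_sum pdeg_scale pdeg.coord)
  then show ?thesis by (simp add: blam_def inner_diff_right inner_vec_def right_diff_distrib sum_subtractf algebra_simps)
qed

lemma pdeg_bmono: "\<exists>q. pdeg q (\<lambda>x. complex_of_real (bmono V \<beta> x))"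
proof -
  have pow: "\<exists>q. pdeg q (\<lambda>x. complex_of_real (blam V v x) ^ k)" for v k
  proof (induction k)
    case 0
    then show ?case by (auto intro: pdeg.const)
  next
    case (Suc k)
    then show ?case using pdeg_mult[OF pdeg_blam] by auto
  qed
  have "\<exists>q. pdeg q (\<lambda>x. \<Prod>v\<in>X. complex_of_real (blam V v x) ^ \<beta> v)" for X
  proof (induction X rule: infinite_finite_induct)
    case (insert v X)
    then obtain q r where "pdeg q (\<lambda>x. complex_of_real (blam V v x) ^ \<beta> v)"
      "pdeg r (\<lambda>x. \<Prod>v\<in>X. complex_of_real (blam V v x) ^ \<beta> v)" using pow by blast
    from pdeg_mult[OF this] show ?case using insert by auto
  qed (auto intro: pdeg.const)
  then show ?thesis by (simp add: bmono_def)
qed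

text \<open>Base times height: \<open>1 / norm (bgrad V v)\<close> is the height over the face
  opposite \<open>v\<close>. Any vertex may serve as apex, and \<open>divergence_bmono\<close>
  exploits that the left side does not depend on this choice.\<close>

lemma integral_simplex_bmono_aux:
  fixes b :: "'n::{finite,wellorder} \<Rightarrow> 'd"
  assumes b: "bij b" and v: "v \<in> V"
  shows "integral (convex hull V) (\<lambda>x. complex_of_real (bmono V \<beta> x)) = complex_of_real
    (sqrt (gram_det (V - {v})) / norm (bgrad V v) * ((\<Prod>v\<in>V. fact (\<beta> v)) / fact (CARD('d) + sum \<beta> V)))"
proof -
  define W where "W = V - {v}"
  define n where "n = CARD('d) - 1"
  have n: "CARD('d) = Suc n" by (simp add: n_def)
  \<comment> \<open>The apex goes last, so that all edges but the last lie in the face opposite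
    \<open>v\<close> and are the edges \<open>face_edge W\<close>.\<close>
  define vs where "vs = face_list W @ [v]"
  have W: "finite W" using simplex_finite by (simp add: W_def)
  have card: "card W = Suc n" using simplex_card simplex_finite v by (simp add: W_def n)
  have vs: "distinct vs" "set vs = V" "length vs = Suc (Suc n)"
    using face_list_props[OF W] card v by (auto simp: vs_def W_def)
  define E where "E i = vs ! Suc i - vs ! 0" for i
  define A where "A i = bgrad V (vs ! Suc i)" for i
  have mem: "vs ! k \<in> V" if "k < Suc (Suc n)" for k using vs that nth_mem[of k vs] by auto
  have dual: "A i \<bullet> E j = (if i = j then 1 else 0)" if "i < Suc n" "j < Suc n" for i j
    using that vs by (simp add: A_def E_def bgrad_inner mem nth_eq_iff_index_eq)
  have "card (UNIV :: 'n set) = CARD('d)" using b by (rule bij_betw_same_card)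
  then obtain e where e: "bij_betw e {..<Suc n} (UNIV :: 'n set)"
    using ex_bij_betw_nat_finite[of "UNIV :: 'n set"] n by (auto simp: atLeast0LessThan)
  let ?D = "det (frame_matrix b e (Suc n) E)"
  note D = det_frame_matrix_base_height[OF b e dual]
  have "gram_sum n E E = gram_det W"
  proof -
    have "gram_sum n E E = gram_sum n (face_edge W) (face_edge W)"
      using face_list_props(3)[OF W] card
      by (intro gram_sum_cong) (auto simp: E_def face_edge_def vs_def nth_append)
    then show ?thesis by (simp add: gram_det_def gram_sum_def card)
  qed
  moreover have "A n = bgrad V v"
    using face_list_props(3)[OF W] card by (simp add: A_def vs_def nth_append)
  ultimately have absD: "\<bar>?D\<bar> = sqrt (gram_det W) / norm (bgrad V v)"
    using D(2) bgrad_nonzero[OF v] by (simp add: field_simps)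
  define f where "f x = complex_of_real (bmono V \<beta> x)" for x
  obtain q where q: "pdeg q f" using pdeg_bmono[of \<beta>] by (auto simp: f_def[abs_def])
  define x where "x s = vs ! 0 + (\<Sum>i<Suc n. s i *\<^sub>R E i)" for s
  have fx: "f (x s) = complex_of_real (\<Prod>j<Suc (Suc n). bary (Suc n) s j ^ \<beta> (vs ! j))" for s
    unfolding f_def x_def E_def using bmono_param[of vs "{}" "Suc n"] vs by simp
  have in_hull: "x s \<in> convex hull V \<longleftrightarrow> s \<in> std_simplex (Suc n)" if "s \<in> space (nat_lborel (Suc n))" for s
  proof -
    have "blam V (vs ! j) (x s) = bary (Suc n) s j" if "j < Suc (Suc n)" for j
      unfolding x_def E_def using vs that mem by (intro blam_param(2)[OF _ _ _ _ refl]) auto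
    then have "(\<forall>u\<in>V. 0 \<le> blam V u (x s)) \<longleftrightarrow> (\<forall>j<Suc (Suc n). 0 \<le> bary (Suc n) s j)"
      unfolding vs(2)[symmetric] all_set_conv_all_nth vs(3) by simp
    then show ?thesis
      unfolding mem_simplex_iff bary_nonneg_iff[OF that] .
  qed
  have comp: "compact (convex hull V)" using simplex_finite by (rule finite_imp_compact_convex_hull)
  then have [measurable]: "convex hull V \<in> sets borel" by (auto intro: borel_closed compact_imp_closed)
  note [measurable] = borel_measurable_pdeg[OF q]
  have "integral (convex hull V) f = (LINT y:convex hull V|lborel. f y)"
    using comp continuous_on_pdeg[OF q] borel_integrable_compact[of "convex hull V" f]
    by (intro set_borel_integral_eq_integral(2)[symmetric]) (auto simp: set_integrable_def)
  also have "\<dots> = complex_of_real \<bar>?D\<bar> * (LINT s|nat_lborel (Suc n). indicator (convex hull V) (x s) *\<^sub>R f (x s))"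
    unfolding set_lebesgue_integral_def x_def
    by (rule integral_affine_nat_lborel[OF b e frame_matrix_def D(1)]) measurable
  also have "(LINT s|nat_lborel (Suc n). indicator (convex hull V) (x s) *\<^sub>R f (x s))
      = (LINT s:std_simplex (Suc n)|nat_lborel (Suc n). complex_of_real (\<Prod>j<Suc (Suc n). bary (Suc n) s j ^ \<beta> (vs ! j)))"
    unfolding set_lebesgue_integral_def
    by (rule Bochner_Integration.integral_cong) (auto simp: fx in_hull indicator_def)
  also have "\<dots> = complex_of_real ((\<Prod>v\<in>V. fact (\<beta> v)) / fact (Suc n + sum \<beta> V))"
    unfolding set_integral_complex_of_real dirichlet_vertices[OF vs] ..
  finally show ?thesis by (simp add: f_def[abs_def] absD W_def n)
qed

text \<open>The change of variables works on a well-ordered index type; the numeral types 2 and 3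
  provide one for each of the two dimensions, linked to \<open>'d\<close> by a bijection.\<close>

lemma integral_simplex_bmono:
  assumes dim: "CARD('d) = 2 \<or> CARD('d) = 3" and v: "v \<in> V"
  shows "integral (convex hull V) (\<lambda>x. complex_of_real (bmono V \<beta> x)) = complex_of_real
    (sqrt (gram_det (V - {v})) / norm (bgrad V v) * ((\<Prod>v\<in>V. fact (\<beta> v)) / fact (CARD('d) + sum \<beta> V)))"
  using dim
proof
  assume "CARD('d) = 2"
  then obtain b :: "2 \<Rightarrow> 'd" where "bij b"
    using finite_same_card_bij[of "UNIV :: 2 set" "UNIV :: 'd set"] by auto
  from integral_simplex_bmono_aux[OF this v] show ?thesis .
next
  assume "CARD('d) = 3"
  then obtain b :: "3 \<Rightarrow> 'd" where "bij b"
    using finite_same_card_bij[of "UNIV :: 3 set" "UNIV :: 'd set"] by auto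
  from integral_simplex_bmono_aux[OF this v] show ?thesis .
qed

end

section \<open>The divergence theorem on a simplex\<close>

context
  fixes V :: "(real^'d::finite) set"
  assumes V: "simplex_verts V"
begin

text \<open>The product rule; the truncated exponent \<open>\<beta> u - 1\<close> is harmless at
  \<open>\<beta> u = 0\<close>, where the coefficient is zero.\<close>

lemma pdiff_bmono:
  "pdiff i (\<lambda>x. complex_of_real (bmono V \<beta> x)) x
    = (\<Sum>u\<in>V. complex_of_real (real (\<beta> u) * bgrad V u $ i) * complex_of_real (bmono V (\<beta>(u := \<beta> u - 1)) x))"
proof -
  let ?y = "\<lambda>t. x + t *\<^sub>R axis i 1"
  have lam: "blam V v (?y t) = blam V v x + t * bgrad V v $ i" for v t
    by (simp add: blam_def inner_add_right inner_diff_right inner_axis)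
  have D: "((\<lambda>t. blam V v (?y t) ^ \<beta> v) has_real_derivative
      (real (\<beta> v) * blam V v x ^ (\<beta> v - 1) * bgrad V v $ i)) (at 0)" for v
    unfolding lam by (auto intro!: derivative_eq_intros)
  have "((\<lambda>t. bmono V \<beta> (?y t)) has_real_derivative
      (\<Sum>u\<in>V. (real (\<beta> u) * blam V u x ^ (\<beta> u - 1) * bgrad V u $ i)
        * (\<Prod>v\<in>V - {u}. blam V v (?y 0) ^ \<beta> v))) (at 0)"
    unfolding bmono_def by (intro has_field_derivative_prod D)
  also have "(\<Sum>u\<in>V. (real (\<beta> u) * blam V u x ^ (\<beta> u - 1) * bgrad V u $ i) * (\<Prod>v\<in>V - {u}. blam V v (?y 0) ^ \<beta> v))
      = (\<Sum>u\<in>V. real (\<beta> u) * bgrad V u $ i * bmono V (\<beta>(u := \<beta> u - 1)) x)"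
    unfolding bmono_def
    by (intro sum.cong refl) (auto simp: prod.remove[OF simplex_finite[OF V]])
  finally have "((\<lambda>t. complex_of_real (bmono V \<beta> (?y t))) has_vector_derivative
      complex_of_real (\<Sum>u\<in>V. real (\<beta> u) * bgrad V u $ i * bmono V (\<beta>(u := \<beta> u - 1)) x)) (at 0)"
    by (intro has_vector_derivative_of_real) (simp add: has_real_derivative_iff_has_vector_derivative)
  then show ?thesis
    unfolding pdiff_def by (subst vector_derivative_at) auto
qed

lemma faces_simplex: "faces V = (\<lambda>v. V - {v}) ` V" "inj_on (\<lambda>v. V - {v}) V"
  by (auto simp: faces_def inj_on_def)

lemma finite_faces: "finite (faces V)"
  using simplex_finite[OF V] by (simp add: faces_def)

lemma face_finite: "W \<in> faces V \<Longrightarrow> finite W"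
  using simplex_finite[OF V] by (auto simp: faces_def)

lemma face_nonempty: "W \<in> faces V \<Longrightarrow> W \<noteq> {}"
  using simplex_not_singleton[OF V] by (fastforce simp: faces_def)

text \<open>Let n = d - 1. Differentiation lowers the degree by one, so volume and face terms share
  the denominator \<open>fact (n + sum \<beta> V)\<close>. Since \<open>\<beta> u\<close> times the
  factorial product of the lowered exponents restores the original product, every \<open>u\<close>
  with nonzero exponent contributes the same number \<open>Q\<close> times its gradient. The
  gradients add up to zero, so this equals minus the sum over the \<open>u\<close> with exponent
  zero, and the faces opposite those are the ones on which the monomial survives.\<close>

lemma divergence_bmono:
  assumes dim: "CARD('d) = 2 \<or> CARD('d) = 3"
  shows "integral (convex hull V) (pdiff i (\<lambda>x. complex_of_real (bmono V \<beta> x)))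
    = (\<Sum>W\<in>faces V. complex_of_real (onormal V W $ i) * face_int W (\<lambda>x. complex_of_real (bmono V \<beta> x)))"
proof -
  define K where "K = convex hull V"
  define n where "n = CARD('d) - 1"
  have n: "CARD('d) = Suc n" by (simp add: n_def)
  have fin: "finite V" by (rule simplex_finite[OF V])
  define F where "F \<beta> = (\<Prod>v\<in>V. fact (\<beta> v) :: real)" for \<beta> :: "real^'d \<Rightarrow> nat"
  define h where "h v = sqrt (gram_det (V - {v})) / norm (bgrad V v)" for v
  \<comment> \<open>d! times the volume. \<open>h v\<close> equals it for every vertex, because the
    volume does not depend on the chosen apex.\<close>
  define C where "C = Re (integral K (\<lambda>x. complex_of_real (bmono V (\<lambda>_. 0) x))) * fact (Suc n)"
  have vol: "integral K (\<lambda>x. complex_of_real (bmono V \<beta> x)) = complex_of_real (h v * (F \<beta> / fact (Suc n + sum \<beta> V)))"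
    if "v \<in> V" for v \<beta>
    unfolding K_def integral_simplex_bmono[OF V dim that] by (simp add: h_def F_def n)
  have h: "h v = C" if "v \<in> V" for v
  proof -
    have "Re (integral K (\<lambda>x. complex_of_real (bmono V (\<lambda>_. 0) x))) = h v * (F (\<lambda>_. 0) / fact (Suc n + 0))"
      unfolding vol[OF that] by (simp only: Re_complex_of_real sum.neutral_const)
    then show ?thesis by (simp add: C_def F_def del: fact_Suc)
  qed
  obtain v0 where v0: "v0 \<in> V" using simplex_card[OF V] by fastforce
  define Q where "Q = C * F \<beta> / fact (n + sum \<beta> V)"
  have coeff: "real (\<beta> u) * (C * (F (\<beta>(u := \<beta> u - 1)) / fact (Suc n + sum (\<beta>(u := \<beta> u - 1)) V))) = of_bool (\<beta> u \<noteq> 0) * Q"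
    if u: "u \<in> V" for u
  proof (cases "\<beta> u")
    case (Suc k)
    have F: "F \<beta> = F (\<beta>(u := k)) * real (\<beta> u)"
      unfolding F_def prod.remove[OF fin u] by (simp add: Suc)
    have "Suc (sum (\<beta>(u := k)) V) = sum \<beta> V"
      unfolding sum.remove[OF fin u] by (simp add: Suc)
    then have "Suc n + sum (\<beta>(u := k)) V = n + sum \<beta> V" by simp
    moreover have "\<beta>(u := \<beta> u - 1) = \<beta>(u := k)" by (simp add: Suc)
    ultimately show ?thesis
      unfolding Q_def F by (simp only: Suc) (simp del: fun_upd_apply of_nat_Suc fact_Suc)
  qed simp
  have "integral K (pdiff i (\<lambda>x. complex_of_real (bmono V \<beta> x)))
      = (\<Sum>u\<in>V. integral K (\<lambda>x. complex_of_real (real (\<beta> u) * bgrad V u $ i) * complex_of_real (bmono V (\<beta>(u := \<beta> u - 1)) x)))"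
    unfolding pdiff_bmono[abs_def]
  proof (rule integral_sum[OF fin])
    fix u
    obtain q where "pdeg q (\<lambda>x. complex_of_real (bmono V (\<beta>(u := \<beta> u - 1)) x))"
      using pdeg_bmono[OF V] by blast
    then show "(\<lambda>x. complex_of_real (real (\<beta> u) * bgrad V u $ i) * complex_of_real (bmono V (\<beta>(u := \<beta> u - 1)) x)) integrable_on K"
      unfolding K_def by (intro integrable_on_hull_pdeg[OF fin] pdeg_scale)
  qed
  also have "\<dots> = (\<Sum>u\<in>V. complex_of_real (real (\<beta> u) * bgrad V u $ i) * complex_of_real (C * (F (\<beta>(u := \<beta> u - 1)) / fact (Suc n + sum (\<beta>(u := \<beta> u - 1)) V))))"
    unfolding integral_mult_right vol[OF v0] h[OF v0] ..
  also have "\<dots> = complex_of_real (\<Sum>u\<in>V. bgrad V u $ i * (real (\<beta> u) * (C * (F (\<beta>(u := \<beta> u - 1)) / fact (Suc n + sum (\<beta>(u := \<beta> u - 1)) V)))))"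
    by (simp add: mult_ac)
  also have "\<dots> = complex_of_real (\<Sum>u\<in>V. bgrad V u $ i * (of_bool (\<beta> u \<noteq> 0) * Q))"
    by (intro arg_cong[where f = complex_of_real] sum.cong refl) (simp only: coeff)
  also have "(\<Sum>u\<in>V. bgrad V u $ i * (of_bool (\<beta> u \<noteq> 0) * Q)) = (\<Sum>u\<in>V. bgrad V u $ i * Q - bgrad V u $ i * (of_bool (\<beta> u = 0) * Q))"
    by (intro sum.cong) auto
  also have "\<dots> = (\<Sum>u\<in>V. bgrad V u) $ i * Q - (\<Sum>u\<in>V. bgrad V u $ i * (of_bool (\<beta> u = 0) * Q))"
    by (simp only: sum_subtractf sum_distrib_right sum_component)
  also have "\<dots> = (\<Sum>u\<in>V. - (bgrad V u $ i * (of_bool (\<beta> u = 0) * Q)))"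
    by (simp only: sum_bgrad[OF V] sum_negf) simp
  finally have L: "integral K (pdiff i (\<lambda>x. complex_of_real (bmono V \<beta> x)))
      = complex_of_real (\<Sum>u\<in>V. - (bgrad V u $ i * (of_bool (\<beta> u = 0) * Q)))" .
  have "(\<Sum>W\<in>faces V. complex_of_real (onormal V W $ i) * face_int W (\<lambda>x. complex_of_real (bmono V \<beta> x)))
      = (\<Sum>v\<in>V. complex_of_real (onormal V (V - {v}) $ i) * face_int (V - {v}) (\<lambda>x. complex_of_real (bmono V \<beta> x)))"
    unfolding faces_simplex(1) by (simp add: sum.reindex[OF faces_simplex(2)])
  also have "\<dots> = (\<Sum>v\<in>V. complex_of_real (- (bgrad V v $ i * (of_bool (\<beta> v = 0) * Q))))"
  proof (intro sum.cong refl)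
    fix v assume v: "v \<in> V"
    have "sqrt (gram_det (V - {v})) = C * norm (bgrad V v)"
      using h[OF v] bgrad_nonzero[OF V v] by (simp add: h_def field_simps)
    then show "complex_of_real (onormal V (V - {v}) $ i) * face_int (V - {v}) (\<lambda>x. complex_of_real (bmono V \<beta> x))
        = complex_of_real (- (bgrad V v $ i * (of_bool (\<beta> v = 0) * Q)))"
      unfolding onormal_eq[OF V v] face_int_bmono[OF V v]
      using bgrad_nonzero[OF V v] by (simp add: Q_def F_def n_def)
  qed
  finally show ?thesis using L by (simp add: K_def)
qed

inductive bspan :: "(real^'d \<Rightarrow> complex) \<Rightarrow> bool" where
  mono: "bspan (\<lambda>x. c * complex_of_real (bmono V \<beta> x))"
| add: "bspan f \<Longrightarrow> bspan g \<Longrightarrow> bspan (\<lambda>x. f x + g x)"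

lemma bspan_sum: "(\<And>a. a \<in> A \<Longrightarrow> bspan (f a)) \<Longrightarrow> bspan (\<lambda>x. \<Sum>a\<in>A. f a x)"
proof (induction A rule: infinite_finite_induct)
  case (insert a A)
  then show ?case using bspan.add[of "f a"] by simp
qed (use bspan.mono[of 0] in simp_all)

lemma bspan_blam: "bspan f \<Longrightarrow> v \<in> V \<Longrightarrow> bspan (\<lambda>x. c * complex_of_real (blam V v x) * f x)"
proof (induction rule: bspan.induct)
  case (mono d \<beta>)
  have "blam V v x * bmono V \<beta> x = bmono V (\<beta>(v := Suc (\<beta> v))) x" for x
    unfolding bmono_def prod.remove[OF simplex_finite[OF V] mono] by simp
  then have eq: "c * complex_of_real (blam V v x) * (d * complex_of_real (bmono V \<beta> x))
      = (c * d) * complex_of_real (bmono V (\<beta>(v := Suc (\<beta> v))) x)" for x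
    by (metis (no_types, lifting) mult.assoc mult.left_commute of_real_mult)
  show ?case unfolding eq by (rule bspan.mono)
next
  case (add f g)
  from bspan.add[OF add.IH(1)[OF add.prems] add.IH(2)[OF add.prems]] show ?case
    by (simp add: distrib_left)
qed

text \<open>By \<open>sum_blam_scaleR\<close> a coordinate function is a combination of barycentric
  coordinates, and multiplying a barycentric monomial by one of these raises an exponent, so the
  span is closed under \<open>coord\<close>.\<close>

lemma pdeg_imp_bspan: "pdeg p f \<Longrightarrow> bspan f"
proof (induction rule: pdeg.induct)
  case (const p c)
  then show ?case using bspan.mono[of c "\<lambda>_. 0"] by (simp add: bmono_def)
next
  case (add p f g)
  then show ?case by (auto intro: bspan.add)
next
  case (coord p f i)
  have "complex_of_real (x $ i) * f x = (\<Sum>v\<in>V. complex_of_real (v $ i) * complex_of_real (blam V v x) * f x)" for x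
  proof -
    have "x $ i = (\<Sum>v\<in>V. blam V v x *\<^sub>R v) $ i" by (simp add: sum_blam_scaleR[OF V])
    then have "x $ i = (\<Sum>v\<in>V. v $ i * blam V v x)" by (simp add: mult.commute)
    then have "complex_of_real (x $ i) = (\<Sum>v\<in>V. complex_of_real (v $ i) * complex_of_real (blam V v x))"
      by (metis (no_types, lifting) of_real_mult of_real_sum sum.cong)
    then show ?thesis by (simp add: sum_distrib_right)
  qed
  moreover have "bspan (\<lambda>x. \<Sum>v\<in>V. complex_of_real (v $ i) * complex_of_real (blam V v x) * f x)"
    by (intro bspan_sum bspan_blam coord)
  ultimately show ?case by simp
qed

lemma divergence_simplex:
  assumes dim: "CARD('d) = 2 \<or> CARD('d) = 3" and f: "pdeg p f"
  shows "integral (convex hull V) (pdiff i f)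
    = (\<Sum>W\<in>faces V. complex_of_real (onormal V W $ i) * face_int W f)"
proof -
  have fin: "finite V" by (rule simplex_finite[OF V])
  have comb: "integral (convex hull V) (pdiff i (\<lambda>x. c * f x + d * g x))
      = (\<Sum>W\<in>faces V. complex_of_real (onormal V W $ i) * face_int W (\<lambda>x. c * f x + d * g x))"
    if f: "pdeg p f" "integral (convex hull V) (pdiff i f)
        = (\<Sum>W\<in>faces V. complex_of_real (onormal V W $ i) * face_int W f)"
      and g: "pdeg q g" "integral (convex hull V) (pdiff i g)
        = (\<Sum>W\<in>faces V. complex_of_real (onormal V W $ i) * face_int W g)" for p q f g c d
  proof -
    have "integral (convex hull V) (pdiff i (\<lambda>x. c * f x + d * g x))
        = c * integral (convex hull V) (pdiff i f) + d * integral (convex hull V) (pdiff i g)"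
      unfolding pdiff_comb[OF f(1) g(1), abs_def]
      by (subst integral_add)
        (auto intro!: integrable_on_hull_pdeg[OF fin] pdeg_scale pdeg_pdiff[OF f(1)] pdeg_pdiff[OF g(1)])
    also have "\<dots> = (\<Sum>W\<in>faces V. complex_of_real (onormal V W $ i) * (c * face_int W f + d * face_int W g))"
      by (simp add: f g sum_distrib_left distrib_left sum.distrib mult.left_commute)
    also have "\<dots> = (\<Sum>W\<in>faces V. complex_of_real (onormal V W $ i) * face_int W (\<lambda>x. c * f x + d * g x))"
      by (intro sum.cong refl) (simp add: face_int_comb[OF face_finite face_nonempty f(1) g(1)])
    finally show ?thesis .
  qed
  from pdeg_imp_bspan[OF f]
  \<comment> \<open>A degree bound is carried along because \<open>comb\<close> asks for
    polynomials, while \<open>bspan\<close> records no degree.\<close>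
  have "(\<exists>q. pdeg q f) \<and> integral (convex hull V) (pdiff i f)
      = (\<Sum>W\<in>faces V. complex_of_real (onormal V W $ i) * face_int W f)"
  proof (induction rule: bspan.induct)
    case (mono c \<beta>)
    obtain q where q: "pdeg q (\<lambda>x. complex_of_real (bmono V \<beta> x))" using pdeg_bmono[OF V] by blast
    show ?case
      using comb[OF q divergence_bmono[OF dim] q divergence_bmono[OF dim], of c 0] pdeg_scale[OF q, of c] by auto
  next
    case (add f g)
    then obtain q r where qr: "pdeg q f" "pdeg r g" by blast
    have "pdeg (max q r) (\<lambda>x. f x + g x)"
      by (intro pdeg.add pdeg_mono[OF qr(1)] pdeg_mono[OF qr(2)]) auto
    then show ?case using comb[OF qr(1) _ qr(2), of 1 1] add by auto
  qed
  then show ?thesis by blast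
qed

end

section \<open>Sesquilinear forms on function spaces\<close>

definition comb_closed :: "('i \<Rightarrow> complex) set \<Rightarrow> bool" where
  "comb_closed S \<longleftrightarrow> (\<forall>x\<in>S. \<forall>y\<in>S. \<forall>c d. (\<lambda>i. c * x i + d * y i) \<in> S)"

definition lin_map :: "('i \<Rightarrow> complex) set \<Rightarrow> ('j \<Rightarrow> complex) set \<Rightarrow> (('i \<Rightarrow> complex) \<Rightarrow> 'j \<Rightarrow> complex) \<Rightarrow> bool" where
  "lin_map S X L \<longleftrightarrow> (\<forall>x\<in>S. L x \<in> X) \<and>
     (\<forall>x\<in>S. \<forall>y\<in>S. \<forall>c d. L (\<lambda>i. c * x i + d * y i) = (\<lambda>j. c * L x j + d * L y j))"

text \<open>Relative to a set, since the integrals involved are additive only on integrable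
  functions.\<close>

definition sesq :: "('i \<Rightarrow> complex) set \<Rightarrow> (('i \<Rightarrow> complex) \<Rightarrow> ('i \<Rightarrow> complex) \<Rightarrow> complex) \<Rightarrow> bool" where
  "sesq S t \<longleftrightarrow> (\<forall>x\<in>S. \<forall>y\<in>S. \<forall>z\<in>S. \<forall>c d.
      t (\<lambda>i. c * x i + d * y i) z = c * t x z + d * t y z
    \<and> t z (\<lambda>i. c * x i + d * y i) = cnj c * t z x + cnj d * t z y)"

lemma sesqD:
  assumes "sesq S t" "x \<in> S" "y \<in> S" "z \<in> S"
  shows "t (\<lambda>i. c * x i + d * y i) z = c * t x z + d * t y z"
    and "t z (\<lambda>i. c * x i + d * y i) = cnj c * t z x + cnj d * t z y"
  using assms unfolding sesq_def by blast+

lemma lin_mapD: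
  "lin_map S X L \<Longrightarrow> x \<in> S \<Longrightarrow> y \<in> S \<Longrightarrow> L (\<lambda>i. c * x i + d * y i) = (\<lambda>j. c * L x j + d * L y j)"
  unfolding lin_map_def by blast

lemma sesq_cong:
  assumes "comb_closed S" "\<And>x y. x \<in> S \<Longrightarrow> y \<in> S \<Longrightarrow> t x y = u x y" "sesq S u"
  shows "sesq S t"
  using assms unfolding sesq_def comb_closed_def by simp

lemma sesq_comp:
  assumes "sesq X t" "lin_map S X L" "lin_map S X M"
  shows "sesq S (\<lambda>x y. t (L x) (M y))"
  using assms unfolding sesq_def lin_map_def by simp

lemma sesq_add: "sesq S t \<Longrightarrow> sesq S u \<Longrightarrow> sesq S (\<lambda>x y. t x y + u x y)"
  unfolding sesq_def by (simp add: algebra_simps)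

lemma sesq_scale: "sesq S t \<Longrightarrow> sesq S (\<lambda>x y. k * t x y)"
  unfolding sesq_def by (simp add: algebra_simps)

lemma sesq_diff: "sesq S t \<Longrightarrow> sesq S u \<Longrightarrow> sesq S (\<lambda>x y. t x y - u x y)"
  unfolding sesq_def by (simp add: algebra_simps)

lemma sesq_sum: "(\<And>a. a \<in> I \<Longrightarrow> sesq S (t a)) \<Longrightarrow> sesq S (\<lambda>x y. \<Sum>a\<in>I. t a x y)"
  by (induction I rule: infinite_finite_induct) (auto intro: sesq_add simp: sesq_def[of S "\<lambda>x y. 0"])

lemma lin_map_comp: "lin_map X Y M \<Longrightarrow> lin_map S X L \<Longrightarrow> lin_map S Y (\<lambda>x. M (L x))"
  unfolding lin_map_def by simp

lemma sesq_nondegenerate_represents: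
  fixes S :: "('i \<Rightarrow> complex) set" and F :: "'k \<Rightarrow> 'i \<Rightarrow> complex"
  assumes "finite I" "\<And>x. x \<in> S \<Longrightarrow> \<exists>c. x = (\<lambda>i. \<Sum>k\<in>I. c k * F k i)"
    and "(\<lambda>_. 0) \<in> S" "comb_closed S" "sesq S a"
    and l: "\<And>x y c d. x \<in> S \<Longrightarrow> y \<in> S \<Longrightarrow> l (\<lambda>i. c * x i + d * y i) = cnj c * l x + cnj d * l y"
    and "\<And>x. x \<in> S \<Longrightarrow> (\<And>y. y \<in> S \<Longrightarrow> a x y = 0) \<Longrightarrow> x = (\<lambda>_. 0)"
  shows "\<exists>x\<in>S. \<forall>y\<in>S. a x y = l y"
proof (rule nondegenerate_form_represents[where F = F and I = I])
  show "a (\<lambda>i. c * x i + d * y i) z = c * a x z + d * a y z"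
    if "x \<in> S" "y \<in> S" "z \<in> S" for x y z c d using assms(5) that unfolding sesq_def by blast
  show "a z (\<lambda>i. c * x i + d * y i) = cnj c * a z x + cnj d * a z y"
    if "x \<in> S" "y \<in> S" "z \<in> S" for x y z c d using assms(5) that unfolding sesq_def by blast
  show "(\<lambda>i. c * x i + d * y i) \<in> S" if "x \<in> S" "y \<in> S" for x y c d
    using assms(4) that unfolding comb_closed_def by blast
qed (use assms in blast)+

section \<open>Integrals of traces and of polynomials\<close>

text \<open>Values off the face are left free, unlike in \<open>PF\<close>: the arguments of
  \<open>fip\<close> in the local equations are partly full polynomials and partly functions cut off
  to the face, and this set contains both kinds.\<close>

definition ptrace :: "nat \<Rightarrow> (real^'d::finite) set \<Rightarrow> (real^'d \<Rightarrow> complex) set" where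
  "ptrace p W = {a. \<exists>q. pdeg p q \<and> (\<forall>x\<in>convex hull W. a x = q x)}"

lemma PF_iff: "f \<in> PF p W \<longleftrightarrow> (\<exists>q. pdeg p q \<and> f = restr (convex hull W) q)"
  by (simp add: PF_def poly_fun_iff_pdeg)

lemma pdeg_in_ptrace: "pdeg p f \<Longrightarrow> f \<in> ptrace p W"
  by (auto simp: ptrace_def)

lemma PF_subset_ptrace: "PF p W \<subseteq> ptrace p W"
  by (force simp: ptrace_def PF_iff restr_def)

lemma restr_PF: "pdeg p f \<Longrightarrow> restr (convex hull W) f \<in> PF p W"
  by (auto simp: PF_iff)

lemma restr_eq: "x \<in> S \<Longrightarrow> restr S f x = f x"
  by (simp add: restr_def)

lemma PF_comb_closed: "comb_closed (PF p W)"
  unfolding comb_closed_def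
proof (intro ballI allI)
  fix f g c d assume "f \<in> PF p W" "g \<in> PF p W"
  then obtain q r where q: "pdeg p q" "f = restr (convex hull W) q" and r: "pdeg p r" "g = restr (convex hull W) r"
    by (auto simp: PF_iff)
  have "(\<lambda>x. c * f x + d * g x) = restr (convex hull W) (\<lambda>x. c * q x + d * r x)"
    by (auto simp: q r restr_def)
  then show "(\<lambda>x. c * f x + d * g x) \<in> PF p W"
    using pdeg_comb[OF q(1) r(1)] by (auto simp: PF_iff)
qed

lemma PF_comb: "f \<in> PF p W \<Longrightarrow> g \<in> PF p W \<Longrightarrow> (\<lambda>x. c * f x + d * g x) \<in> PF p W"
  using PF_comb_closed unfolding comb_closed_def by blast

lemma PF_zero: "(\<lambda>_. 0) \<in> PF p W"
  using restr_PF[OF pdeg.const[of p 0], of W] by (simp add: restr_def[abs_def])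

lemma PF_finite_span:
  assumes "f \<in> PF p (W :: (real^'d::finite) set)"
  shows "\<exists>c. f = (\<lambda>x. \<Sum>\<alpha>\<in>mono_exps p. c \<alpha> * restr (convex hull W) (\<lambda>x. \<Prod>i\<in>UNIV. complex_of_real ((x $ i) ^ \<alpha> i)) x)"
proof -
  obtain c where "f = restr (convex hull W) (\<lambda>x. \<Sum>\<alpha>\<in>mono_exps p. c \<alpha> * (\<Prod>i\<in>UNIV. complex_of_real ((x $ i) ^ \<alpha> i)))"
    using assms by (auto simp: PF_def poly_fun_def)
  then show ?thesis by (intro exI[of _ c]) (auto simp: restr_def)
qed

lemma fip_cong:
  assumes "finite W" "W \<noteq> {}"
    "\<And>x. x \<in> convex hull W \<Longrightarrow> a x = a' x" "\<And>x. x \<in> convex hull W \<Longrightarrow> b x = b' x"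
  shows "fip W a b = fip W a' b'"
  unfolding fip_def using assms by (intro face_int_cong) auto

lemma fip_commute: "fip W a b = cnj (fip W b a)"
  unfolding fip_def face_int_cnj[symmetric] by (simp add: mult.commute)

lemma sesq_fip:
  assumes W: "finite W" "W \<noteq> {}"
  shows "sesq (ptrace p W) (fip W)"
proof -
  have left: "fip W (\<lambda>i. c * x i + d * y i) z = c * fip W x z + d * fip W y z"
    if "x \<in> ptrace p W" "y \<in> ptrace p W" "z \<in> ptrace p W" for x y z c d
  proof -
    obtain x' y' z' where p: "pdeg p x'" "pdeg p y'" "pdeg p z'"
      and e: "\<forall>t\<in>convex hull W. x t = x' t" "\<forall>t\<in>convex hull W. y t = y' t" "\<forall>t\<in>convex hull W. z t = z' t"
      using \<open>x \<in> _\<close> \<open>y \<in> _\<close> \<open>z \<in> _\<close> unfolding ptrace_def by blast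
    have "fip W (\<lambda>i. c * x i + d * y i) z = face_int W (\<lambda>t. c * (x' t * cnj (z' t)) + d * (y' t * cnj (z' t)))"
      unfolding fip_def using e by (intro face_int_cong[OF W]) (auto simp: algebra_simps)
    also have "\<dots> = c * fip W x' z' + d * fip W y' z'"
      unfolding fip_def
      by (rule face_int_comb[OF W pdeg_mult[OF p(1) pdeg_cnj[OF p(3)]] pdeg_mult[OF p(2) pdeg_cnj[OF p(3)]]])
    also have "fip W x' z' = fip W x z" using e by (intro fip_cong[OF W]) auto
    also have "fip W y' z' = fip W y z" using e by (intro fip_cong[OF W]) auto
    finally show ?thesis .
  qed
  have "fip W z (\<lambda>i. c * x i + d * y i) = cnj c * fip W z x + cnj d * fip W z y"
    if "x \<in> ptrace p W" "y \<in> ptrace p W" "z \<in> ptrace p W" for x y z c d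
  proof -
    have "fip W z (\<lambda>i. c * x i + d * y i) = cnj (c * fip W x z + d * fip W y z)"
      unfolding left[OF that, symmetric] by (rule fip_commute)
    also have "\<dots> = cnj c * fip W z x + cnj d * fip W z y"
      by (simp flip: fip_commute)
    finally show ?thesis .
  qed
  with left show ?thesis unfolding sesq_def by blast
qed

lemma vol_ip_commute: "vol_ip K a b = cnj (vol_ip K b a)"
  unfolding vol_ip_def Henstock_Kurzweil_Integration.integral_cnj by (simp add: mult.commute)

lemma sesq_vol_ip:
  assumes "finite V"
  shows "sesq {f. pdeg p f} (vol_ip (convex hull V))"
proof -
  have left: "vol_ip (convex hull V) (\<lambda>i. c * x i + d * y i) z = c * vol_ip (convex hull V) x z + d * vol_ip (convex hull V) y z"
    if "pdeg p x" "pdeg p y" "pdeg p z" for x y z c d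
  proof -
    have i: "(\<lambda>t. x t * cnj (z t)) integrable_on convex hull V" "(\<lambda>t. y t * cnj (z t)) integrable_on convex hull V"
      using that by (auto intro!: integrable_on_hull_pdeg[OF assms] pdeg_mult pdeg_cnj)
    have "vol_ip (convex hull V) (\<lambda>i. c * x i + d * y i) z
        = integral (convex hull V) (\<lambda>t. c * (x t * cnj (z t)) + d * (y t * cnj (z t)))"
      unfolding vol_ip_def by (simp add: algebra_simps)
    also have "\<dots> = c * vol_ip (convex hull V) x z + d * vol_ip (convex hull V) y z"
      unfolding vol_ip_def using i
      by (subst integral_add) (auto intro: integrable_on_mult_right)
    finally show ?thesis .
  qed
  have "vol_ip (convex hull V) z (\<lambda>i. c * x i + d * y i) = cnj c * vol_ip (convex hull V) z x + cnj d * vol_ip (convex hull V) z y"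
    if "pdeg p x" "pdeg p y" "pdeg p z" for x y z c d
  proof -
    have "vol_ip (convex hull V) z (\<lambda>i. c * x i + d * y i) = cnj (c * vol_ip (convex hull V) x z + d * vol_ip (convex hull V) y z)"
      unfolding left[OF that, symmetric] by (rule vol_ip_commute)
    also have "\<dots> = cnj c * vol_ip (convex hull V) z x + cnj d * vol_ip (convex hull V) z y"
      by (simp flip: vol_ip_commute)
    finally show ?thesis .
  qed
  with left show ?thesis unfolding sesq_def by blast
qed

lemma vvol_ip_eq_sum:
  assumes "finite V" "\<And>i. pdeg p (\<lambda>x. u x $ i)" "\<And>i. pdeg q (\<lambda>x. v x $ i)"
  shows "vvol_ip (convex hull V) u v = (\<Sum>i\<in>UNIV. vol_ip (convex hull V) (\<lambda>x. u x $ i) (\<lambda>x. v x $ i))"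
  unfolding vvol_ip_def vol_ip_def
  by (intro integral_sum finite integrable_on_hull_pdeg[OF assms(1), of "p + q"] pdeg_mult pdeg_cnj assms(2,3))

lemma pdeg_pdiff': "pdeg p f \<Longrightarrow> pdeg p (pdiff i f)"
  by (rule pdeg_mono[OF pdeg_pdiff]) auto

lemma pdeg_cdiv: "(\<And>i. pdeg p (\<lambda>x. u x $ i)) \<Longrightarrow> pdeg p (cdiv u)"
  unfolding cdiv_def[abs_def] by (intro pdeg_sum pdeg_pdiff') auto

lemma pdeg_ndot: "(\<And>i. pdeg p (\<lambda>x. u x $ i)) \<Longrightarrow> pdeg p (ndot n u)"
  unfolding ndot_def by (intro pdeg_sum pdeg_scale) auto

lemma face_int_sum:
  assumes W: "finite W" "W \<noteq> {}" and I: "finite I" and f: "\<And>i. i \<in> I \<Longrightarrow> pdeg p (f i)"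
  shows "face_int W (\<lambda>x. \<Sum>i\<in>I. c i * f i x) = (\<Sum>i\<in>I. c i * face_int W (f i))"
  using I f
proof (induction I rule: finite_induct)
  case empty
  then show ?case by (simp add: face_int_def)
next
  case (insert i I)
  have "pdeg p (\<lambda>x. \<Sum>i\<in>I. c i * f i x)" using insert by (intro pdeg_sum pdeg_scale) auto
  from face_int_comb[OF W insert.prems[of i] this, of "c i" 1] insert show ?case by simp
qed

text \<open>The divergence theorem for \<open>u x $ i * cnj (q x)\<close> in direction
  \<open>i\<close>, summed over \<open>i\<close>; conjugation commutes with real directional
  derivatives.\<close>

lemma integration_by_parts:
  fixes V :: "(real^'d::finite) set"
  assumes V: "simplex_verts V" and dim: "CARD('d) = 2 \<or> CARD('d) = 3"
    and u: "\<And>i. pdeg p (\<lambda>x. u x $ i)" and q: "pdeg p q"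
  shows "vvol_ip (convex hull V) u (cgrad q) + vol_ip (convex hull V) (cdiv u) q
    = (\<Sum>W\<in>faces V. fip W (ndot (onormal V W) u) q)"
proof -
  have fin: "finite V" by (rule simplex_finite[OF V])
  define f where "f i x = u x $ i * cnj (q x)" for i x
  have f: "pdeg (p + p) (f i)" for i
    unfolding f_def by (intro pdeg_mult u pdeg_cnj q)
  have pd: "pdiff i (f i) x = u x $ i * cnj (pdiff i q x) + pdiff i (\<lambda>y. u y $ i) x * cnj (q x)" for i x
    unfolding f_def by (simp add: pdiff_mult[OF u pdeg_cnj[OF q]] pdiff_cnj[OF q])
  have i1: "(\<lambda>x. \<Sum>i\<in>UNIV. u x $ i * cnj (cgrad q x $ i)) integrable_on convex hull V"
    unfolding cgrad_def
    by (intro integrable_on_hull_pdeg[OF fin, of "p + p"] pdeg_sum) (simp add: pdeg_mult pdeg_cnj u pdeg_pdiff' q)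
  have i2: "(\<lambda>x. cdiv u x * cnj (q x)) integrable_on convex hull V"
    by (intro integrable_on_hull_pdeg[OF fin, of "p + p"] pdeg_mult pdeg_cnj pdeg_cdiv u q)
  have "vvol_ip (convex hull V) u (cgrad q) + vol_ip (convex hull V) (cdiv u) q
      = integral (convex hull V) (\<lambda>x. (\<Sum>i\<in>UNIV. u x $ i * cnj (cgrad q x $ i)) + cdiv u x * cnj (q x))"
    unfolding vvol_ip_def vol_ip_def by (rule integral_add[OF i1 i2, symmetric])
  also have "\<dots> = integral (convex hull V) (\<lambda>x. \<Sum>i\<in>UNIV. pdiff i (f i) x)"
    by (simp add: pd cgrad_def cdiv_def sum.distrib sum_distrib_right)
  also have "\<dots> = (\<Sum>i\<in>UNIV. integral (convex hull V) (pdiff i (f i)))"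
    by (intro integral_sum) (auto intro: integrable_on_hull_pdeg[OF fin pdeg_pdiff[OF f]])
  also have "\<dots> = (\<Sum>i\<in>UNIV. \<Sum>W\<in>faces V. complex_of_real (onormal V W $ i) * face_int W (f i))"
    by (simp only: divergence_simplex[OF V dim f])
  also have "\<dots> = (\<Sum>W\<in>faces V. \<Sum>i\<in>UNIV. complex_of_real (onormal V W $ i) * face_int W (f i))"
    by (rule sum.swap)
  also have "\<dots> = (\<Sum>W\<in>faces V. fip W (ndot (onormal V W) u) q)"
  proof (intro sum.cong refl)
    fix W assume "W \<in> faces V"
    then have W: "finite W" "W \<noteq> {}" using face_finite[OF V] face_nonempty[OF V] by auto
    show "(\<Sum>i\<in>UNIV. complex_of_real (onormal V W $ i) * face_int W (f i)) = fip W (ndot (onormal V W) u) q"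
      unfolding face_int_sum[OF W finite f, symmetric] fip_def ndot_def f_def
      by (simp add: sum_distrib_right mult.assoc)
  qed
  finally show ?thesis .
qed

section \<open>Vanishing of polynomials\<close>

lemma pdeg_line_poly:
  assumes "pdeg p f"
  shows "\<exists>r. \<forall>t. f (x + t *\<^sub>R h) = poly r (complex_of_real t)"
  using assms
proof (induction rule: pdeg.induct)
  case (const p c)
  then show ?case by (intro exI[of _ "[:c:]"]) simp
next
  case (add p f g)
  then obtain r s where "\<forall>t. f (x + t *\<^sub>R h) = poly r (complex_of_real t)"
    "\<forall>t. g (x + t *\<^sub>R h) = poly s (complex_of_real t)" by blast
  then show ?case by (intro exI[of _ "r + s"]) simp
next
  case (coord p f i)
  then obtain r where "\<forall>t. f (x + t *\<^sub>R h) = poly r (complex_of_real t)" by blast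
  then show ?case
    by (intro exI[of _ "[:complex_of_real (x $ i), complex_of_real (h $ i):] * r"]) (simp add: algebra_simps)
qed

text \<open>Along the line from \<open>x0\<close> to any \<open>y\<close> the function is a
  polynomial in one variable. Openness gives it infinitely many roots, so it vanishes at
  \<open>y\<close> too.\<close>

lemma pdeg_zero_on_open:
  assumes f: "pdeg p f" and S: "open S" "x0 \<in> S" and zero: "\<And>x. x \<in> S \<Longrightarrow> f x = 0"
  shows "f = (\<lambda>_. 0)"
proof
  fix y
  define h where "h = y - x0"
  obtain r where r: "\<And>t. f (x0 + t *\<^sub>R h) = poly r (complex_of_real t)"
    using pdeg_line_poly[OF f, of x0 h] by blast
  have "open ((\<lambda>t. x0 + t *\<^sub>R h) -` S)"
    by (intro open_vimage S continuous_intros)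
  moreover have "0 \<in> (\<lambda>t. x0 + t *\<^sub>R h) -` S" using S by simp
  ultimately have "infinite ((\<lambda>t. x0 + t *\<^sub>R h) -` S)"
    using finite_imp_not_open by blast
  then have "infinite (complex_of_real ` ((\<lambda>t. x0 + t *\<^sub>R h) -` S))"
    by (subst finite_image_iff) (auto simp: inj_on_def)
  moreover have "complex_of_real ` ((\<lambda>t. x0 + t *\<^sub>R h) -` S) \<subseteq> {z. poly r z = 0}"
    using zero r by force
  ultimately have "r = 0" using poly_roots_finite infinite_super by blast
  then show "f y = 0" using r[of 1] by (simp add: h_def)
qed

text \<open>All barycentric coordinates of the centroid are \<open>1 / card V\<close>, hence
  positive, and positivity persists nearby.\<close>

lemma simplex_contains_box:
  fixes V :: "(real^'d::finite) set"
  assumes V: "simplex_verts V"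
  obtains a b where "cbox a b \<subseteq> convex hull V" "box a b \<noteq> {}"
proof -
  let ?S = "{x. \<forall>v\<in>V. 0 < blam V v x}"
  define c where "c = (\<Sum>v\<in>V. (1 / real (card V)) *\<^sub>R v)"
  have fin: "finite V" by (rule simplex_finite[OF V])
  have card: "card V > 0" using simplex_card[OF V] by simp
  have "?S = (\<Inter>v\<in>V. {x. 0 < blam V v x})" by auto
  also have "open \<dots>"
    using fin unfolding blam_def by (intro open_INT open_Collect_less continuous_intros ballI) auto
  finally have "open ?S" .
  moreover have "c \<in> ?S"
  proof clarify
    fix w assume w: "w \<in> V"
    have "blam V w c = (\<Sum>v\<in>V. (1 / real (card V)) * (1 + bgrad V w \<bullet> (v - w)))"
      using card by (simp add: blam_def c_def inner_diff_right inner_sum_right sum.distrib sum_subtractf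
          distrib_left right_diff_distrib)
    also have "\<dots> = (\<Sum>v\<in>V. (1 / real (card V)) * of_bool (v = w))"
      using w by (intro sum.cong refl) (simp flip: blam_def add: blam_vertex[OF V])
    also have "\<dots> = 1 / real (card V)"
      using w fin by (simp add: of_bool_def if_distrib cong: if_cong)
    finally show "0 < blam V w c" using card by simp
  qed
  ultimately obtain a b where ab: "cbox a b \<subseteq> ?S" "c \<in> box a b"
    by (rule open_contains_cbox)
  have "?S \<subseteq> convex hull V"
  proof
    fix x assume "x \<in> ?S"
    then have "\<forall>v\<in>V. 0 \<le> blam V v x" by (auto intro: less_imp_le)
    then show "x \<in> convex hull V" unfolding mem_simplex_iff[OF V] .
  qed
  then show ?thesis using that[of a b] ab by auto
qed

text \<open>A continuous nonnegative function with integral zero vanishes on a box inside the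
  simplex, and polynomials vanishing there vanish everywhere. A family is treated at once, to cover
  the components of a vector residual.\<close>

lemma pdeg_zero_if_norm_integral_zero:
  fixes V :: "(real^'d::finite) set"
  assumes V: "simplex_verts V" and I: "finite I" and f: "\<And>i. i \<in> I \<Longrightarrow> pdeg p (f i)"
    and zero: "(\<Sum>i\<in>I. vol_ip (convex hull V) (f i) (f i)) = 0" and i: "i \<in> I"
  shows "f i = (\<lambda>_. 0)"
proof -
  obtain a b where ab: "cbox a b \<subseteq> convex hull V" "box a b \<noteq> {}"
    using simplex_contains_box[OF V] .
  define F where "F x = (\<Sum>i\<in>I. (norm (f i x))\<^sup>2)" for x
  have cont: "continuous_on S F" for S
    unfolding F_def using f by (intro continuous_intros continuous_on_pdeg) auto
  have nn: "0 \<le> F x" for x unfolding F_def by (intro sum_nonneg) auto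
  have comp: "compact (convex hull V)"
    using simplex_finite[OF V] by (rule finite_imp_compact_convex_hull)
  have int: "F integrable_on convex hull V"
  proof -
    have "set_integrable lborel (convex hull V) F"
      unfolding set_integrable_def by (rule borel_integrable_compact[OF comp cont])
    then show ?thesis by (rule set_borel_integral_eq_integral)
  qed
  have "complex_of_real (integral (convex hull V) F) = integral (convex hull V) (\<lambda>x. complex_of_real (F x))"
    using integral_linear[OF int bounded_linear_of_real[where 'a = complex]] by (simp add: o_def)
  also have "\<dots> = integral (convex hull V) (\<lambda>x. \<Sum>i\<in>I. f i x * cnj (f i x))"
    by (simp only: F_def of_real_sum complex_norm_square)
  also have "\<dots> = (\<Sum>i\<in>I. vol_ip (convex hull V) (f i) (f i))"
    unfolding vol_ip_def
    by (intro integral_sum[OF I] integrable_on_hull_pdeg[OF simplex_finite[OF V], of "p + p"] pdeg_mult pdeg_cnj f)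
  finally have int0: "integral (convex hull V) F = 0" using zero by simp
  have "integral (cbox a b) F \<le> integral (convex hull V) F"
    using nn by (intro integral_subset_le ab int integrable_continuous cont) auto
  moreover have "0 \<le> integral (cbox a b) F"
    by (intro integral_nonneg integrable_continuous cont nn)
  ultimately have "integral (cbox a b) F = 0" using int0 by simp
  then have F0: "F x = 0" if "x \<in> cbox a b" for x
    using integral_cbox_eq_0_iff[OF cont ab(2)] nn that by blast
  have "f i x = 0" if "x \<in> box a b" for x
  proof -
    have "F x = 0" using F0 that box_subset_cbox by blast
    then show ?thesis using I i by (simp add: F_def sum_nonneg_eq_0_iff)
  qed
  moreover obtain x0 where "x0 \<in> box a b" using ab(2) by blast
  ultimately show ?thesis using pdeg_zero_on_open[OF f[OF i] open_box] by blast
qed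

section \<open>Face operators\<close>

lemma fip_zero: "fip W (\<lambda>_. 0) b = 0" "fip W a (\<lambda>_. 0) = 0"
  by (simp_all add: fip_def face_int_def)

context
  fixes p :: nat and W :: "(real^'d::finite) set"
    and A :: "(real^'d \<Rightarrow> complex) \<Rightarrow> (real^'d \<Rightarrow> complex)"
  assumes W: "finite W" "W \<noteq> {}" and A: "admissible_face_op p W A"
begin

lemma face_op_PF: "\<phi> \<in> PF p W \<Longrightarrow> A \<phi> \<in> PF p W"
  using A unfolding admissible_face_op_def by blast

lemma face_op_lin: "lin_map (PF p W) (PF p W) A"
  using A unfolding admissible_face_op_def lin_map_def by blast

lemma face_op_selfadjoint: "\<phi> \<in> PF p W \<Longrightarrow> \<psi> \<in> PF p W \<Longrightarrow> fip W (A \<phi>) \<psi> = fip W \<phi> (A \<psi>)"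
  using A unfolding admissible_face_op_def by blast

lemma face_op_pos: "\<phi> \<in> PF p W \<Longrightarrow> \<phi> \<noteq> (\<lambda>_. 0) \<Longrightarrow> 0 < Re (fip W (A \<phi>) \<phi>)"
  using A unfolding admissible_face_op_def by blast

lemma face_op_nonneg: "\<phi> \<in> PF p W \<Longrightarrow> 0 \<le> Re (fip W (A \<phi>) \<phi>)"
  using face_op_pos[of \<phi>] by (cases "\<phi> = (\<lambda>_. 0)") (auto simp: fip_zero less_imp_le)

lemma face_op_zero: "A (\<lambda>_. 0) = (\<lambda>_. 0)"
  using lin_mapD[OF face_op_lin PF_zero PF_zero, of 0 0] by simp

lemma sesq_face_op: "sesq (PF p W) (\<lambda>x y. fip W (A x) y)"
proof (rule sesq_comp[OF sesq_fip[OF W, of p]])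
  show "lin_map (PF p W) (ptrace p W) A"
    using face_op_lin PF_subset_ptrace unfolding lin_map_def by blast
  show "lin_map (PF p W) (ptrace p W) (\<lambda>y. y)"
    using PF_subset_ptrace unfolding lin_map_def by blast
qed

text \<open>Nondegeneracy of the face pairing is read off from the operator instead of the surface
  integral: the test function \<open>A \<phi>\<close> turns the pairing into
  \<open>fip W (A \<phi>) \<phi>\<close>, which is positive for nonzero
  \<open>\<phi>\<close>.\<close>

lemma fip_definite:
  assumes "\<phi> \<in> PF p W" "\<And>\<psi>. \<psi> \<in> PF p W \<Longrightarrow> fip W \<phi> \<psi> = 0"
  shows "\<phi> = (\<lambda>_. 0)"
  using face_op_pos[OF assms(1)] assms(2)[OF face_op_PF[OF assms(1)]] face_op_selfadjoint[OF assms(1,1)]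
  by fastforce

lemma face_op_inj:
  assumes "\<phi> \<in> PF p W" "\<psi> \<in> PF p W" "A \<phi> = A \<psi>"
  shows "\<phi> = \<psi>"
proof -
  let ?h = "\<lambda>x. 1 * \<phi> x + (-1) * \<psi> x"
  have "A ?h = (\<lambda>x. 1 * A \<phi> x + (-1) * A \<psi> x)"
    using face_op_lin assms(1,2) unfolding lin_map_def by blast
  then have "A ?h = (\<lambda>_. 0)" using assms(3) by simp
  then have "?h = (\<lambda>_. 0)"
    using face_op_pos[OF PF_comb[OF assms(1,2)], of 1 "-1"] by (auto simp: fip_zero)
  then show ?thesis by (simp add: fun_eq_iff)
qed

text \<open>Positivity makes the form \<open>fip W (A x) y\<close> nondegenerate, so it represents
  the pairing with \<open>\<psi>\<close>; \<open>fip_definite\<close> then upgrades equality of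
  pairings to equality of functions.\<close>

lemma face_op_surj:
  assumes \<psi>: "\<psi> \<in> PF p W"
  shows "\<exists>\<phi>\<in>PF p W. A \<phi> = \<psi>"
proof -
  have "\<exists>x\<in>PF p W. \<forall>y\<in>PF p W. fip W (A x) y = fip W \<psi> y"
  proof (rule sesq_nondegenerate_represents[OF finite_mono_exps PF_finite_span PF_zero PF_comb_closed sesq_face_op])
    show "fip W \<psi> (\<lambda>i. c * x i + d * y i) = cnj c * fip W \<psi> x + cnj d * fip W \<psi> y"
      if "x \<in> PF p W" "y \<in> PF p W" for x y c d
      using sesqD(2)[OF sesq_fip[OF W, of p]] that \<psi> PF_subset_ptrace by blast
    show "x = (\<lambda>_. 0)" if x: "x \<in> PF p W" and "\<And>y. y \<in> PF p W \<Longrightarrow> fip W (A x) y = 0" for x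
      using face_op_pos[OF x] that(2)[OF x] by fastforce
  qed
  then obtain x where x: "x \<in> PF p W" "\<And>y. y \<in> PF p W \<Longrightarrow> fip W (A x) y = fip W \<psi> y" by blast
  have "(\<lambda>t. 1 * A x t + (-1) * \<psi> t) = (\<lambda>_. 0)"
  proof (rule fip_definite)
    show "(\<lambda>t. 1 * A x t + (-1) * \<psi> t) \<in> PF p W"
      by (intro PF_comb face_op_PF x \<psi>)
    fix y assume y: "y \<in> PF p W"
    have "fip W (\<lambda>t. 1 * A x t + (-1) * \<psi> t) y = 1 * fip W (A x) y + (-1) * fip W \<psi> y"
      by (rule sesqD(1)[OF sesq_fip[OF W, of p]]) (use PF_subset_ptrace y \<psi> face_op_PF[OF x(1)] in blast)+
    then show "fip W (\<lambda>t. 1 * A x t + (-1) * \<psi> t) y = 0" using x(2)[OF y] by simp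
  qed
  then have "A x = \<psi>" by (simp add: fun_eq_iff)
  then show ?thesis using x(1) by blast
qed

lemma face_op_inv_eq: "\<phi> \<in> PF p W \<Longrightarrow> A \<phi> = \<psi> \<Longrightarrow> face_op_inv p W A \<psi> = \<phi>"
  unfolding face_op_inv_def using face_op_inj by blast

lemma face_op_inv_props:
  assumes "\<psi> \<in> PF p W"
  shows "face_op_inv p W A \<psi> \<in> PF p W" "A (face_op_inv p W A \<psi>) = \<psi>"
  using face_op_surj[OF assms] face_op_inv_eq by auto

lemma face_op_inv_lin: "lin_map (PF p W) (PF p W) (face_op_inv p W A)"
  unfolding lin_map_def
proof (intro conjI ballI allI)
  fix x y c d assume x: "x \<in> PF p W" and y: "y \<in> PF p W"
  let ?I = "face_op_inv p W A"
  show "?I (\<lambda>i. c * x i + d * y i) = (\<lambda>j. c * ?I x j + d * ?I y j)"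
  proof (rule face_op_inv_eq)
    show "(\<lambda>j. c * ?I x j + d * ?I y j) \<in> PF p W"
      by (intro PF_comb face_op_inv_props x y)
    have "A (\<lambda>j. c * ?I x j + d * ?I y j) = (\<lambda>j. c * A (?I x) j + d * A (?I y) j)"
      using face_op_lin face_op_inv_props(1) x y unfolding lin_map_def by blast
    then show "A (\<lambda>j. c * ?I x j + d * ?I y j) = (\<lambda>i. c * x i + d * y i)"
      by (simp only: face_op_inv_props(2)[OF x] face_op_inv_props(2)[OF y])
  qed
qed (rule face_op_inv_props)

text \<open>Expand both squares in the A-norm. The first contains the cross term of \<open>a\<close>
  and \<open>b\<close> with a plus sign, the square of \<open>a - b\<close> inside the second with a
  minus sign, and they cancel. Self-adjointness merges the two mixed pairings of each square into
  one real part.\<close>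

lemma face_norm_identity:
  assumes a: "a \<in> PF p W" and b: "b \<in> PF p W" and g: "g \<in> PF p W"
  shows "Re (fip W (A (\<lambda>x. a x + b x)) (\<lambda>x. a x + b x))
      + Re (fip W (A (\<lambda>x. g x - (a x - b x))) (\<lambda>x. g x - (a x - b x)))
    = Re (fip W (A g) g) + 2 * (Re (fip W (A a) a) + Re (fip W (A b) b))
      - 2 * (Re (fip W (A g) a) - Re (fip W (A g) b))"
proof -
  have sym: "Re (fip W (A x) y) = Re (fip W (A y) x)" if "x \<in> PF p W" "y \<in> PF p W" for x y
    using face_op_selfadjoint[OF that] fip_commute[of W x "A y"] by simp
  have expand: "Re (fip W (A (\<lambda>i. x i + of_real r * y i)) (\<lambda>i. x i + of_real r * y i))
      = Re (fip W (A x) x) + 2 * r * Re (fip W (A x) y) + r\<^sup>2 * Re (fip W (A y) y)"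
    if xy: "x \<in> PF p W" "y \<in> PF p W" for x y r
  proof -
    have c: "(\<lambda>i. 1 * x i + complex_of_real r * y i) \<in> PF p W" by (rule PF_comb[OF xy])
    show ?thesis
      using sesqD(1)[OF sesq_face_op xy c, of 1 "complex_of_real r"]
        sesqD(2)[OF sesq_face_op xy xy(1), of 1 "complex_of_real r"]
        sesqD(2)[OF sesq_face_op xy xy(2), of 1 "complex_of_real r"] sym[OF xy]
      by (simp add: power2_eq_square algebra_simps)
  qed
  have h: "(\<lambda>x. 1 * a x + (-1) * b x) \<in> PF p W" by (rule PF_comb[OF a b])
  have gh: "Re (fip W (A g) (\<lambda>x. 1 * a x + (-1) * b x)) = Re (fip W (A g) a) - Re (fip W (A g) b)"
    using sesqD(2)[OF sesq_face_op a b g, of 1 "-1"] by simp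
  have diff: "(\<lambda>x. g x - (a x - b x)) = (\<lambda>x. g x + complex_of_real (-1) * (1 * a x + (-1) * b x))"
    by (simp add: fun_eq_iff)
  show ?thesis unfolding diff
    using expand[OF a b, of 1] expand[OF a b, of "-1"] expand[OF g h, of "-1"] gh
    by simp
qed

end

section \<open>Pairs of a scalar and a vector polynomial\<close>

text \<open>A pair \<open>(P, U)\<close> is stored as one function on \<open>'d option \<times> (real^'d)\<close>, with \<open>P\<close> at
  \<open>None\<close> and the components of \<open>U\<close> at \<open>Some i\<close>.\<close>

definition pair_polys :: "nat \<Rightarrow> ('d option \<times> (real^'d::finite) \<Rightarrow> complex) set" where
  "pair_polys p = {z. \<forall>j. pdeg p (\<lambda>x. z (j, x))}"

definition scal :: "('d option \<times> (real^'d::finite) \<Rightarrow> complex) \<Rightarrow> real^'d \<Rightarrow> complex" where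
  "scal z = (\<lambda>x. z (None, x))"

definition vect :: "('d option \<times> (real^'d::finite) \<Rightarrow> complex) \<Rightarrow> real^'d \<Rightarrow> complex^'d" where
  "vect z = (\<lambda>x. \<chi> i. z (Some i, x))"

definition pair_of :: "(real^'d::finite \<Rightarrow> complex) \<Rightarrow> (real^'d \<Rightarrow> complex^'d) \<Rightarrow> 'd option \<times> (real^'d) \<Rightarrow> complex" where
  "pair_of q v = (\<lambda>(j, x). case j of None \<Rightarrow> q x | Some i \<Rightarrow> v x $ i)"

lemma scal_pair_of [simp]: "scal (pair_of q v) = q"
  by (simp add: scal_def pair_of_def)

lemma vect_pair_of [simp]: "vect (pair_of q v) = v"
  by (simp add: vect_def pair_of_def fun_eq_iff vec_eq_iff)

lemma pair_of_scal_vect: "pair_of (scal z) (vect z) = z"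
  by (auto simp: scal_def vect_def pair_of_def fun_eq_iff split: option.split)

lemma pair_of_in: "pdeg p q \<Longrightarrow> (\<And>i. pdeg p (\<lambda>x. v x $ i)) \<Longrightarrow> pair_of q v \<in> pair_polys p"
  unfolding pair_polys_def
proof (intro CollectI allI)
  fix j assume "pdeg p q" "\<And>i. pdeg p (\<lambda>x. v x $ i)"
  then show "pdeg p (\<lambda>x. pair_of q v (j, x))" by (cases j) (simp_all add: pair_of_def)
qed

lemma pair_polys_pdeg:
  assumes "z \<in> pair_polys p"
  shows "pdeg p (scal z)" "pdeg p (\<lambda>x. vect z x $ i)"
  using assms by (auto simp: pair_polys_def scal_def vect_def)

lemma pair_polys_comb_closed: "comb_closed (pair_polys p)"
  by (auto simp: comb_closed_def pair_polys_def intro: pdeg_comb)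

lemma pair_polys_finite_span:
  fixes z :: "'d option \<times> (real^'d::finite) \<Rightarrow> complex"
  assumes "z \<in> pair_polys p"
  shows "\<exists>c. z = (\<lambda>k. \<Sum>(j, \<alpha>)\<in>UNIV \<times> mono_exps p. c (j, \<alpha>) *
      (if fst k = j then \<Prod>i\<in>UNIV. complex_of_real ((snd k $ i) ^ \<alpha> i) else 0))"
proof -
  have "\<forall>j. poly_fun p (\<lambda>x. z (j, x))"
    using assms by (simp add: pair_polys_def poly_fun_iff_pdeg)
  from choice[OF this[unfolded poly_fun_def]]
  obtain c where c: "\<forall>j. (\<lambda>x. z (j, x))
      = (\<lambda>x. \<Sum>\<alpha>\<in>mono_exps p. c j \<alpha> * (\<Prod>i\<in>UNIV. complex_of_real ((x $ i) ^ \<alpha> i)))"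
    by (rule exE)
  have "z k = (\<Sum>(j, \<alpha>)\<in>UNIV \<times> mono_exps p. (case (j, \<alpha>) of (j, \<alpha>) \<Rightarrow> c j \<alpha>) *
      (if fst k = j then \<Prod>i\<in>UNIV. complex_of_real ((snd k $ i) ^ \<alpha> i) else 0))" for k
  proof -
    have "(\<Sum>(j, \<alpha>)\<in>UNIV \<times> mono_exps p. (case (j, \<alpha>) of (j, \<alpha>) \<Rightarrow> c j \<alpha>) *
        (if fst k = j then \<Prod>i\<in>UNIV. complex_of_real ((snd k $ i) ^ \<alpha> i) else 0))
      = (\<Sum>j\<in>UNIV. if fst k = j then \<Sum>\<alpha>\<in>mono_exps p. c j \<alpha> * (\<Prod>i\<in>UNIV. complex_of_real ((snd k $ i) ^ \<alpha> i)) else 0)"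
      unfolding sum.cartesian_product[symmetric] prod.case by (intro sum.cong refl) auto
    also have "\<dots> = z k" using fun_cong[OF spec[OF c, of "fst k"], of "snd k"] by simp
    finally show ?thesis by simp
  qed
  then have "z = (\<lambda>k. \<Sum>(j, \<alpha>)\<in>UNIV \<times> mono_exps p. (case (j, \<alpha>) of (j, \<alpha>) \<Rightarrow> c j \<alpha>) *
      (if fst k = j then \<Prod>i\<in>UNIV. complex_of_real ((snd k $ i) ^ \<alpha> i) else 0))" by (rule ext)
  then show ?thesis by (rule exI[of _ "\<lambda>(j, \<alpha>). c j \<alpha>"])
qed

lemma lin_map_mono: "lin_map S X L \<Longrightarrow> X \<subseteq> Y \<Longrightarrow> lin_map S Y L"
  unfolding lin_map_def by blast

lemma lin_scal: "lin_map (pair_polys p) {f. pdeg p f} scal"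
  by (auto simp: lin_map_def pair_polys_pdeg) (simp add: scal_def)

lemma lin_component: "lin_map (pair_polys p) {f. pdeg p f} (\<lambda>z x. vect z x $ i)"
  by (auto simp: lin_map_def pair_polys_pdeg) (simp add: vect_def)

lemma lin_pdiff: "lin_map {f. pdeg p f} {f. pdeg p f} (pdiff i)"
  by (auto simp: lin_map_def pdeg_pdiff' fun_eq_iff pdiff_comb)

lemma lin_sum:
  assumes "\<And>i. i \<in> I \<Longrightarrow> lin_map S {f. pdeg p f} (L i)"
  shows "lin_map S {f. pdeg p f} (\<lambda>z x. \<Sum>i\<in>I. k i * L i z x)"
  unfolding lin_map_def
proof (intro conjI ballI allI)
  show "(\<lambda>x. \<Sum>i\<in>I. k i * L i z x) \<in> {f. pdeg p f}" if "z \<in> S" for z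
    using assms that unfolding lin_map_def by (auto intro!: pdeg_sum pdeg_scale)
  fix x y c d assume "x \<in> S" "y \<in> S"
  then have "L i (\<lambda>j. c * x j + d * y j) t = c * L i x t + d * L i y t" if "i \<in> I" for i t
    using fun_cong[OF lin_mapD[OF assms[OF that]]] by blast
  then show "(\<lambda>t. \<Sum>i\<in>I. k i * L i (\<lambda>j. c * x j + d * y j) t) = (\<lambda>t. c * (\<Sum>i\<in>I. k i * L i x t) + d * (\<Sum>i\<in>I. k i * L i y t))"
    by (auto simp: fun_eq_iff sum_distrib_left algebra_simps sum.distrib intro!: sum.cong)
qed

lemma lin_ndot: "lin_map (pair_polys p) {f. pdeg p f} (\<lambda>z. ndot n (vect z))"
  unfolding ndot_def by (rule lin_sum[OF lin_component])

lemma lin_cdiv: "lin_map (pair_polys p) {f. pdeg p f} (\<lambda>z. cdiv (vect z))"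
proof -
  have "lin_map (pair_polys p) {f. pdeg p f} (\<lambda>z x. \<Sum>i\<in>UNIV. 1 * pdiff i (\<lambda>x. vect z x $ i) x)"
    by (rule lin_sum[OF lin_map_comp[OF lin_pdiff lin_component]])
  then show ?thesis by (simp add: cdiv_def[abs_def])
qed

lemma lin_restr: "lin_map {f. pdeg p f} (PF p W) (restr (convex hull W))"
  by (auto simp: lin_map_def restr_PF) (auto simp: restr_def)

section \<open>The local problem\<close>

lemma pdiff_zero: "pdiff i (\<lambda>_. 0) = (\<lambda>_. 0)"
  by (simp add: pdiff_def fun_eq_iff)

context
  fixes V :: "(real^'d::finite) set" and p :: nat and \<kappa> \<eta> :: real
    and A :: "(real^'d) set \<Rightarrow> (real^'d \<Rightarrow> complex) \<Rightarrow> (real^'d \<Rightarrow> complex)"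
  assumes dim: "CARD('d) = 2 \<or> CARD('d) = 3" and V: "simplex_verts V"
    and kappa: "\<kappa> > 0" and eta: "\<eta> > 0"
    and A: "\<And>W. W \<in> faces V \<Longrightarrow> admissible_face_op p W (A W)"
begin

abbreviation K where "K \<equiv> convex hull V"
abbreviation nrm where "nrm \<equiv> onormal V"
abbreviation inv_tr where "inv_tr W P \<equiv> face_op_inv p W (A W) (restr (convex hull W) P)"
abbreviation ntr where "ntr W U \<equiv> restr (convex hull W) (ndot (nrm W) U)"

lemma face: "W \<in> faces V \<Longrightarrow> finite W" "W \<in> faces V \<Longrightarrow> W \<noteq> {}"
  using face_finite[OF V] face_nonempty[OF V] by auto

lemma inv_tr_props:
  assumes "W \<in> faces V" "pdeg p P"
  shows "inv_tr W P \<in> PF p W" "A W (inv_tr W P) = restr (convex hull W) P"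
  using face_op_inv_props[OF face[OF assms(1)] A[OF assms(1)] restr_PF[OF assms(2)]] by auto

lemma ntr_PF: "(\<And>i. pdeg p (\<lambda>x. U x $ i)) \<Longrightarrow> ntr W U \<in> PF p W"
  by (intro restr_PF pdeg_ndot)

text \<open>Self-adjointness moves \<open>A W\<close> across, so that pairing with the trace of
  \<open>P\<close> becomes pairing with \<open>inv_tr W P\<close> in the A-inner product, in which
  the energy is measured.\<close>

lemma fip_inv_tr:
  assumes "W \<in> faces V" "pdeg p P" "\<phi> \<in> PF p W"
  shows "fip W \<phi> P = fip W (A W \<phi>) (inv_tr W P)"
proof -
  have "fip W \<phi> P = fip W \<phi> (A W (inv_tr W P))"
    unfolding inv_tr_props(2)[OF assms(1,2)] by (rule fip_cong[OF face[OF assms(1)]]) (auto simp: restr_eq)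
  also have "\<dots> = fip W (A W \<phi>) (inv_tr W P)"
    by (rule face_op_selfadjoint[OF face[OF assms(1)] A[OF assms(1)] assms(3) inv_tr_props(1)[OF assms(1,2)], symmetric])
  finally show ?thesis .
qed

lemma fip_add_left:
  assumes "W \<in> faces V" "a \<in> ptrace p W" "b \<in> ptrace p W" "c \<in> ptrace p W"
  shows "fip W (\<lambda>x. a x + b x) c = fip W a c + fip W b c"
  using sesqD(1)[OF sesq_fip[OF face[OF assms(1)]] assms(2-4), of 1 1] by simp

lemma PF_ptrace: "f \<in> PF p W \<Longrightarrow> f \<in> ptrace p W"
  using PF_subset_ptrace by blast

section \<open>Energy identity and the case without defect\<close>

lemma local_energy:
  assumes P: "pdeg p P" and U: "\<And>i. pdeg p (\<lambda>x. U x $ i)"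
    and g: "\<And>W. W \<in> faces V \<Longrightarrow> g W \<in> PF p W"
    and eqs: "local_eqs p A \<kappa> \<eta> V g P U"
  shows "(\<Sum>W\<in>faces V. Re (fip W (A W (\<lambda>x. inv_tr W P x + ntr W U x)) (\<lambda>x. inv_tr W P x + ntr W U x)))
      + (\<Sum>W\<in>faces V. Re (fip W (A W (\<lambda>x. g W x - (inv_tr W P x - ntr W U x)))
          (\<lambda>x. g W x - (inv_tr W P x - ntr W U x))))
    = (\<Sum>W\<in>faces V. Re (fip W (A W (g W)) (g W)))"
proof -
  let ?a = "\<lambda>W. inv_tr W P" and ?b = "\<lambda>W. ntr W U" and ?n = "\<lambda>W. ndot (nrm W) U"
  \<comment> \<open>The volume pairing of a function with itself is real, so the terms with the
    factor \<open>\<i>\<close> vanish from the real parts of both tested equations.\<close>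
  have real: "Im (vol_ip K f f) = 0" for f
    using vol_ip_commute[of K f f] by (metis complex_cnj_cancel_iff complex_eq_iff cnj.simps(2) neg_equal_zero)
  have imag: "Re (- \<i> * complex_of_real c * vol_ip K f f) = 0" for c f
    using real[of f] by simp
  have vreal: "Re (- \<i> * complex_of_real c * vvol_ip K U U) = 0" for c
    unfolding vvol_ip_eq_sum[OF simplex_finite[OF V] U U] sum_distrib_left Re_sum
    using imag by (simp only: sum.neutral_const)
  have e1: "- \<i> * complex_of_real (\<kappa> / \<eta>) * vol_ip K P P - vvol_ip K U (cgrad P)
      + (\<Sum>W\<in>faces V. 1/2 * fip W (\<lambda>x. ?a W x + ?n W x) P) = (\<Sum>W\<in>faces V. 1/2 * fip W (g W) P)"
    using eqs P unfolding local_eqs_def poly_fun_iff_pdeg by blast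
  have e2: "- \<i> * complex_of_real (\<kappa> * \<eta>) * vvol_ip K U U - vol_ip K P (cdiv U)
      + (\<Sum>W\<in>faces V. 1/2 * fip W (\<lambda>x. P x + A W (?b W) x) (?n W))
      = - (\<Sum>W\<in>faces V. 1/2 * fip W (A W (g W)) (?n W))"
    using eqs U unfolding local_eqs_def vpoly_fun_def poly_fun_iff_pdeg by blast
  have n_tr: "?n W \<in> ptrace p W" for W by (intro pdeg_in_ptrace pdeg_ndot U)
  have P_tr: "P \<in> ptrace p W" for W by (rule pdeg_in_ptrace[OF P])
  have to_b: "fip W \<phi> (?n W) = fip W \<phi> (?b W)" if "W \<in> faces V" for W \<phi>
    by (rule fip_cong[OF face[OF that]]) (auto simp: restr_eq)
  have f1: "Re (fip W (\<lambda>x. ?a W x + ?n W x) P) = Re (fip W (A W (?a W)) (?a W)) + Re (fip W (?n W) P)"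
    if W: "W \<in> faces V" for W
    using fip_add_left[OF W PF_ptrace[OF inv_tr_props(1)[OF W P]] n_tr P_tr]
      fip_inv_tr[OF W P inv_tr_props(1)[OF W P]] by simp
  have f2: "Re (fip W (\<lambda>x. P x + A W (?b W) x) (?n W)) = Re (fip W (?n W) P) + Re (fip W (A W (?b W)) (?b W))"
    if W: "W \<in> faces V" for W
    using fip_add_left[OF W P_tr PF_ptrace[OF face_op_PF[OF face[OF W] A[OF W] ntr_PF[OF U]]] n_tr]
      to_b[OF W] fip_commute[of W P "?n W"] by simp
  \<comment> \<open>The two volume terms add up to the whole boundary pairing of the normal
    component with \<open>P\<close>. They enter the tested equations with a minus sign, and each
    equation also contains half of that pairing, so all this cancels and only A-norms and data
    remain.\<close>
  have "Re (vvol_ip K U (cgrad P)) + Re (vol_ip K P (cdiv U)) = (\<Sum>W\<in>faces V. Re (fip W (?n W) P))"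
    using arg_cong[OF integration_by_parts[OF V dim U P], of Re] vol_ip_commute[of K P "cdiv U"] by simp
  moreover have "- Re (vvol_ip K U (cgrad P))
      + (\<Sum>W\<in>faces V. 1/2 * (Re (fip W (A W (?a W)) (?a W)) + Re (fip W (?n W) P)))
      = (\<Sum>W\<in>faces V. 1/2 * Re (fip W (A W (g W)) (?a W)))"
    using arg_cong[OF e1, of Re] real[of P] by (simp add: f1 fip_inv_tr[OF _ P g])
  moreover have "- Re (vol_ip K P (cdiv U))
      + (\<Sum>W\<in>faces V. 1/2 * (Re (fip W (?n W) P) + Re (fip W (A W (?b W)) (?b W))))
      = - (\<Sum>W\<in>faces V. 1/2 * Re (fip W (A W (g W)) (?b W)))"
    using arg_cong[OF e2, of Re] vreal[of 1] by (simp add: f2 to_b[of _ "A _ (g _)"])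
  ultimately have bal: "(\<Sum>W\<in>faces V. Re (fip W (A W (?a W)) (?a W)) + Re (fip W (A W (?b W)) (?b W)))
      = (\<Sum>W\<in>faces V. Re (fip W (A W (g W)) (?a W)) - Re (fip W (A W (g W)) (?b W)))"
    unfolding sum_distrib_left[symmetric] sum.distrib sum_subtractf by argo
  have "(\<Sum>W\<in>faces V. Re (fip W (A W (\<lambda>x. ?a W x + ?b W x)) (\<lambda>x. ?a W x + ?b W x))
      + Re (fip W (A W (\<lambda>x. g W x - (?a W x - ?b W x))) (\<lambda>x. g W x - (?a W x - ?b W x))))
    = (\<Sum>W\<in>faces V. Re (fip W (A W (g W)) (g W))
      + 2 * (Re (fip W (A W (?a W)) (?a W)) + Re (fip W (A W (?b W)) (?b W)))
      - 2 * (Re (fip W (A W (g W)) (?a W)) - Re (fip W (A W (g W)) (?b W))))"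
    by (intro sum.cong refl face_norm_identity[OF face A] inv_tr_props P ntr_PF U g)
  also have "\<dots> = (\<Sum>W\<in>faces V. Re (fip W (A W (g W)) (g W)))"
    unfolding sum_subtractf sum.distrib[of "\<lambda>W. Re (fip W (A W (g W)) (g W))"] sum_distrib_left[symmetric] bal by simp
  finally show ?thesis by (simp only: sum.distrib)
qed

text \<open>Each of the two equations lowers the degree, so only zero remains.\<close>

lemma strong_equations_zero:
  assumes P: "pdeg k P" and U: "\<And>i. pdeg k (U i)" and c: "c \<noteq> 0" "d \<noteq> 0"
    and div: "\<And>x. c * P x = (\<Sum>i\<in>UNIV. pdiff i (U i) x)"
    and grad: "\<And>i x. d * U i x = pdiff i P x"
  shows "P = (\<lambda>_. 0) \<and> (\<forall>i. U i = (\<lambda>_. 0))"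
  using P U
proof (induction k)
  case 0
  have "pdiff i P = (\<lambda>_. 0)" "pdiff i (U i) = (\<lambda>_. 0)" for i
    using pdeg_has_pdiff[OF 0(1)] pdeg_has_pdiff[OF 0(2)] by auto
  then show ?case using div grad c by (auto simp: fun_eq_iff)
next
  case (Suc k)
  have "pdeg k (\<lambda>x. (1 / c) * (\<Sum>i\<in>UNIV. pdiff i (U i) x))"
    using pdeg_pdiff[OF Suc.prems(2)] by (intro pdeg_scale pdeg_sum) auto
  then have "pdeg k P" using c(1) by (simp flip: div)
  moreover have "pdeg k (U i)" for i
  proof -
    have "pdeg k (\<lambda>x. (1 / d) * pdiff i P x)"
      using pdeg_pdiff[OF Suc.prems(1)] by (intro pdeg_scale) auto
    then show ?thesis using c(2) by (simp flip: grad)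
  qed
  ultimately show ?case by (rule Suc.IH)
qed

text \<open>For such data the boundary terms of each equation collapse to the one produced by
  integration by parts. What is left says that the residuals \<open>R\<close> and \<open>G\<close>
  of the strong equations are orthogonal to all test polynomials; being polynomials of degree at
  most \<open>p\<close> themselves, they may be used as test functions and so vanish.\<close>

lemma local_matched_zero:
  assumes P: "pdeg p P" and U: "\<And>i. pdeg p (\<lambda>x. U x $ i)"
    and eqs: "local_eqs p A \<kappa> \<eta> V g P U"
    and match: "\<And>W. W \<in> faces V \<Longrightarrow> g W = (\<lambda>x. inv_tr W P x - ntr W U x)"
  shows "P = (\<lambda>_. 0) \<and> U = (\<lambda>_. 0)"
proof -
  let ?a = "\<lambda>W. inv_tr W P" and ?b = "\<lambda>W. ntr W U" and ?n = "\<lambda>W. ndot (nrm W) U"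
  have n_tr: "?n W \<in> ptrace p W" for W by (intro pdeg_in_ptrace pdeg_ndot U)
  have P_tr: "P \<in> ptrace p W" for W by (rule pdeg_in_ptrace[OF P])
  have a_tr: "?a W \<in> ptrace p W" if "W \<in> faces V" for W
    using PF_ptrace[OF inv_tr_props(1)[OF that P]] .
  have Ab_tr: "A W (?b W) \<in> ptrace p W" if "W \<in> faces V" for W
    using PF_ptrace[OF face_op_PF[OF face[OF that] A[OF that] ntr_PF[OF U]]] .
  let ?i1 = "\<i> * complex_of_real (\<kappa> / \<eta>)" and ?i2 = "\<i> * complex_of_real (\<kappa> * \<eta>)"
  define R where "R x = cdiv U x - ?i1 * P x" for x
  define G where "G i x = pdiff i P x - ?i2 * U x $ i" for i x
  have R: "pdeg p R"
    using pdeg_comb[OF pdeg_cdiv[OF U] P, of 1 "- ?i1"] by (simp add: R_def[abs_def])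
  have G: "pdeg p (G i)" for i
    using pdeg_comb[OF pdeg_pdiff'[OF P] U, of 1 i "- ?i2" i] by (simp add: G_def[abs_def])
  have "vol_ip K R q = 0" if q: "pdeg p q" for q
  proof -
    have q_tr: "q \<in> ptrace p W" for W by (rule pdeg_in_ptrace[OF q])
    have e: "- \<i> * complex_of_real (\<kappa> / \<eta>) * vol_ip K P q - vvol_ip K U (cgrad q)
        + (\<Sum>W\<in>faces V. 1/2 * fip W (\<lambda>x. ?a W x + ?n W x) q) = (\<Sum>W\<in>faces V. 1/2 * fip W (g W) q)"
      using eqs q unfolding local_eqs_def poly_fun_iff_pdeg by blast
    have face_eq: "1/2 * fip W (\<lambda>x. ?a W x + ?n W x) q = 1/2 * fip W (g W) q + fip W (?n W) q"
      if W: "W \<in> faces V" for W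
    proof -
      have "fip W (g W) q = fip W (\<lambda>x. 1 * ?a W x + (-1) * ?n W x) q"
        unfolding match[OF W] by (rule fip_cong[OF face[OF W]]) (auto simp: restr_eq)
      also have "\<dots> = fip W (?a W) q - fip W (?n W) q"
        using sesqD(1)[OF sesq_fip[OF face[OF W]] a_tr[OF W] n_tr q_tr, of 1 "-1"] by simp
      finally have "fip W (g W) q = fip W (?a W) q - fip W (?n W) q" .
      then show ?thesis
        unfolding fip_add_left[OF W a_tr[OF W] n_tr q_tr] by (simp add: diff_divide_distrib add_divide_distrib)
    qed
    have "(\<Sum>W\<in>faces V. 1/2 * fip W (\<lambda>x. ?a W x + ?n W x) q)
        = (\<Sum>W\<in>faces V. 1/2 * fip W (g W) q) + (\<Sum>W\<in>faces V. fip W (?n W) q)"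
      unfolding sum.distrib[symmetric] by (intro sum.cong refl face_eq)
    with e have "- \<i> * complex_of_real (\<kappa> / \<eta>) * vol_ip K P q - vvol_ip K U (cgrad q)
        + (\<Sum>W\<in>faces V. fip W (?n W) q) = 0" by (simp add: algebra_simps)
    moreover have "vol_ip K R q = vol_ip K (cdiv U) q - ?i1 * vol_ip K P q"
      using sesqD(1)[OF sesq_vol_ip[OF simplex_finite[OF V], of p], of "cdiv U" P q 1 "- ?i1"]
        pdeg_cdiv[OF U] P q by (simp add: R_def[abs_def])
    ultimately show ?thesis
      unfolding integration_by_parts[OF V dim U q, symmetric] by simp
  qed
  from this[OF R] have R0: "R = (\<lambda>_. 0)"
    using pdeg_zero_if_norm_integral_zero[OF V, of "{()}" p "\<lambda>_. R"] R by simp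
  have "(\<Sum>i\<in>UNIV. vol_ip K (G i) (\<lambda>x. v x $ i)) = 0" if v: "\<And>i. pdeg p (\<lambda>x. v x $ i)" for v
  proof -
    let ?m = "\<lambda>W. ndot (nrm W) v"
    have m_tr: "?m W \<in> ptrace p W" for W by (intro pdeg_in_ptrace pdeg_ndot v)
    have e: "- \<i> * complex_of_real (\<kappa> * \<eta>) * vvol_ip K U v - vol_ip K P (cdiv v)
        + (\<Sum>W\<in>faces V. 1/2 * fip W (\<lambda>x. P x + A W (?b W) x) (?m W))
        = - (\<Sum>W\<in>faces V. 1/2 * fip W (A W (g W)) (?m W))"
      using eqs v unfolding local_eqs_def vpoly_fun_def poly_fun_iff_pdeg by blast
    have face_eq: "1/2 * fip W (\<lambda>x. P x + A W (?b W) x) (?m W) = fip W P (?m W) - 1/2 * fip W (A W (g W)) (?m W)"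
      if W: "W \<in> faces V" for W
    proof -
      have "A W (\<lambda>x. 1 * ?a W x + (-1) * ?b W x) = (\<lambda>x. 1 * A W (?a W) x + (-1) * A W (?b W) x)"
        using face_op_lin[OF face[OF W] A[OF W]] inv_tr_props(1)[OF W P] ntr_PF[OF U]
        unfolding lin_map_def by blast
      then have "A W (g W) = (\<lambda>x. 1 * restr (convex hull W) P x + (-1) * A W (?b W) x)"
        using match[OF W] inv_tr_props(2)[OF W P] by simp
      then have "fip W (A W (g W)) (?m W) = fip W (\<lambda>x. 1 * P x + (-1) * A W (?b W) x) (?m W)"
        by (intro fip_cong[OF face[OF W]]) (auto simp: restr_eq)
      also have "\<dots> = fip W P (?m W) - fip W (A W (?b W)) (?m W)"
        using sesqD(1)[OF sesq_fip[OF face[OF W]] P_tr Ab_tr[OF W] m_tr, of 1 "-1"] by simp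
      finally have "fip W (A W (g W)) (?m W) = fip W P (?m W) - fip W (A W (?b W)) (?m W)" .
      then show ?thesis
        unfolding fip_add_left[OF W P_tr Ab_tr[OF W] m_tr] by (simp add: diff_divide_distrib add_divide_distrib)
    qed
    have "(\<Sum>W\<in>faces V. 1/2 * fip W (\<lambda>x. P x + A W (?b W) x) (?m W))
        = (\<Sum>W\<in>faces V. fip W P (?m W)) - (\<Sum>W\<in>faces V. 1/2 * fip W (A W (g W)) (?m W))"
      unfolding sum_subtractf[symmetric] by (intro sum.cong refl face_eq)
    with e have e': "- \<i> * complex_of_real (\<kappa> * \<eta>) * vvol_ip K U v - vol_ip K P (cdiv v)
        + (\<Sum>W\<in>faces V. fip W P (?m W)) = 0" by (simp add: algebra_simps)
    have gr: "pdeg p (\<lambda>x. cgrad P x $ i)" for i by (simp add: cgrad_def pdeg_pdiff' P)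
    \<comment> \<open>Integration by parts for the pair \<open>v\<close>, \<open>P\<close>,
      conjugated because here \<open>P\<close> sits in the first slot and the test field in the
      second.\<close>
    have "cnj (vvol_ip K v (cgrad P)) + vol_ip K P (cdiv v) = (\<Sum>W\<in>faces V. fip W P (?m W))"
      using arg_cong[OF integration_by_parts[OF V dim v P], of cnj]
      by (simp add: fip_commute[of _ P] vol_ip_commute[of K P "cdiv v"])
    moreover have "cnj (vvol_ip K v (cgrad P)) = (\<Sum>i\<in>UNIV. vol_ip K (pdiff i P) (\<lambda>x. v x $ i))"
      unfolding vvol_ip_eq_sum[OF simplex_finite[OF V] v gr]
      by (simp add: vol_ip_commute[of K "pdiff _ P"] cgrad_def)
    ultimately have "(\<Sum>i\<in>UNIV. vol_ip K (pdiff i P) (\<lambda>x. v x $ i)) - ?i2 * vvol_ip K U v = 0"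
      using e' by (simp add: algebra_simps)
    moreover have "vol_ip K (G i) (\<lambda>x. v x $ i)
        = vol_ip K (pdiff i P) (\<lambda>x. v x $ i) - ?i2 * vol_ip K (\<lambda>x. U x $ i) (\<lambda>x. v x $ i)" for i
      using sesqD(1)[OF sesq_vol_ip[OF simplex_finite[OF V], of p], of "pdiff i P" "\<lambda>x. U x $ i" "\<lambda>x. v x $ i" 1 "- ?i2"]
        pdeg_pdiff'[OF P] U v by (simp add: G_def[abs_def])
    ultimately show ?thesis
      unfolding vvol_ip_eq_sum[OF simplex_finite[OF V] U v] by (simp add: sum_subtractf sum_distrib_left)
  qed
  from this[of "\<lambda>x. \<chi> i. G i x"] have "(\<Sum>i\<in>UNIV. vol_ip K (G i) (G i)) = 0"
    using G by simp
  then have G0: "G i = (\<lambda>_. 0)" for i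
    using pdeg_zero_if_norm_integral_zero[OF V finite_class.finite_UNIV, of p G] G by blast
  have "P = (\<lambda>_. 0) \<and> (\<forall>i. (\<lambda>x. U x $ i) = (\<lambda>_. 0))"
  proof (rule strong_equations_zero[OF P U])
    show "?i1 \<noteq> 0" "?i2 \<noteq> 0" using kappa eta by auto
    show "?i1 * P x = (\<Sum>i\<in>UNIV. pdiff i (\<lambda>x. U x $ i) x)" for x
      using fun_cong[OF R0, of x] by (simp add: R_def cdiv_def)
    show "?i2 * U x $ i = pdiff i P x" for i x
      using fun_cong[OF G0[of i], of x] by (simp add: G_def)
  qed
  then show ?thesis by (auto simp: fun_eq_iff vec_eq_iff)
qed

section \<open>Well-posedness of the local problem\<close>

definition local_form ::
  "('d option \<times> (real^'d) \<Rightarrow> complex) \<Rightarrow> ('d option \<times> (real^'d) \<Rightarrow> complex) \<Rightarrow> complex" where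
  "local_form z y =
     (- \<i> * complex_of_real (\<kappa> / \<eta>) * vol_ip K (scal z) (scal y) - vvol_ip K (vect z) (cgrad (scal y))
       + (\<Sum>W\<in>faces V. 1/2 * fip W (\<lambda>x. inv_tr W (scal z) x + ndot (nrm W) (vect z) x) (scal y)))
   + (- \<i> * complex_of_real (\<kappa> * \<eta>) * vvol_ip K (vect z) (vect y) - vol_ip K (scal z) (cdiv (vect y))
       + (\<Sum>W\<in>faces V. 1/2 * fip W (\<lambda>x. scal z x + A W (ntr W (vect z)) x) (ndot (nrm W) (vect y))))"

definition local_rhs ::
  "((real^'d) set \<Rightarrow> real^'d \<Rightarrow> complex) \<Rightarrow> ('d option \<times> (real^'d) \<Rightarrow> complex) \<Rightarrow> complex" where
  "local_rhs g y = (\<Sum>W\<in>faces V. 1/2 * fip W (g W) (scal y))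
     + - (\<Sum>W\<in>faces V. 1/2 * fip W (A W (g W)) (ndot (nrm W) (vect y)))"

text \<open>Adding the two equations loses nothing: test pairs with one component zero give them
  back separately.\<close>

lemma local_eqs_iff:
  assumes "z \<in> pair_polys p"
  shows "local_eqs p A \<kappa> \<eta> V g (scal z) (vect z) \<longleftrightarrow> (\<forall>y\<in>pair_polys p. local_form z y = local_rhs g y)"
proof
  assume "local_eqs p A \<kappa> \<eta> V g (scal z) (vect z)"
  note e = this[unfolded local_eqs_def poly_fun_iff_pdeg vpoly_fun_def]
  show "\<forall>y\<in>pair_polys p. local_form z y = local_rhs g y"
  proof
    fix y :: "'d option \<times> (real^'d) \<Rightarrow> complex" assume y: "y \<in> pair_polys p"
    have "\<forall>i. pdeg p (\<lambda>x. vect y x $ i)" using pair_polys_pdeg(2)[OF y] by blast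
    note e12 = e[THEN conjunct1, THEN spec[of _ "scal y"], THEN mp, OF pair_polys_pdeg(1)[OF y]]
      e[THEN conjunct2, THEN spec[of _ "vect y"], THEN mp, OF this]
    show "local_form z y = local_rhs g y"
      unfolding local_form_def local_rhs_def by (simp only: e12)
  qed
next
  assume eq: "\<forall>y\<in>pair_polys p. local_form z y = local_rhs g y"
  have zero: "cgrad (\<lambda>_. 0) = (\<lambda>_. 0)" "cdiv (\<lambda>_. 0) = (\<lambda>_. 0)" "ndot n (\<lambda>_. 0) = (\<lambda>_. 0)" for n
    by (simp_all add: cgrad_def cdiv_def ndot_def pdiff_zero fun_eq_iff vec_eq_iff)
  have ip: "vol_ip K f (\<lambda>_. 0) = 0" "vvol_ip K u (\<lambda>_. 0) = 0" for f u
    by (simp_all add: vol_ip_def vvol_ip_def)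
  show "local_eqs p A \<kappa> \<eta> V g (scal z) (vect z)"
    unfolding local_eqs_def poly_fun_iff_pdeg vpoly_fun_def
  proof (intro conjI allI impI)
    fix q :: "real^'d \<Rightarrow> complex" assume "pdeg p q"
    then have "pair_of q (\<lambda>_. 0) \<in> pair_polys p" by (intro pair_of_in) (auto intro: pdeg.const)
    from bspec[OF eq this] show "- \<i> * complex_of_real (\<kappa> / \<eta>) * vol_ip K (scal z) q
        - vvol_ip K (vect z) (cgrad q)
        + (\<Sum>W\<in>faces V. 1/2 * fip W (\<lambda>x. inv_tr W (scal z) x + ndot (nrm W) (vect z) x) q)
        = (\<Sum>W\<in>faces V. 1/2 * fip W (g W) q)"
      by (simp add: local_form_def local_rhs_def zero ip fip_zero)
  next
    fix v :: "real^'d \<Rightarrow> complex^'d" assume "\<forall>i. pdeg p (\<lambda>x. v x $ i)"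
    then have "pair_of (\<lambda>_. 0) v \<in> pair_polys p" by (intro pair_of_in) (auto intro: pdeg.const)
    from bspec[OF eq this] show "- \<i> * complex_of_real (\<kappa> * \<eta>) * vvol_ip K (vect z) v
        - vol_ip K (scal z) (cdiv v)
        + (\<Sum>W\<in>faces V. 1/2 * fip W (\<lambda>x. scal z x + A W (ntr W (vect z)) x) (ndot (nrm W) v))
        = - (\<Sum>W\<in>faces V. 1/2 * fip W (A W (g W)) (ndot (nrm W) v))"
      by (simp add: local_form_def local_rhs_def zero ip fip_zero)
  qed
qed

lemma lin_tr:
  "lin_map S {f. pdeg p f} L \<Longrightarrow> lin_map S (ptrace p W) L"
  "lin_map S (PF p W) L \<Longrightarrow> lin_map S (ptrace p W) L"
  by (auto intro: lin_map_mono pdeg_in_ptrace PF_ptrace)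

lemma sesq_local_form: "sesq (pair_polys p) local_form"
proof (rule sesq_cong[OF pair_polys_comb_closed])
  let ?vol = "vol_ip K"
  \<comment> \<open>\<open>local_form\<close> split into single pairings, each an inner product
    composed with linear maps into polynomials or traces. The splitting is valid only on
    \<open>pair_polys p\<close>, hence \<open>sesq_cong\<close>.\<close>
  define t where "t z y = ((- \<i> * complex_of_real (\<kappa> / \<eta>)) * ?vol (scal z) (scal y)
       - (\<Sum>i\<in>UNIV. ?vol (\<lambda>x. vect z x $ i) (pdiff i (scal y)))
       + (\<Sum>W\<in>faces V. 1/2 * (fip W (inv_tr W (scal z)) (scal y) + fip W (ndot (nrm W) (vect z)) (scal y))))
     + ((- \<i> * complex_of_real (\<kappa> * \<eta>)) * (\<Sum>i\<in>UNIV. ?vol (\<lambda>x. vect z x $ i) (\<lambda>x. vect y x $ i))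
       - ?vol (scal z) (cdiv (vect y))
       + (\<Sum>W\<in>faces V. 1/2 * (fip W (scal z) (ndot (nrm W) (vect y))
           + fip W (A W (ntr W (vect z))) (ndot (nrm W) (vect y)))))" for z y
  show "local_form z y = t z y" if z: "z \<in> pair_polys p" and y: "y \<in> pair_polys p" for z y
  proof -
    note zp = pair_polys_pdeg[OF z] and yp = pair_polys_pdeg[OF y]
    have g: "pdeg p (\<lambda>x. cgrad (scal y) x $ i)" for i by (simp add: cgrad_def pdeg_pdiff' yp)
    have v1: "vvol_ip K (vect z) (cgrad (scal y)) = (\<Sum>i\<in>UNIV. ?vol (\<lambda>x. vect z x $ i) (pdiff i (scal y)))"
      unfolding vvol_ip_eq_sum[OF simplex_finite[OF V] zp(2) g] by (simp add: cgrad_def)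
    have f1: "fip W (\<lambda>x. inv_tr W (scal z) x + ndot (nrm W) (vect z) x) (scal y)
        = fip W (inv_tr W (scal z)) (scal y) + fip W (ndot (nrm W) (vect z)) (scal y)"
      if W: "W \<in> faces V" for W
      by (intro fip_add_left W PF_ptrace[OF inv_tr_props(1)] pdeg_in_ptrace pdeg_ndot zp yp)
    have f2: "fip W (\<lambda>x. scal z x + A W (ntr W (vect z)) x) (ndot (nrm W) (vect y))
        = fip W (scal z) (ndot (nrm W) (vect y)) + fip W (A W (ntr W (vect z))) (ndot (nrm W) (vect y))"
      if W: "W \<in> faces V" for W
      by (rule fip_add_left[OF W pdeg_in_ptrace[OF zp(1)]
          PF_ptrace[OF face_op_PF[OF face[OF W] A[OF W] ntr_PF[OF zp(2)]]] pdeg_in_ptrace[OF pdeg_ndot[OF yp(2)]]])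
    show ?thesis
      unfolding local_form_def t_def v1 vvol_ip_eq_sum[OF simplex_finite[OF V] zp(2) yp(2)]
      by (simp add: f1 f2)
  qed
  have inv: "lin_map (pair_polys p) (PF p W) (\<lambda>z. inv_tr W (scal z))" if W: "W \<in> faces V" for W
    by (rule lin_map_comp[OF face_op_inv_lin[OF face[OF W] A[OF W]] lin_map_comp[OF lin_restr lin_scal]])
  have Ab: "lin_map (pair_polys p) (PF p W) (\<lambda>z. A W (ntr W (vect z)))" if W: "W \<in> faces V" for W
    by (rule lin_map_comp[OF face_op_lin[OF face[OF W] A[OF W]] lin_map_comp[OF lin_restr lin_ndot]])
  note vol = sesq_comp[OF sesq_vol_ip[OF simplex_finite[OF V], of p]]
  note fip = sesq_comp[OF sesq_fip[of _ p]]
  show "sesq (pair_polys p) t"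
    unfolding t_def[abs_def]
    by (intro sesq_add sesq_diff sesq_scale sesq_sum vol fip lin_scal lin_component lin_cdiv
        lin_map_comp[OF lin_pdiff lin_scal] face lin_tr(1)[OF lin_scal] lin_tr(1)[OF lin_ndot]
        lin_tr(2)[OF inv] lin_tr(2)[OF Ab])
qed

text \<open>A kernel element solves the local problem for zero data. Its energy identity is a sum of
  nonnegative terms equal to 0, so on every face \<open>inv_tr\<close> and \<open>ntr\<close> agree,
  which is the hypothesis of \<open>local_matched_zero\<close> for zero data.\<close>

lemma local_form_nondegenerate:
  assumes z: "z \<in> pair_polys p" and zero: "\<And>y. y \<in> pair_polys p \<Longrightarrow> local_form z y = 0"
  shows "z = (\<lambda>_. 0)"
proof -
  let ?g = "\<lambda>_::(real^'d) set. \<lambda>_::real^'d. 0::complex"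
  note zp = pair_polys_pdeg[OF z]
  have A0: "A W (\<lambda>_. 0) = (\<lambda>_. 0)" if "W \<in> faces V" for W
    by (rule face_op_zero[OF face[OF that] A[OF that]])
  have "local_rhs ?g y = 0" for y
    unfolding local_rhs_def by (simp add: A0 fip_zero)
  then have eqs: "local_eqs p A \<kappa> \<eta> V ?g (scal z) (vect z)"
    unfolding local_eqs_iff[OF z] using zero by simp
  let ?s = "\<lambda>W x. inv_tr W (scal z) x + ntr W (vect z) x"
  let ?d = "\<lambda>W x. 0 - (inv_tr W (scal z) x - ntr W (vect z) x)"
  have PFd: "?d W \<in> PF p W" if "W \<in> faces V" for W
    using PF_comb[OF inv_tr_props(1)[OF that zp(1)] ntr_PF[OF zp(2)], of "-1" 1] by simp
  have PFs: "?s W \<in> PF p W" if "W \<in> faces V" for W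
    using PF_comb[OF inv_tr_props(1)[OF that zp(1)] ntr_PF[OF zp(2)], of 1 1] by simp
  have "(\<Sum>W\<in>faces V. Re (fip W (A W (?s W)) (?s W))) + (\<Sum>W\<in>faces V. Re (fip W (A W (?d W)) (?d W)))
      = (\<Sum>W\<in>faces V. Re (fip W (A W (?g W)) (?g W)))"
    by (rule local_energy[OF zp(1) zp(2) _ eqs]) (rule PF_zero)
  also have "\<dots> = 0" by (simp add: fip_zero)
  finally have sum0: "(\<Sum>W\<in>faces V. Re (fip W (A W (?s W)) (?s W))) + (\<Sum>W\<in>faces V. Re (fip W (A W (?d W)) (?d W))) = 0" .
  have nn: "0 \<le> Re (fip W (A W (?s W)) (?s W))" "0 \<le> Re (fip W (A W (?d W)) (?d W))" if "W \<in> faces V" for W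
    using face_op_nonneg[OF face[OF that] A[OF that]] PFs[OF that] PFd[OF that] by blast+
  have "0 \<le> (\<Sum>W\<in>faces V. Re (fip W (A W (?s W)) (?s W)))" by (rule sum_nonneg) (rule nn(1))
  moreover have "0 \<le> (\<Sum>W\<in>faces V. Re (fip W (A W (?d W)) (?d W)))" by (rule sum_nonneg) (rule nn(2))
  ultimately have "(\<Sum>W\<in>faces V. Re (fip W (A W (?d W)) (?d W))) = 0" using sum0 by linarith
  then have "\<forall>W\<in>faces V. Re (fip W (A W (?d W)) (?d W)) = 0"
    by (subst (asm) sum_nonneg_eq_0_iff[OF finite_faces[OF V]]) (rule nn(2))
  then have d0: "?d W = (\<lambda>_. 0)" if "W \<in> faces V" for W
    using face_op_pos[OF face[OF that] A[OF that] PFd[OF that]] that by fastforce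
  have "scal z = (\<lambda>_. 0) \<and> vect z = (\<lambda>_. 0)"
  proof (rule local_matched_zero[OF zp(1) zp(2) eqs])
    show "?g W = (\<lambda>x. inv_tr W (scal z) x - ntr W (vect z) x)" if "W \<in> faces V" for W
      using d0[OF that] by (simp add: fun_eq_iff)
  qed
  then have "z = pair_of (\<lambda>_. 0) (\<lambda>_. 0)" using pair_of_scal_vect[of z] by simp
  then show ?thesis by (auto simp: pair_of_def fun_eq_iff split: option.split)
qed

text \<open>The trivial kernel gives existence in finite dimension and, applied to a difference of
  solutions, uniqueness. This licenses treating \<open>local_sol\<close> as an actual
  solution.\<close>

lemma local_solution_unique:
  assumes g: "\<And>W. W \<in> faces V \<Longrightarrow> g W \<in> PF p W"
  shows "\<exists>!(P, U). poly_fun p P \<and> vpoly_fun p U \<and> local_eqs p A \<kappa> \<eta> V g P U"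
proof -
  have "\<exists>z\<in>pair_polys p. \<forall>y\<in>pair_polys p. local_form z y = local_rhs g y"
  proof (rule sesq_nondegenerate_represents[where I = "UNIV \<times> mono_exps p"
        and F = "\<lambda>(j, \<alpha>) k. if fst k = j then \<Prod>i\<in>UNIV. complex_of_real ((snd k $ i) ^ \<alpha> i) else 0"])
    show "finite ((UNIV :: 'd option set) \<times> (mono_exps p :: ('d \<Rightarrow> nat) set))" by simp
    show "\<exists>c. z = (\<lambda>i. \<Sum>k\<in>UNIV \<times> mono_exps p. c k *
        (case k of (j, \<alpha>) \<Rightarrow> \<lambda>k. if fst k = j then \<Prod>i\<in>UNIV. complex_of_real ((snd k $ i) ^ \<alpha> i) else 0) i)"
      if "z \<in> pair_polys p" for z
      using pair_polys_finite_span[OF that] by (simp add: case_prod_unfold)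
    show "(\<lambda>_. 0) \<in> pair_polys p" by (simp add: pair_polys_def pdeg.const)
    show "comb_closed (pair_polys p)" by (rule pair_polys_comb_closed)
    show "sesq (pair_polys p) local_form" by (rule sesq_local_form)
    show "z = (\<lambda>_. 0)" if "z \<in> pair_polys p" "\<And>y. y \<in> pair_polys p \<Longrightarrow> local_form z y = 0" for z
      using that by (rule local_form_nondegenerate)
    fix x y :: "'d option \<times> (real^'d) \<Rightarrow> complex" and c d
    assume x: "x \<in> pair_polys p" and y: "y \<in> pair_polys p"
    let ?z = "\<lambda>i. c * x i + d * y i"
    have s: "scal ?z = (\<lambda>i. c * scal x i + d * scal y i)"
      using lin_scal x y unfolding lin_map_def by blast
    have n: "ndot m (vect ?z) = (\<lambda>i. c * ndot m (vect x) i + d * ndot m (vect y) i)" for m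
      using lin_ndot[of p m] x y unfolding lin_map_def by blast
    note xp = pair_polys_pdeg[OF x] and yp = pair_polys_pdeg[OF y]
    have f1: "fip W (g W) (scal ?z) = cnj c * fip W (g W) (scal x) + cnj d * fip W (g W) (scal y)"
      if W: "W \<in> faces V" for W
      unfolding s
      by (rule sesqD(2)[OF sesq_fip[OF face[OF W], of p]]) (intro pdeg_in_ptrace PF_ptrace g W xp yp)+
    have f2: "fip W (A W (g W)) (ndot (nrm W) (vect ?z))
        = cnj c * fip W (A W (g W)) (ndot (nrm W) (vect x)) + cnj d * fip W (A W (g W)) (ndot (nrm W) (vect y))"
      if W: "W \<in> faces V" for W
      unfolding n
      by (rule sesqD(2)[OF sesq_fip[OF face[OF W], of p]])
        (intro pdeg_in_ptrace pdeg_ndot PF_ptrace[OF face_op_PF[OF face A]] g W xp yp)+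
    show "local_rhs g ?z = cnj c * local_rhs g x + cnj d * local_rhs g y"
      unfolding local_rhs_def
      by (simp add: f1 f2 sum.distrib sum_distrib_left algebra_simps add_divide_distrib)
  qed
  then obtain z where z: "z \<in> pair_polys p" "\<forall>y\<in>pair_polys p. local_form z y = local_rhs g y" by blast
  show ?thesis
  proof (rule ex1I[of _ "(scal z, vect z)"])
    show "case (scal z, vect z) of (P, U) \<Rightarrow> poly_fun p P \<and> vpoly_fun p U \<and> local_eqs p A \<kappa> \<eta> V g P U"
      using pair_polys_pdeg[OF z(1)] z local_eqs_iff[OF z(1)] by (simp add: poly_fun_iff_pdeg vpoly_fun_def)
    fix PU assume PU: "case PU of (P, U) \<Rightarrow> poly_fun p P \<and> vpoly_fun p U \<and> local_eqs p A \<kappa> \<eta> V g P U"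
    obtain P U where [simp]: "PU = (P, U)" by (cases PU)
    define w where "w = pair_of P U"
    have w: "w \<in> pair_polys p"
      using PU unfolding w_def by (intro pair_of_in) (auto simp: poly_fun_iff_pdeg vpoly_fun_def)
    have w_eq: "\<forall>y\<in>pair_polys p. local_form w y = local_rhs g y"
      using PU unfolding local_eqs_iff[OF w, symmetric] by (simp add: w_def)
    have "(\<lambda>i. 1 * w i + (-1) * z i) = (\<lambda>_. 0)"
    proof (rule local_form_nondegenerate)
      show "(\<lambda>i. 1 * w i + (-1) * z i) \<in> pair_polys p"
        using pair_polys_comb_closed w z(1) unfolding comb_closed_def by blast
      show "local_form (\<lambda>i. 1 * w i + (-1) * z i) y = 0" if y: "y \<in> pair_polys p" for y
        using sesqD(1)[OF sesq_local_form w z(1) y, of 1 "-1"] w_eq z(2) y by simp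
    qed
    then have "w = z" by (simp add: fun_eq_iff)
    then show "PU = (scal z, vect z)" by (simp add: w_def flip: \<open>w = z\<close>)
  qed
qed

text \<open>The norm is a sum over elements and the operator acts element by element, so the
  comparison is local: the defect in the energy identity is never negative, and it is positive once
  the data on the element are nonzero.\<close>

lemma scatter_face_sum:
  fixes g :: "(real^'d) set \<Rightarrow> (real^'d) set \<Rightarrow> real^'d \<Rightarrow> complex"
  assumes g: "\<And>W. W \<in> faces V \<Longrightarrow> g V W \<in> PF p W" and k: "k V = \<kappa>" "e V = \<eta>"
  shows "(\<Sum>W\<in>faces V. (face_norm W (A W) (scatter p A k e g V W))\<^sup>2)
      \<le> (\<Sum>W\<in>faces V. (face_norm W (A W) (g V W))\<^sup>2)"
    and "\<exists>W\<in>faces V. g V W \<noteq> (\<lambda>_. 0) \<Longrightarrow>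
      (\<Sum>W\<in>faces V. (face_norm W (A W) (scatter p A k e g V W))\<^sup>2)
      < (\<Sum>W\<in>faces V. (face_norm W (A W) (g V W))\<^sup>2)"
proof -
  obtain P U where PU: "local_sol p A \<kappa> \<eta> V (g V) = (P, U)" by fastforce
  have "case local_sol p A \<kappa> \<eta> V (g V) of (P, U) \<Rightarrow>
      poly_fun p P \<and> vpoly_fun p U \<and> local_eqs p A \<kappa> \<eta> V (g V) P U"
    unfolding local_sol_def by (rule theI'[OF local_solution_unique]) (rule g)
  then have P: "pdeg p P" and U: "\<And>i. pdeg p (\<lambda>x. U x $ i)" and eqs: "local_eqs p A \<kappa> \<eta> V (g V) P U"
    by (simp_all add: PU poly_fun_iff_pdeg vpoly_fun_def)
  let ?s = "\<lambda>W x. inv_tr W P x + ntr W U x"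
  let ?d = "\<lambda>W x. g V W x - (inv_tr W P x - ntr W U x)"
  have sc: "scatter p A k e g V W = ?s W" for W
    by (simp add: scatter_def k PU)
  have PFs: "?s W \<in> PF p W" if "W \<in> faces V" for W
    using PF_comb[OF inv_tr_props(1)[OF that P] ntr_PF[OF U], of 1 1] by simp
  have PFd: "?d W \<in> PF p W" if "W \<in> faces V" for W
  proof -
    have "?d W = (\<lambda>x. 1 * g V W x + (-1) * (1 * inv_tr W P x + (-1) * ntr W U x))"
      by (simp add: fun_eq_iff)
    then show ?thesis
      using PF_comb[OF g[OF that] PF_comb[OF inv_tr_props(1)[OF that P] ntr_PF[OF U], of 1 "-1"], of 1 "-1"]
      by (simp only:)
  qed
  have sq: "(face_norm W (A W) \<phi>)\<^sup>2 = Re (fip W (A W \<phi>) \<phi>)" if "W \<in> faces V" "\<phi> \<in> PF p W" for W \<phi>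
    unfolding face_norm_def using face_op_nonneg[OF face[OF that(1)] A[OF that(1)] that(2)] by simp
  have energy: "(\<Sum>W\<in>faces V. (face_norm W (A W) (?s W))\<^sup>2) + (\<Sum>W\<in>faces V. (face_norm W (A W) (?d W))\<^sup>2)
      = (\<Sum>W\<in>faces V. (face_norm W (A W) (g V W))\<^sup>2)"
    using local_energy[OF P U g eqs] by (simp add: sq PFs PFd g)
  show "(\<Sum>W\<in>faces V. (face_norm W (A W) (scatter p A k e g V W))\<^sup>2)
      \<le> (\<Sum>W\<in>faces V. (face_norm W (A W) (g V W))\<^sup>2)"
    unfolding sc using energy sum_nonneg[of "faces V" "\<lambda>W. (face_norm W (A W) (?d W))\<^sup>2"] by simp
  assume nz: "\<exists>W\<in>faces V. g V W \<noteq> (\<lambda>_. 0)"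
  \<comment> \<open>A zero defect forces \<open>P\<close> and \<open>U\<close> to vanish, and the
    data, being the difference of their traces, vanish with them.\<close>
  have "(\<Sum>W\<in>faces V. (face_norm W (A W) (?d W))\<^sup>2) \<noteq> 0"
  proof
    assume "(\<Sum>W\<in>faces V. (face_norm W (A W) (?d W))\<^sup>2) = 0"
    then have "(face_norm W (A W) (?d W))\<^sup>2 = 0" if "W \<in> faces V" for W
      using that by (simp add: sum_nonneg_eq_0_iff[OF finite_faces[OF V]])
    then have "Re (fip W (A W (?d W)) (?d W)) = 0" if "W \<in> faces V" for W
      using that sq[OF that PFd[OF that]] by simp
    then have d0: "?d W = (\<lambda>_. 0)" if "W \<in> faces V" for W
      using face_op_pos[OF face[OF that] A[OF that] PFd[OF that]] that by fastforce
    then have match: "g V W = (\<lambda>x. inv_tr W P x - ntr W U x)" if "W \<in> faces V" for W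
      using that by (simp add: fun_eq_iff)
    have PU0: "P = (\<lambda>_. 0)" "U = (\<lambda>_. 0)"
      using local_matched_zero[OF P U eqs match] by auto
    have "g V W = (\<lambda>_. 0)" if W: "W \<in> faces V" for W
    proof -
      have "restr (convex hull W) (\<lambda>_. 0) = (\<lambda>_. 0 :: complex)" by (simp add: restr_def fun_eq_iff)
      moreover have "face_op_inv p W (A W) (\<lambda>_. 0) = (\<lambda>_. 0)"
        by (rule face_op_inv_eq[OF face[OF W] A[OF W] PF_zero face_op_zero[OF face[OF W] A[OF W]]])
      moreover have "ndot n (\<lambda>_::real^'d. 0) = (\<lambda>_. 0)" for n :: "real^'d"
        by (simp add: ndot_def fun_eq_iff)
      ultimately show ?thesis unfolding match[OF W] PU0 by simp
    qed
    then show False using nz by blast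
  qed
  then have "0 < (\<Sum>W\<in>faces V. (face_norm W (A W) (?d W))\<^sup>2)"
    using sum_nonneg[of "faces V" "\<lambda>W. (face_norm W (A W) (?d W))\<^sup>2"] by simp
  then show "(\<Sum>W\<in>faces V. (face_norm W (A W) (scatter p A k e g V W))\<^sup>2)
      < (\<Sum>W\<in>faces V. (face_norm W (A W) (g V W))\<^sup>2)"
    unfolding sc using energy by simp
qed

end

theorem mainTheorem5:
  fixes \<Omega> :: "(real^'d::finite) set"
    and T :: "(real^'d) set set"
    and p :: nat
    and \<kappa> \<eta> :: "(real^'d) set \<Rightarrow> real"
    and A :: "(real^'d) set \<Rightarrow> (real^'d \<Rightarrow> complex) \<Rightarrow> (real^'d \<Rightarrow> complex)"
    and g :: "(real^'d) set \<Rightarrow> (real^'d) set \<Rightarrow> real^'d \<Rightarrow> complex"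
  assumes dim: "CARD('d) = 2 \<or> CARD('d) = 3"
    and dom: "polytopal_domain \<Omega>"
    and mesh: "conforming_mesh \<Omega> T"
    and kappa_pos: "\<forall>V\<in>T. \<kappa> V > 0"
    and eta_pos: "\<forall>V\<in>T. \<eta> V > 0"
    and A_ok: "\<forall>V\<in>T. \<forall>W\<in>faces V. admissible_face_op p W (A W)"
    and g_Gh: "in_Gh p T g"
    and g_nz: "\<exists>V\<in>T. \<exists>W\<in>faces V. g V W \<noteq> (\<lambda>_. 0)"
  shows "Gh_norm T A (scatter p A \<kappa> \<eta> g) < Gh_norm T A g"
proof -
  have fin: "finite T" and simplex: "\<And>V. V \<in> T \<Longrightarrow> simplex_verts V"
    using mesh by (auto simp: conforming_mesh_def)
  have le: "(\<Sum>W\<in>faces V. (face_norm W (A W) (scatter p A \<kappa> \<eta> g V W))\<^sup>2)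
      \<le> (\<Sum>W\<in>faces V. (face_norm W (A W) (g V W))\<^sup>2)" if "V \<in> T" for V
    by (rule scatter_face_sum(1)[OF dim simplex[OF that], of "\<kappa> V" "\<eta> V"])
      (use that kappa_pos eta_pos A_ok g_Gh in \<open>auto simp: in_Gh_def\<close>)
  \<comment> \<open>One element with nonzero data suffices: the weak inequality on all others
    preserves strictness of the sum.\<close>
  obtain V0 where V0: "V0 \<in> T" "\<exists>W\<in>faces V0. g V0 W \<noteq> (\<lambda>_. 0)" using g_nz by blast
  have less: "(\<Sum>W\<in>faces V0. (face_norm W (A W) (scatter p A \<kappa> \<eta> g V0 W))\<^sup>2)
      < (\<Sum>W\<in>faces V0. (face_norm W (A W) (g V0 W))\<^sup>2)"
    by (rule scatter_face_sum(2)[OF dim simplex[OF V0(1)], of "\<kappa> V0" "\<eta> V0"])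
      (use V0 kappa_pos eta_pos A_ok g_Gh in \<open>auto simp: in_Gh_def\<close>)
  show ?thesis
    unfolding Gh_norm_def real_sqrt_less_iff
    using le less V0(1) by (intro sum_strict_mono_ex1[OF fin]) auto
qed

end
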